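(* Let $\mathcal R=\mathcal R(\mathbb F_2)$, $\mathcal N=\mathcal N(\mathbb F_2)$, and $\mathcal A$, $\mathcal A_m$ be as in the context. For all integers $n\ge2$, $$\gamma_n(\mathcal R)\cong\mathcal A_{2n-3}\ltimes\gamma_n(\mathcal N),$$ and the lower central quotients are $$\gamma_i(\mathcal R)/\gamma_{i+1}(\mathcal R)\cong\begin{cases}(\mathbb Z_2)^3\times\mathbb Z_4 & \text{if } i=1,\\ (\mathbb Z_2)^4 & \text{if } i\ge2 \text{ is even},\\ (\mathbb Z_2)^6 & \text{if } i>1 \text{ is odd}.\end{cases}$$ Moreover, letting $F_{\mathcal R}:\mathcal R\to\mathcal R^{ab}=\mathcal R/\gamma_2(\mathcal R)$ be the abelianization map, $a=F_{\mathcal R}((1+t,t))$ and $b_i=F_{\mathcal R}((1,t+t^{i+1}))$ for $i\ge1$, the abelian group $\mathcal R^{ab}$ has the presentation $$\langle a,\ b_1,\ b_1b_2,\ b_4\mid a^2=(b_1b_2)^2=b_4^2=b_1^4=1,\ [b_i,b_j]=1,\ [a,b_i]=1\rangle,$$ i.e. $\mathcal R^{ab}$ is the direct product of the cyclic subgroups generated by $a$ (order 2), $b_1$ (order 4), $b_1b_2$ (order 2) and $b_4$ (order 2).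
   Context: The Riordan group $\mathcal R=\mathcal R(\mathbb F_2)$ consists of pairs $(g,f)$ of formal power series over $\mathbb F_2$ with $g=1+g_1t+\cdots$, $f=t+f_2t^2+\cdots$, identified with lower triangular matrices $(d_{n,k})$, $d_{n,k}=[t^n]gf^k$; the product is $(g_1,f_1)(g_2,f_2)=(g_1\cdot(g_2\circ f_1),\,f_2\circ f_1)$, identity $(1,t)$. It is a pro-2 group, the inverse limit of its finite truncations (upper-left $(n+1)\times(n+1)$ corners), with the corresponding profinite ($t$-adic) topology. The Appell subgroup $\mathcal A=\{(g,t)\}$ is normal abelian; for $m\ge0$, $\mathcal A_m=\{(g,t): g\equiv1\pmod{t^{m+1}}\}$. The Nottingham group $\mathcal N=\mathcal N(\mathbb F_2)=\{(1,f)\}$ is a subgroup, and $\mathcal R=\mathcal A\rtimes\mathcal N$. The lower central series is $\gamma_1(G)=G$, $\gamma_{i}(G)=[\gamma_{i-1}(G),G]$, where for closed normal subgroups $X,Y$, $[X,Y]$ is the smallest closed subgroup containing all commutators $[x,y]=x^{-1}y^{-1}xy$, $x\in X$, $y\in Y$. $\mathbb Z_q=\mathbb Z/q\mathbb Z$. *)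

theory Defs
  imports "HOL-Library.Z2" "HOL-Computational_Algebra.Formal_Power_Series"
          "HOL-Algebra.Algebra"
begin

type_synonym rpair = "bit fps \<times> bit fps"

definition riordan_carrier :: "rpair set" where
  "riordan_carrier = {(g, f). fps_nth g 0 = 1 \<and> fps_nth f 0 = 0 \<and> fps_nth f 1 = 1}"

definition Riordan :: "rpair monoid" where
  "Riordan = \<lparr> carrier = riordan_carrier,
     mult = (\<lambda>(g1, f1) (g2, f2). (g1 * (g2 oo f1), f2 oo f1)),
     one = (1, fps_X) \<rparr>"

definition Appell :: "rpair set" where
  "Appell = {(g, f) \<in> riordan_carrier. f = fps_X}"

definition Appell_m :: "nat \<Rightarrow> rpair set" where
  "Appell_m m = {(g, f) \<in> Appell. \<forall>k. 1 \<le> k \<and> k \<le> m \<longrightarrow> fps_nth g k = 0}"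

definition Nottingham :: "rpair set" where
  "Nottingham = {(g, f) \<in> riordan_carrier. g = 1}"

text \<open>Closure in the profinite (t-adic) topology: x lies in the closure of S iff for every
  N some element of S agrees with x in all coefficients of index at most N (equivalently,
  has the same (N+1)x(N+1) truncation as a lower triangular matrix).\<close>
definition rclosure :: "rpair set \<Rightarrow> rpair set" where
  "rclosure S = {x \<in> riordan_carrier. \<forall>N. \<exists>h\<in>S. \<forall>k\<le>N.
       fps_nth (fst h) k = fps_nth (fst x) k \<and> fps_nth (snd h) k = fps_nth (snd x) k}"

definition rcomm :: "rpair \<Rightarrow> rpair \<Rightarrow> rpair" where
  "rcomm x y = mult Riordan (mult Riordan (mult Riordan (m_inv Riordan x) (m_inv Riordan y)) x) y"

definition closed_comm :: "rpair set \<Rightarrow> rpair set \<Rightarrow> rpair set" where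
  "closed_comm P Q = Inter {K. subgroup K Riordan \<and> rclosure K = K \<and>
                          {rcomm x y | x y. x \<in> P \<and> y \<in> Q} \<subseteq> K}"

text \<open>lcs_aux H k = gamma_(k+1)(H).\<close>
primrec lcs_aux :: "rpair set \<Rightarrow> nat \<Rightarrow> rpair set" where
  "lcs_aux H 0 = H"
| "lcs_aux H (Suc k) = closed_comm (lcs_aux H k) H"

definition gamma :: "rpair set \<Rightarrow> nat \<Rightarrow> rpair set" where
  "gamma H i = lcs_aux H (i - 1)"

definition Zmod :: "nat \<Rightarrow> int monoid" where
  "Zmod q = integer_mod_group q"

definition Rab :: "rpair set monoid" where
  "Rab = Riordan Mod (gamma riordan_carrier 2)"

definition F_R :: "rpair \<Rightarrow> rpair set" where
  "F_R x = gamma riordan_carrier 2 #>\<^bsub>Riordan\<^esub> x"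

end

theory Submission
  imports Defs
begin

text \<open>
  Write a series over \<open>\<bbbF>\<^sub>2\<close> as \<open>f = P\<^sup>2 + t S\<^sup>2\<close> with \<open>P\<close> its even and \<open>S\<close> its odd part. Since
  squaring is additive, \<open>S\<close> is multiplicative under substitution: the odd part of \<open>f \<circ> h\<close> is
  \<open>S\<^sub>h \<cdot> (S\<^sub>f \<circ> h)\<close>. So \<open>f \<mapsto> (S\<^sub>f, f)\<close> embeds the Nottingham group into the Riordan group, and the
  easy fact that \<open>\<gamma>\<^sub>n(\<R>)\<close> has first component congruent to 1 modulo \<open>t\<^bsup>2n-2\<^esup>\<close> already forces the
  coefficients of \<open>S\<^sub>f\<close> of index \<open>1, \<dots>, 2n - 3\<close> to vanish for \<open>f \<in> \<gamma>\<^sub>n(\<N>)\<close>. Computing two more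
  coefficients of the odd part of a commutator gives the remaining linear conditions on \<open>\<gamma>\<^sub>n(\<N>)\<close>:
  the coefficients of \<open>S\<^sub>f\<close> of index \<open>2n - 2\<close> (\<open>n\<close> even) and \<open>2n - 1\<close> are determined by the
  leading coefficient of \<open>P\<^sub>f\<close>.

  Conversely, a closed subgroup that contains, for every element of a group \<open>D\<close>, an element of \<open>D\<close>
  with the same leading coefficients contains \<open>D\<close>. Suitable leading coefficients come from explicit
  commutators with \<open>t + t\<^sup>2\<close> and \<open>t + t\<^sup>3\<close>. The quotients are read off from the coefficients that
  are additive on \<open>\<gamma>\<^sub>n\<close> and whose common kernel is \<open>\<gamma>\<^bsub>n+1\<^esub>\<close>.
\<close>

text \<open>The obstacle is that the terms of the series of the Nottingham group are not cut out by
  the order of \<open>f - t\<close> alone: their last conditions link coefficients of the even and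
  the odd part and depend on the parity of \<open>n\<close>. Two facts of characteristic 2 are
  behind this. First, \<open>t^(2k)\<close> composed with \<open>h\<close> agrees with
  \<open>t^(2k)\<close> modulo \<open>t^(2k+2)\<close>, so commuting a series congruent to 1 modulo
  \<open>t^(2k)\<close> with a substitution gains two degrees at once; this is the reason for the
  exponents \<open>2n - 2\<close>. Second, \<open>t^n\<close> composed with \<open>y\<close> has
  \<open>n * y_2\<close> as the coefficient after the leading one, and \<open>t^(2n-2)\<close>
  composed with \<open>y\<close> has \<open>(n - 1) * y_2\<close> two places after it; here the
  parity of \<open>n\<close> enters. Commutators are computed without inverse series, because
  \<open>c = [x, y]\<close> solves \<open>(y x) c = x y\<close>. The expected terms are given by
  explicit linear conditions, and each is recognized as the kernel of an additive coefficient map on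
  the preceding one. This yields both that it is a group and what the quotient is.\<close>

section \<open>Truncated power series over the field with two elements\<close>

text \<open>These simp rules of \<open>Z2\<close> turn sums and products of bits into bit operations, which blocks
  ring normalization.\<close>
declare add_bit_eq_xor [simp del] mult_bit_eq_and [simp del] power_bit_unfold [simp del]

lemma bit_add_self [simp]: "a + a = (0::bit)"
  by (cases a) simp_all

lemma bit_add_self_left [simp]: "a + (a + b) = (b::bit)"
  by (simp flip: add.assoc)

lemma bit_mult_self [simp]: "a * a = (a::bit)"
  by (cases a) simp_all

lemma bit_mult_self_left [simp]: "a * (a * b) = a * (b::bit)"
  by (simp flip: mult.assoc)

lemma bit_add_eq_0_iff: "a + b = 0 \<longleftrightarrow> a = (b::bit)"
  by (cases a; cases b) simp_all

lemma bit_fps_add_self [simp]: "f + f = (0::bit fps)"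
  by (rule fps_ext) (simp only: fps_add_nth bit_add_self fps_zero_nth)

lemma bit_fps_add_self_left [simp]: "f + (f + g) = (g::bit fps)"
  by (simp flip: add.assoc)

section \<open>Congruence of series modulo a power of t\<close>

definition agree :: "nat \<Rightarrow> 'a fps \<Rightarrow> 'a fps \<Rightarrow> bool" where
  "agree m f g \<longleftrightarrow> (\<forall>k<m. fps_nth f k = fps_nth g k)"

lemma agreeD: "agree m f g \<Longrightarrow> k < m \<Longrightarrow> fps_nth f k = fps_nth g k"
  by (simp add: agree_def)

lemma agree_refl [simp]: "agree m f f"
  by (simp add: agree_def)

lemma agree_sym: "agree m f g \<Longrightarrow> agree m g f"
  by (simp add: agree_def)

lemma agree_trans [trans]: "agree m f g \<Longrightarrow> agree m g h \<Longrightarrow> agree m f h"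
  by (simp add: agree_def)

lemma agree_mono: "agree m f g \<Longrightarrow> k \<le> m \<Longrightarrow> agree k f g"
  by (simp add: agree_def)

lemma agree_add: "agree m f f' \<Longrightarrow> agree m g g' \<Longrightarrow> agree m (f + g) (f' + g')"
  by (simp add: agree_def)

lemma agree_mult:
  fixes f g :: "'a::comm_ring_1 fps"
  shows "agree m f f' \<Longrightarrow> agree m g g' \<Longrightarrow> agree m (f * g) (f' * g')"
  by (auto simp: agree_def fps_mult_nth intro!: sum.cong)

lemma agree_power:
  fixes f g :: "'a::comm_ring_1 fps"
  shows "agree m f g \<Longrightarrow> agree m (f ^ i) (g ^ i)"
  by (induction i) (auto intro: agree_mult)

lemma agree_compose:
  fixes f g x y :: "'a::comm_ring_1 fps"
  shows "agree m f g \<Longrightarrow> agree m x y \<Longrightarrow> agree m (f oo x) (g oo y)"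
  unfolding agree_def fps_compose_nth
  by (auto intro!: sum.cong simp: agree_power[unfolded agree_def, rule_format, of m x y])

lemma agree_0_iff:
  fixes f :: "'a::comm_ring_1 fps"
  shows "agree m f 0 \<longleftrightarrow> f = fps_X ^ m * fps_shift m f"
proof
  assume "agree m f 0"
  then show "f = fps_X ^ m * fps_shift m f"
    by (intro fps_ext) (auto simp: fps_X_power_mult_nth agree_def)
next
  assume f: "f = fps_X ^ m * fps_shift m f"
  show "agree m f 0"
    by (subst f) (simp add: agree_def fps_X_power_mult_nth)
qed

lemma agree_0_mult:
  fixes f g :: "'a::comm_ring_1 fps"
  assumes "agree m f 0" "agree k g 0"
  shows "agree (m + k) (f * g) 0"
proof -
  have "f * g = (fps_X ^ m * fps_shift m f) * (fps_X ^ k * fps_shift k g)"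
    using assms unfolding agree_0_iff by (rule arg_cong2)
  also have "\<dots> = fps_X ^ (m + k) * (fps_shift m f * fps_shift k g)"
    by (simp add: power_add mult_ac)
  finally show ?thesis
    by (simp add: agree_def fps_X_power_mult_nth)
qed

lemma agree_0_compose:
  fixes f x :: "'a::idom fps"
  assumes "agree m f 0" "fps_nth x 0 = 0"
  shows "agree m (f oo x) 0"
  using assms agree_compose[of m f 0 x x] by simp

lemma mult_nth_lead:
  fixes r u :: "'a::comm_ring_1 fps"
  assumes "agree m u 0"
  shows "fps_nth (r * u) m = fps_nth r 0 * fps_nth u m"
    and "fps_nth (r * u) (Suc m) = fps_nth r 0 * fps_nth u (Suc m) + fps_nth r 1 * fps_nth u m"
proof -
  have "r * u = fps_X ^ m * (r * fps_shift m u)"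
    using assms by (metis agree_0_iff mult.left_commute)
  then have *: "fps_nth (r * u) (m + j) = fps_nth (r * fps_shift m u) j" for j
    by (simp add: fps_X_power_mult_nth)
  show "fps_nth (r * u) m = fps_nth r 0 * fps_nth u m"
    using *[of 0] by simp
  show "fps_nth (r * u) (Suc m) = fps_nth r 0 * fps_nth u (Suc m) + fps_nth r 1 * fps_nth u m"
    using *[of 1] by simp
qed

lemma agree_mult_cancel:
  fixes r f g :: "'a::field fps"
  assumes "agree m (r * f) (r * g)" "fps_nth r 0 \<noteq> 0"
  shows "agree m f g"
  using agree_mult[OF agree_refl[of m "inverse r"] assms(1)] inverse_mult_eq_1[OF assms(2)]
  by (simp flip: mult.assoc)

lemma agree_compose_cancel:
  fixes f g x :: "'a::field fps"
  assumes "agree m (f oo x) (g oo x)" "fps_nth x 0 = 0" "fps_nth x 1 \<noteq> 0"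
  shows "agree m f g"
proof -
  have "fps_nth (fps_inv x) 0 = 0"
    by (simp add: fps_inv_def)
  then have "f = (f oo x) oo fps_inv x" "g = (g oo x) oo fps_inv x"
    using assms(2,3) by (simp_all flip: fps_compose_assoc add: fps_inv_right)
  then show ?thesis
    using agree_compose[OF assms(1) agree_refl[of m "fps_inv x"]] by simp
qed

section \<open>Leading coefficients of a composition\<close>

lemma compose_nth_1: 
  fixes u h :: "'a::comm_ring_1 fps"
  shows "fps_nth (u oo h) 1 = fps_nth u 1 * fps_nth h 1"
  by (simp add: fps_compose_nth)

lemma compose_nth_2_3:
  fixes u h :: "bit fps"
  assumes "fps_nth h 0 = 0" "fps_nth h 1 = 1"
  shows "fps_nth (u oo h) 2 = fps_nth u 2 + fps_nth u 1 * fps_nth h 2"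
    and "fps_nth (u oo h) 3 = fps_nth u 3 + fps_nth u 1 * fps_nth h 3"
  using assms
  by (simp_all add: fps_compose_nth fps_mult_nth eval_nat_numeral algebra_simps)

text \<open>With \<open>h = t * H\<close>, composing \<open>t^m * v\<close> with \<open>h\<close>
  gives \<open>t^m * H^m\<close> times the composition of \<open>v\<close> with \<open>h\<close>, so
  only low coefficients of \<open>H^m\<close> have to be known.\<close>

lemma compose_nth_shift:
  fixes u h :: "'a::idom fps"
  assumes "agree m u 0" "fps_nth h 0 = 0"
  shows "fps_nth (u oo h) (m + j) = fps_nth (fps_shift 1 h ^ m * (fps_shift m u oo h)) j"
proof -
  have "h = fps_X * fps_shift 1 h"
    using assms(2) agree_0_iff[of 1 h] by (simp add: agree_def)
  then have h: "h ^ m = fps_X ^ m * fps_shift 1 h ^ m"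
    by (metis power_mult_distrib)
  have "u oo h = (fps_X ^ m * fps_shift m u) oo h"
    using assms(1) unfolding agree_0_iff by (rule arg_cong)
  also have "\<dots> = (fps_X ^ m oo h) * (fps_shift m u oo h)"
    using assms(2) by (rule fps_compose_mult_distrib)
  also have "fps_X ^ m oo h = h ^ m"
    using assms(2) by (simp flip: fps_compose_power)
  finally have "u oo h = fps_X ^ m * (fps_shift 1 h ^ m * (fps_shift m u oo h))"
    by (simp add: h mult_ac)
  then show ?thesis
    by (simp add: fps_X_power_mult_nth)
qed

text \<open>Squaring is additive, so it merely spreads the coefficients to the even positions. The
  induction goes in steps of two because splitting off the constant coefficient of \<open>p\<close>
  costs a factor \<open>t^2\<close> in the square.\<close>

lemma bit_fps_square_nth:
  fixes p :: "bit fps"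
  shows "fps_nth (p ^ 2) k = (if even k then fps_nth p (k div 2) else 0)"
proof (induction k arbitrary: p rule: induct_nat_012)
  case (ge2 k)
  define c where "c = fps_const (fps_nth p 0)"
  have "p = c + fps_X * fps_shift 1 p"
    by (rule fps_ext) (simp add: c_def)
  then have "p ^ 2 = (c + fps_X * fps_shift 1 p) ^ 2"
    by simp
  also have "\<dots> = c * c + fps_X ^ 2 * (fps_shift 1 p) ^ 2"
    by (simp add: power2_eq_square algebra_simps)
  also have "c * c = c"
    by (simp add: c_def)
  finally have "fps_nth (p ^ 2) (Suc (Suc k)) = fps_nth ((fps_shift 1 p) ^ 2) k"
    by (simp add: fps_X_power_mult_nth c_def)
  with ge2(1) show ?case by simp
qed (simp_all add: power2_eq_square)

text \<open>An even power of \<open>p\<close> is a power of \<open>p^2\<close>, which is a series in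
  \<open>t^2\<close>; hence the odd coefficients vanish.\<close>

lemma power_even_nth:
  fixes p :: "bit fps"
  assumes "fps_nth p 0 = 1"
  shows "fps_nth (p ^ (2 * l)) 0 = 1" "fps_nth (p ^ (2 * l)) 1 = 0"
    "fps_nth (p ^ (2 * l)) 2 = of_nat l * fps_nth p 1" "fps_nth (p ^ (2 * l)) 3 = 0"
proof -
  define q where "q = p ^ 2"
  have q: "fps_nth q 0 = 1" "fps_nth q (Suc 0) = 0" "fps_nth q (Suc (Suc 0)) = fps_nth p 1"
    "fps_nth q (Suc (Suc (Suc 0))) = 0"
    using assms by (simp_all add: q_def bit_fps_square_nth)
  have "fps_nth (q ^ l) 0 = 1 \<and> fps_nth (q ^ l) (Suc 0) = 0 \<and>
    fps_nth (q ^ l) (Suc (Suc 0)) = of_nat l * fps_nth p 1 \<and> fps_nth (q ^ l) (Suc (Suc (Suc 0))) = 0"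
    by (induction l) (simp_all add: q fps_mult_nth distrib_right add_ac)
  then show "fps_nth (p ^ (2 * l)) 0 = 1" "fps_nth (p ^ (2 * l)) 1 = 0"
    "fps_nth (p ^ (2 * l)) 2 = of_nat l * fps_nth p 1" "fps_nth (p ^ (2 * l)) 3 = 0"
    by (simp_all only: q_def power_mult numeral_2_eq_2 numeral_3_eq_3 One_nat_def)
qed

text \<open>For even order the factor \<open>H^(2l)\<close> of
  \<open>h^(2l) = t^(2l) * H^(2l)\<close> is \<open>1 + l * h_2 * t^2\<close> up to
  \<open>t^3\<close>, so little interferes with the composition of the shifted series. The fourth
  coefficient is what the coefficient \<open>2 * n + 1\<close> of a commutator requires later, with
  \<open>l = n - 1\<close>.\<close>

lemma compose_nth_even:
  fixes u h :: "bit fps"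
  assumes "agree (2 * l) u 0" "fps_nth h 0 = 0" "fps_nth h 1 = 1"
  shows "fps_nth (u oo h) (2 * l) = fps_nth u (2 * l)"
    "fps_nth (u oo h) (2 * l + 1) = fps_nth u (2 * l + 1)"
    "fps_nth (u oo h) (2 * l + 2) = fps_nth u (2 * l + 2) + fps_nth u (2 * l + 1) * fps_nth h 2
       + of_nat l * fps_nth h 2 * fps_nth u (2 * l)"
    "fps_nth (u oo h) (2 * l + 3) = fps_nth u (2 * l + 3)
       + fps_nth u (2 * l + 1) * (fps_nth h 3 + of_nat l * fps_nth h 2)"
proof -
  define A B where "A = fps_shift 1 h ^ (2 * l)" and "B = (fps_shift (2 * l) u oo h)"
  have "fps_nth (fps_shift 1 h) 0 = 1" "fps_nth (fps_shift 1 h) 1 = fps_nth h 2"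
    using assms(3) by (simp_all add: eval_nat_numeral)
  then have A: "fps_nth A 0 = 1" "fps_nth A 1 = 0" "fps_nth A 2 = of_nat l * fps_nth h 2"
    "fps_nth A 3 = 0"
    using power_even_nth[of "fps_shift 1 h" l] by (simp_all add: A_def)
  have B: "fps_nth B 0 = fps_nth u (2 * l)" "fps_nth B 1 = fps_nth u (2 * l + 1)"
    "fps_nth B 2 = fps_nth u (2 * l + 2) + fps_nth u (2 * l + 1) * fps_nth h 2"
    "fps_nth B 3 = fps_nth u (2 * l + 3) + fps_nth u (2 * l + 1) * fps_nth h 3"
    using compose_nth_2_3[OF assms(2,3), of "fps_shift (2 * l) u"] assms(3)
      compose_nth_1[of "fps_shift (2 * l) u" h]
    by (simp_all add: B_def add_ac)
  have *: "fps_nth (u oo h) (2 * l + j) = (\<Sum>i=0..j. fps_nth A i * fps_nth B (j - i))" for j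
    unfolding A_def B_def compose_nth_shift[OF assms(1,2)] fps_mult_nth ..
  have s: "{0..1::nat} = {0,1}" "{0..2::nat} = {0,1,2}" "{0..3::nat} = {0,1,2,3}"
    by auto
  show "fps_nth (u oo h) (2 * l) = fps_nth u (2 * l)"
    using *[of 0] A B by simp
  show "fps_nth (u oo h) (2 * l + 1) = fps_nth u (2 * l + 1)"
    using *[of 1] A B unfolding s by simp
  show "fps_nth (u oo h) (2 * l + 2) = fps_nth u (2 * l + 2) + fps_nth u (2 * l + 1) * fps_nth h 2
       + of_nat l * fps_nth h 2 * fps_nth u (2 * l)"
    using *[of 2] A B unfolding s by (simp add: mult_ac)
  show "fps_nth (u oo h) (2 * l + 3) = fps_nth u (2 * l + 3)
       + fps_nth u (2 * l + 1) * (fps_nth h 3 + of_nat l * fps_nth h 2)"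
    using *[of 3] A B unfolding s by (simp add: algebra_simps)
qed

text \<open>A series of odd order \<open>m\<close> is treated as one of even order
  \<open>m - 1\<close> with leading coefficient zero.\<close>

lemma compose_nth_lead:
  fixes u h :: "bit fps"
  assumes "agree m u 0" "fps_nth h 0 = 0" "fps_nth h 1 = 1"
  shows "fps_nth (u oo h) m = fps_nth u m"
    "fps_nth (u oo h) (Suc m) = fps_nth u (Suc m) + of_nat m * fps_nth h 2 * fps_nth u m"
proof -
  obtain l where "m = 2 * l \<or> m = 2 * l + 1"
    by (metis oddE evenE)
  moreover {
    assume m: "m = 2 * l"
    have "fps_nth (u oo h) m = fps_nth u m \<and>
      fps_nth (u oo h) (Suc m) = fps_nth u (Suc m) + of_nat m * fps_nth h 2 * fps_nth u m"
      using compose_nth_even[of l u h] assms m by simp }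
  moreover {
    assume m: "m = 2 * l + 1"
    then have "agree (2 * l) u 0" "fps_nth u (2 * l) = 0"
      using assms(1) by (auto simp: agree_def)
    then have "fps_nth (u oo h) m = fps_nth u m \<and>
      fps_nth (u oo h) (Suc m) = fps_nth u (Suc m) + of_nat m * fps_nth h 2 * fps_nth u m"
      using compose_nth_even[of l u h] assms m by (simp add: mult_ac) }
  ultimately show "fps_nth (u oo h) m = fps_nth u m"
    "fps_nth (u oo h) (Suc m) = fps_nth u (Suc m) + of_nat m * fps_nth h 2 * fps_nth u m"
    by blast+
qed

text \<open>This is the Taylor expansion at \<open>t\<close> to first order. With
  \<open>d = x - t\<close> of order \<open>m\<close>, the product of \<open>d\<close> and the
  derivative of \<open>r\<close> is \<open>r_1 * d\<close> modulo \<open>t^(m+2)\<close>, since a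
  derivative has no linear coefficient in characteristic 2; the terms containing \<open>d^2\<close>
  have order at least \<open>2 * m\<close>, and \<open>m \<ge> 2\<close>.\<close>

lemma compose_near_X:
  fixes r x :: "bit fps"
  assumes "agree m x fps_X" "m \<ge> 2"
  shows "fps_nth (r oo x) m = fps_nth r m + fps_nth r 1 * fps_nth x m"
    "fps_nth (r oo x) (Suc m) = fps_nth r (Suc m) + fps_nth r 1 * fps_nth x (Suc m)"
proof -
  define d where "d = x + fps_X"
  have x: "x = fps_X + d"
    by (simp add: d_def add_ac)
  have x0: "fps_nth x 0 = 0"
    using agreeD[OF assms(1), of 0] assms(2) by simp
  have d: "agree m d 0"
    using agree_add[OF assms(1) agree_refl[of m fps_X]] by (simp add: d_def)
  define c where "c = fps_const (fps_nth r 0) + fps_const (fps_nth r 1) * fps_X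
    + fps_const (fps_nth r 2) * fps_X ^ 2"
  define R where "R = fps_shift 3 r"
  have "fps_nth r k = fps_nth (c + fps_X ^ 3 * R) k" for k
  proof -
    consider "k = 0" | "k = 1" | "k = 2" | "k \<ge> 3" by linarith
    then show ?thesis
      by cases (auto simp: c_def R_def fps_X_power_mult_nth)
  qed
  then have r: "r = c + fps_X ^ 3 * R"
    by (intro fps_ext) auto
  have cx: "c oo x = c + fps_const (fps_nth r 1) * d + fps_const (fps_nth r 2) * d ^ 2"
  proof -
    have "c oo x = fps_const (fps_nth r 0) + fps_const (fps_nth r 1) * x
      + fps_const (fps_nth r 2) * x ^ 2"
      using x0 by (simp add: c_def fps_compose_add_distrib fps_compose_mult_distrib
        flip: fps_compose_power)
    also have "x ^ 2 = fps_X ^ 2 + d ^ 2"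
      unfolding x by (simp add: power2_eq_square algebra_simps)
    finally show ?thesis
      by (simp add: c_def x algebra_simps)
  qed
  have "agree (m + 2) ((fps_X ^ 3 * R) oo x) (fps_X ^ 3 * R)"
  proof -
    have "(fps_X ^ 3 * R) oo x = x ^ 3 * (R oo x)"
      using x0 by (simp add: fps_compose_mult_distrib flip: fps_compose_power)
    \<comment> \<open>The difference of cubes is \<open>d\<close> times a series of order 2, so
      replacing \<open>x^3\<close> by \<open>t^3\<close> changes nothing below
      \<open>t^(m+2)\<close>.\<close>
    also have "x ^ 3 = fps_X ^ 3 + d * (x ^ 2 + x * fps_X + fps_X ^ 2)"
      unfolding x by (simp add: power2_eq_square power3_eq_cube algebra_simps)
    finally have eq: "(fps_X ^ 3 * R) oo x = fps_X ^ 3 * (R oo x) +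
       d * ((x ^ 2 + x * fps_X + fps_X ^ 2) * (R oo x))"
      by (simp add: algebra_simps)
    have x1: "agree 1 x 0" "agree 1 fps_X (0::bit fps)"
      using x0 by (simp_all add: agree_def)
    have "agree 2 (x ^ 2 + x * fps_X + fps_X ^ 2) 0"
      using agree_0_mult[OF x1(1) x1(1)] agree_0_mult[OF x1(1) x1(2)] agree_0_mult[OF x1(2) x1(2)]
      by (simp add: agree_def power2_eq_square numeral_2_eq_2)
    then have "agree 2 ((x ^ 2 + x * fps_X + fps_X ^ 2) * (R oo x)) 0"
      using agree_0_mult[of 2 _ 0 "R oo x"] by (simp add: agree_def)
    from agree_0_mult[OF d this]
    have 1: "agree (m + 2) (d * ((x ^ 2 + x * fps_X + fps_X ^ 2) * (R oo x))) 0" .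
    have "agree m (R oo x) R"
      using agree_compose[OF agree_refl assms(1), of R] by simp
    then have "agree (m + 2) (fps_X ^ 3 * (R oo x)) (fps_X ^ 3 * R)"
      by (auto simp: agree_def fps_X_power_mult_nth)
    from agree_add[OF this 1] eq show ?thesis by simp
  qed
  moreover have "r oo x = (c oo x) + ((fps_X ^ 3 * R) oo x)"
    by (subst r) (rule fps_compose_add_distrib)
  moreover have "agree (m + 2) (d ^ 2) 0"
    using agree_0_mult[OF d d] assms(2) by (auto simp: agree_def power2_eq_square)
  ultimately have *: "agree (m + 2) (r oo x) (r + fps_const (fps_nth r 1) * d)"
    unfolding cx by (subst (2) r) (simp add: agree_def add_ac)
  have "fps_nth x m = fps_nth d m" "fps_nth x (Suc m) = fps_nth d (Suc m)"
    using assms(2) by (simp_all add: x)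
  then show "fps_nth (r oo x) m = fps_nth r m + fps_nth r 1 * fps_nth x m"
    "fps_nth (r oo x) (Suc m) = fps_nth r (Suc m) + fps_nth r 1 * fps_nth x (Suc m)"
    using agreeD[OF *, of m] agreeD[OF *, of "Suc m"] by simp_all
qed

section \<open>Even and odd parts of power series\<close>

definition even_part :: "'a fps \<Rightarrow> 'a fps" where "even_part f = Abs_fps (\<lambda>k. fps_nth f (2 * k))"
definition odd_part :: "'a fps \<Rightarrow> 'a fps" where "odd_part f = Abs_fps (\<lambda>k. fps_nth f (2 * k + 1))"
text \<open>Over the field with two elements this is \<open>P^2 + t * S^2\<close>, the inverse of
  passing to the two parts; it serves to write down witnesses with prescribed parts.\<close>

definition interleave :: "'a fps \<Rightarrow> 'a fps \<Rightarrow> 'a fps" where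
  "interleave P S = Abs_fps (\<lambda>k. if even k then fps_nth P (k div 2) else fps_nth S (k div 2))"

lemma even_part_nth: "fps_nth (even_part f) k = fps_nth f (2 * k)"
  by (simp add: even_part_def)
lemma odd_part_nth: "fps_nth (odd_part f) k = fps_nth f (2 * k + 1)"
  by (simp add: odd_part_def)

lemma even_part_interleave [simp]: "even_part (interleave P S) = P" and odd_part_interleave [simp]: "odd_part (interleave P S) = S"
  by (simp_all add: interleave_def fps_eq_iff even_part_nth odd_part_nth)

lemma nth_even_odd: "fps_nth f k = (if even k then fps_nth (even_part f) (k div 2) else fps_nth (odd_part f) (k div 2))"
  by (auto simp: even_part_nth odd_part_nth elim!: oddE)

lemma parts_unique:
  fixes A B :: "bit fps"
  assumes "f = A ^ 2 + fps_X * B ^ 2"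
  shows "even_part f = A" "odd_part f = B"
  by (simp_all add: assms fps_eq_iff even_part_nth odd_part_nth bit_fps_square_nth)

lemma parts_decompose:
  fixes f :: "bit fps"
  shows "f = (even_part f) ^ 2 + fps_X * (odd_part f) ^ 2"
proof (rule fps_ext)
  fix k
  show "fps_nth f k = fps_nth ((even_part f) ^ 2 + fps_X * (odd_part f) ^ 2) k"
    by (cases k) (auto simp: bit_fps_square_nth even_part_nth odd_part_nth)
qed

text \<open>Composing \<open>f = P^2 + t * S^2\<close> with \<open>h\<close> turns the factor
  \<open>t\<close> into \<open>h\<close>, whose own decomposition sorts the result into a square
  plus \<open>t\<close> times a square.\<close>

lemma parts_compose: 
  fixes f h :: "bit fps"
  assumes "fps_nth h 0 = 0"
  shows "odd_part (f oo h) = odd_part h * (odd_part f oo h)"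
    and "even_part (f oo h) = (even_part f oo h) + even_part h * (odd_part f oo h)"
proof -
  let ?P = "even_part f oo h" and ?S = "odd_part f oo h"
  have "f oo h = (even_part f ^ 2 + fps_X * odd_part f ^ 2) oo h"
    by (simp flip: parts_decompose)
  also have "\<dots> = ?P ^ 2 + h * ?S ^ 2"
    using assms by (simp add: fps_compose_add_distrib fps_compose_mult_distrib fps_compose_power)
  also have "\<dots> = ?P ^ 2 + (even_part h ^ 2 + fps_X * odd_part h ^ 2) * ?S ^ 2"
    by (simp flip: parts_decompose)
  also have "\<dots> = (?P + even_part h * ?S) ^ 2 + fps_X * (odd_part h * ?S) ^ 2"
    by (simp add: power2_eq_square algebra_simps)
  finally have "f oo h = (?P + even_part h * ?S) ^ 2 + fps_X * (odd_part h * ?S) ^ 2" .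
  then show "odd_part (f oo h) = odd_part h * ?S" "even_part (f oo h) = ?P + even_part h * ?S"
    by (rule parts_unique)+
qed

section \<open>The terms of the lower central series\<close>

lemma Riordan_simps [simp]:
  "carrier Riordan = riordan_carrier"
  "\<one>\<^bsub>Riordan\<^esub> = (1, fps_X)"
  "(g1, f1) \<otimes>\<^bsub>Riordan\<^esub> (g2, f2) = (g1 * (g2 oo f1), f2 oo f1)"
  by (simp_all add: Riordan_def)

lemma riordan_carrier_iff [simp]:
  "(g, f) \<in> riordan_carrier \<longleftrightarrow> fps_nth g 0 = 1 \<and> fps_nth f 0 = 0 \<and> fps_nth f 1 = 1"
  by (simp add: riordan_carrier_def)

lemma group_Riordan: "group Riordan"
proof (rule groupI)
  fix x y assume "x \<in> carrier Riordan" "y \<in> carrier Riordan"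
  then show "x \<otimes>\<^bsub>Riordan\<^esub> y \<in> carrier Riordan"
    by (cases x; cases y) (simp add: compose_nth_1[unfolded One_nat_def])
next
  fix x y z
  assume "x \<in> carrier Riordan" "y \<in> carrier Riordan" "z \<in> carrier Riordan"
  then show "x \<otimes>\<^bsub>Riordan\<^esub> y \<otimes>\<^bsub>Riordan\<^esub> z = x \<otimes>\<^bsub>Riordan\<^esub> (y \<otimes>\<^bsub>Riordan\<^esub> z)"
    by (cases x; cases y; cases z)
      (simp add: fps_compose_mult_distrib fps_compose_assoc mult.assoc)
next
  fix x assume "x \<in> carrier Riordan"
  then obtain g f where x: "x = (g, f)" and f: "fps_nth g 0 = 1" "fps_nth f 0 = 0" "fps_nth f 1 = 1"
    by (cases x) simp
  let ?h = "fps_inv f"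
  have h: "fps_nth ?h 0 = 0" "fps_nth ?h 1 = 1"
    using f by (simp_all add: fps_inv_def)
  have "(inverse (g oo ?h), ?h) \<otimes>\<^bsub>Riordan\<^esub> x = \<one>\<^bsub>Riordan\<^esub>"
    using f by (simp add: x fps_inv_right inverse_mult_eq_1)
  moreover have "(inverse (g oo ?h), ?h) \<in> carrier Riordan"
    using f h by simp
  ultimately show "\<exists>y\<in>carrier Riordan. y \<otimes>\<^bsub>Riordan\<^esub> x = \<one>\<^bsub>Riordan\<^esub>"
    by blast
qed (auto simp del: riordan_carrier_iff, simp_all)

interpretation R: group Riordan
  by (rule group_Riordan)

text \<open>The case \<open>n = 2\<close> is exceptional because there the coefficient of \<open>t\<^bsup>2n+1\<^esup>\<close>, that is
  \<open>odd_part f $ n\<close>, need not vanish and contributes to the commutators computed in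
  \<open>nottingham_comm_nth\<close> below.\<close>
definition nottingham_lcs :: "nat \<Rightarrow> bit fps set" where
  "nottingham_lcs n = {f. agree n (even_part f) 0 \<and> fps_nth (odd_part f) 0 = 1 \<and> agree (2 * n - 2) (odd_part f) 1 \<and>
     (n \<ge> 2 \<longrightarrow> (if odd n then fps_nth (odd_part f) (2 * n - 1) = fps_nth (even_part f) n
       else fps_nth (odd_part f) (2 * n - 2) = fps_nth (even_part f) n \<and>
            fps_nth (odd_part f) (2 * n - 1) = (if n = 2 then fps_nth (even_part f) n else 0)))}"

text \<open>The explicit candidate for \<open>gamma riordan_carrier n\<close>. The conditions on the
  two components are independent, which anticipates the semidirect decomposition.\<close>

definition riordan_lcs :: "nat \<Rightarrow> rpair set" where
  "riordan_lcs n = {(g, f). fps_nth g 0 = 1 \<and> agree (2 * n - 2) g 1 \<and> f \<in> nottingham_lcs n}"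

lemma riordan_lcs_iff: "(g, f) \<in> riordan_lcs n \<longleftrightarrow> fps_nth g 0 = 1 \<and> agree (2 * n - 2) g 1 \<and> f \<in> nottingham_lcs n"
  by (simp add: riordan_lcs_def)

lemma nottingham_lcs_1: "f \<in> nottingham_lcs 1 \<longleftrightarrow> fps_nth f 0 = 0 \<and> fps_nth f 1 = 1"
  by (auto simp: nottingham_lcs_def agree_def even_part_nth odd_part_nth)

lemma riordan_lcs_1: "riordan_lcs 1 = riordan_carrier"
  unfolding riordan_lcs_def riordan_carrier_def nottingham_lcs_1 by (simp add: agree_def)

lemma nottingham_lcs_agree_X:
  assumes "f \<in> nottingham_lcs n" "n \<ge> 1"
  shows "agree (2 * n) f fps_X"
  unfolding agree_def
proof safe
  fix k assume k: "k < 2 * n"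
  show "fps_nth f k = fps_nth fps_X k"
  proof (cases "even k")
    case True
    then have "fps_nth f k = fps_nth (even_part f) (k div 2)"
      by (simp add: even_part_nth)
    also have "\<dots> = 0"
      using assms k by (simp add: nottingham_lcs_def agree_def less_mult_imp_div_less mult.commute)
    finally show ?thesis using True by auto
  next
    case False
    then obtain j where j: "k = 2 * j + 1" by (elim oddE)
    have "fps_nth f k = fps_nth (odd_part f) j"
      by (simp add: j odd_part_nth)
    also have "\<dots> = fps_nth 1 j"
      using assms k j by (cases "j = 0") (auto simp: nottingham_lcs_def agree_def)
    finally show ?thesis by (simp add: j)
  qed
qed

lemma nottingham_lcs_nth_0_1: 
  assumes "f \<in> nottingham_lcs n" "n \<ge> 1"
  shows "fps_nth f 0 = 0" "fps_nth f 1 = 1"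
  using agreeD[OF nottingham_lcs_agree_X[OF assms], of 0] agreeD[OF nottingham_lcs_agree_X[OF assms], of 1] assms(2)
  by simp_all

lemma riordan_lcs_subset: "n \<ge> 1 \<Longrightarrow> riordan_lcs n \<subseteq> riordan_carrier"
  using nottingham_lcs_nth_0_1 by (auto simp: riordan_lcs_def)

lemma fps_X_mem_nottingham_lcs: "n \<ge> 1 \<Longrightarrow> fps_X \<in> nottingham_lcs n"
  by (auto simp: nottingham_lcs_def agree_def even_part_nth odd_part_nth)

section \<open>Composition inside the candidate terms\<close>

lemma agree_mult_near_1:
  fixes a b :: "bit fps"
  assumes "agree m a 1" "agree m b 1"
  shows "agree (2 * m) (a * b) (a + b + 1)"
proof -
  have "agree m (a + 1) 0" "agree m (b + 1) 0"
    using agree_add[OF assms(1) agree_refl[of m 1]] agree_add[OF assms(2) agree_refl[of m 1]]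
    by simp_all
  then have "agree (m + m) ((a + 1) * (b + 1)) 0"
    by (rule agree_0_mult)
  from agree_add[OF this agree_refl[of _ "a + b + 1"]] show ?thesis
    by (simp add: algebra_simps flip: mult_2)
qed

lemma agree_1_iff: 
  fixes f :: "bit fps" shows "agree m (f + 1) 0 \<longleftrightarrow> agree m f 1"
  by (auto simp: agree_def bit_add_eq_0_iff)

text \<open>The derivative of \<open>t^(2l)\<close> is zero, so substitution first disturbs
  \<open>t^(2l)\<close> in degree \<open>2l + 2\<close>; the same bound holds for the next power
  \<open>t^(2l+1)\<close> trivially.\<close>

lemma compose_agree_near:
  fixes u h :: "bit fps"
  assumes "agree (2 * l) u 1" "fps_nth h 0 = 0" "fps_nth h 1 = 1"
  shows "agree (2 * l + 2) (u oo h) u"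
proof -
  have u: "agree (2 * l) (u + 1) 0"
    using assms(1) by (simp add: agree_1_iff)
  have "fps_nth ((u + 1) oo h) k = fps_nth (u + 1) k" if k: "k < 2 * l + 2" for k
  proof -
    consider "k < 2 * l" | "k = 2 * l" | "k = 2 * l + 1" using k by linarith
    then show ?thesis
    proof cases
      case 1
      then show ?thesis
        using agreeD[OF agree_0_compose[OF u assms(2)], of k] agreeD[OF u] by simp
    next
      case 2 then show ?thesis using compose_nth_even(1)[OF u assms(2,3)] by simp
    next
      case 3 then show ?thesis using compose_nth_even(2)[OF u assms(2,3)] by simp
    qed
  qed
  then show ?thesis
    by (simp add: agree_def fps_compose_add_distrib)
qed

text \<open>Since \<open>n \<ge> 2\<close>, the series \<open>h\<close> is \<open>t\<close> modulo
  \<open>t^4\<close>. So \<open>h_2\<close> and \<open>h_3\<close> vanish, and with them the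
  corrections in \<open>compose_nth_even\<close>: what remains is the product of the odd parts and
  the sum of the even parts.\<close>

lemma nottingham_lcs_compose:
  assumes n: "n \<ge> 2" and f: "f \<in> nottingham_lcs n" "h \<in> nottingham_lcs n"
  shows "agree (2 * n + 2) (odd_part (f oo h)) (odd_part f * odd_part h)"
    "agree (n + 2) (even_part (f oo h)) (even_part f + even_part h)"
proof -
  have h: "agree (2 * n) h fps_X"
    using nottingham_lcs_agree_X[OF f(2)] n by simp
  have h0: "fps_nth h 0 = 0" "fps_nth h 1 = 1" "fps_nth h 2 = 0" "fps_nth h 3 = 0"
    using agreeD[OF h, of 0] agreeD[OF h, of 1] agreeD[OF h, of 2] agreeD[OF h, of 3] n by simp_all
  have l: "2 * n - 2 = 2 * (n - 1)" "2 * n = 2 * (n - 1) + 2" using n by simp_all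
  have s: "agree (2 * (n - 1)) (odd_part f + 1) 0"
    using f(1) n by (simp add: nottingham_lcs_def agree_1_iff l)
  have "fps_nth ((odd_part f + 1) oo h) k = fps_nth (odd_part f + 1) k" if k: "k < 2 * n + 2" for k
  proof -
    consider "k < 2 * (n - 1)" | "k = 2 * (n - 1)" | "k = 2 * (n - 1) + 1" | "k = 2 * (n - 1) + 2"
      | "k = 2 * (n - 1) + 3"
      using k l by linarith
    then show ?thesis
    proof cases
      case 1
      then show ?thesis
        using agreeD[OF agree_0_compose[OF s h0(1)], of k] agreeD[OF s] by simp
    qed (use compose_nth_even[OF s h0(1,2)] in \<open>simp_all add: h0\<close>)
  qed
  then have u: "agree (2 * n + 2) (odd_part f oo h) (odd_part f)"
    by (simp add: agree_def fps_compose_add_distrib)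
  from agree_mult[OF this agree_refl[of _ "odd_part h"]] show "agree (2 * n + 2) (odd_part (f oo h)) (odd_part f * odd_part h)"
    by (simp add: parts_compose[OF h0(1)] mult_ac)
  have "agree (2 * n - 2) (odd_part f oo h) 1"
    using agree_mono[OF u, of "2 * n - 2"] f(1) by (auto simp: nottingham_lcs_def agree_def)
  then have "agree (n + (2 * n - 2)) (even_part h * ((odd_part f oo h) + 1)) 0"
    using f(2) by (intro agree_0_mult) (auto simp: nottingham_lcs_def agree_1_iff)
  then have 1: "agree (n + 2) (even_part h * ((odd_part f oo h) + 1)) 0"
    by (rule agree_mono) (use n in simp)
  have "agree (2 * n) (even_part f oo h) (even_part f)"
    using agree_compose[OF agree_refl h, of "even_part f"] by simp
  then have 2: "agree (n + 2) (even_part f oo h) (even_part f)"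
    by (rule agree_mono) (use n in simp)
  have "even_part (f oo h) = (even_part f oo h) + even_part h + even_part h * ((odd_part f oo h) + 1)"
    by (simp add: parts_compose[OF h0(1)] algebra_simps)
  with agree_add[OF agree_add[OF 2 agree_refl[of _ "even_part h"]] 1]
  show "agree (n + 2) (even_part (f oo h)) (even_part f + even_part h)" by simp
qed

text \<open>A product of series congruent to 1 modulo \<open>t^(2n-2)\<close> is additive below
  degree \<open>4n - 4\<close>, which exceeds \<open>2n + 1\<close> exactly when
  \<open>n \<ge> 3\<close>. For \<open>n = 2\<close> the index \<open>2n + 1\<close> needs an
  argument of its own.\<close>

lemma nottingham_lcs_compose_nth:
  assumes n: "n \<ge> 2" and f: "f \<in> nottingham_lcs n" "h \<in> nottingham_lcs n"
  shows "fps_nth (even_part (f oo h)) n = fps_nth (even_part f) n + fps_nth (even_part h) n"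
    "fps_nth (even_part (f oo h)) (n + 1) = fps_nth (even_part f) (n + 1) + fps_nth (even_part h) (n + 1)"
    "fps_nth (odd_part (f oo h)) (2 * n + 1) = fps_nth (odd_part f) (2 * n + 1) + fps_nth (odd_part h) (2 * n + 1)"
    "n \<noteq> 2 \<Longrightarrow> fps_nth (odd_part (f oo h)) (2 * n - 2) = fps_nth (odd_part f) (2 * n - 2) + fps_nth (odd_part h) (2 * n - 2)"
    "n \<noteq> 2 \<Longrightarrow> fps_nth (odd_part (f oo h)) (2 * n) = fps_nth (odd_part f) (2 * n) + fps_nth (odd_part h) (2 * n)"
proof -
  note c = nottingham_lcs_compose[OF assms]
  show "fps_nth (even_part (f oo h)) n = fps_nth (even_part f) n + fps_nth (even_part h) n"
    "fps_nth (even_part (f oo h)) (n + 1) = fps_nth (even_part f) (n + 1) + fps_nth (even_part h) (n + 1)"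
    using agreeD[OF c(2), of n] agreeD[OF c(2), of "n + 1"] by simp_all
  have a: "agree (2 * (2 * n - 2)) (odd_part f * odd_part h) (odd_part f + odd_part h + 1)"
    using f by (intro agree_mult_near_1) (auto simp: nottingham_lcs_def)
  have *: "fps_nth (odd_part (f oo h)) k = fps_nth (odd_part f) k + fps_nth (odd_part h) k"
    if "k > 0" "k < 2 * n + 2" "n \<noteq> 2" for k
    using agreeD[OF c(1) that(2)] agreeD[OF a, of k] that n by simp
  show "n \<noteq> 2 \<Longrightarrow> fps_nth (odd_part (f oo h)) (2 * n - 2) = fps_nth (odd_part f) (2 * n - 2) + fps_nth (odd_part h) (2 * n - 2)"
    "n \<noteq> 2 \<Longrightarrow> fps_nth (odd_part (f oo h)) (2 * n) = fps_nth (odd_part f) (2 * n) + fps_nth (odd_part h) (2 * n)"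
    using n by (auto intro!: *)
  show "fps_nth (odd_part (f oo h)) (2 * n + 1) = fps_nth (odd_part f) (2 * n + 1) + fps_nth (odd_part h) (2 * n + 1)"
  proof (cases "n = 2")
    case False
    then show ?thesis using n by (intro *) auto
  next
    \<comment> \<open>Now \<open>n = 2\<close>. The cross terms in degree 5 are
      \<open>S_2 * T_3 + S_3 * T_2\<close> for the odd parts \<open>S\<close> and \<open>T\<close>;
      they cancel because \<open>S_3 = S_2\<close> and \<open>T_3 = T_2\<close> on
      \<open>nottingham_lcs 2\<close>.\<close>
    case True
    have z: "fps_nth (odd_part u) 0 = 1" "fps_nth (odd_part u) 1 = 0" "fps_nth (odd_part u) 3 = fps_nth (odd_part u) 2"
      if "u \<in> nottingham_lcs n" for u
      using that True by (auto simp: nottingham_lcs_def agree_def)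
    have "fps_nth (odd_part (f oo h)) 5 = fps_nth (odd_part f * odd_part h) 5"
      using agreeD[OF c(1), of 5] True by simp
    also have "{0..5::nat} = {0,1,2,3,4,5}" by auto
    then have "fps_nth (odd_part f * odd_part h) 5 = fps_nth (odd_part f) 5 + fps_nth (odd_part h) 5"
      using z[OF f(1)] z[OF f(2)] by (simp add: fps_mult_nth add_ac mult_ac)
    finally show ?thesis using True by simp
  qed
qed

section \<open>Homomorphisms detecting the successive quotients\<close>

abbreviation bit_int :: "bit \<Rightarrow> int" where "bit_int b \<equiv> of_bool (b = 1)"

lemma bit_int_add: "bit_int (a + b) = (bit_int a + bit_int b) mod 2"
  by (cases a; cases b) simp_all

text \<open>Binary addition modulo 4: \<open>a * b\<close> is the carry out of the low bits.\<close>

lemma bit_int_add_carry: "bit_int (a + b) + 2 * bit_int (c + d + a * b) = (bit_int a + 2 * bit_int c + (bit_int b + 2 * bit_int d)) mod 4"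
  by (cases a; cases b; cases c; cases d) simp_all

text \<open>The last component is a homomorphism to \<open>\<int>/4\<close>: with \<open>f \<mapsto> f\<^sub>2 + f\<^sub>3\<close> as its low bit,
  \<open>f\<^sub>4 + f\<^sub>5 + f\<^sub>2 f\<^sub>3\<close> is a high bit satisfying exactly the carry rule.\<close>
definition ab_map :: "rpair \<Rightarrow> int \<times> int \<times> int \<times> int" where
  "ab_map = (\<lambda>(g, f). (bit_int (fps_nth g 1), bit_int (fps_nth f 3),
     bit_int (fps_nth f 5 + fps_nth f 7 + fps_nth f 3 * fps_nth f 5),
     bit_int (fps_nth f 2 + fps_nth f 3) + 2 * bit_int (fps_nth f 4 + fps_nth f 5 + fps_nth f 2 * fps_nth f 3)))"

text \<open>The last entry is a sum because the next term of the series equates its two summands; so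
  its vanishing is the wanted condition. The fifth entry of the map for odd \<open>n\<close> has the
  same origin.\<close>

definition lcs_map_even :: "nat \<Rightarrow> rpair \<Rightarrow> int \<times> int \<times> int \<times> int" where
  "lcs_map_even n = (\<lambda>(g, f). (bit_int (fps_nth g (2 * n - 2)), bit_int (fps_nth g (2 * n - 1)),
     bit_int (fps_nth (even_part f) n), bit_int (fps_nth (odd_part f) (2 * n + 1) + fps_nth (even_part f) (n + 1))))"

definition lcs_map_odd :: "nat \<Rightarrow> rpair \<Rightarrow> int \<times> int \<times> int \<times> int \<times> int \<times> int" where
  "lcs_map_odd n = (\<lambda>(g, f). (bit_int (fps_nth g (2 * n - 2)), bit_int (fps_nth g (2 * n - 1)),
     bit_int (fps_nth (even_part f) n), bit_int (fps_nth (odd_part f) (2 * n - 2)),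
     bit_int (fps_nth (odd_part f) (2 * n) + fps_nth (even_part f) (n + 1)), bit_int (fps_nth (odd_part f) (2 * n + 1))))"

lemma Zmod_simps [simp]:
  "\<one>\<^bsub>Zmod n\<^esub> = 0" "x \<otimes>\<^bsub>Zmod n\<^esub> y = (x + y) mod int n" "group (Zmod n)" "comm_group (Zmod n)"
  by (simp_all add: Zmod_def)

lemma carrier_Zmod: "n > 0 \<Longrightarrow> carrier (Zmod n) = {0..<int n}"
  by (simp add: Zmod_def carrier_integer_mod_group)

text \<open>For the third entry, let \<open>1 + s_1 t + s_2 t^2 + s_3 t^3 + ...\<close> be the odd
  part of \<open>f\<close>, so \<open>s_1 = f_3\<close>, \<open>s_2 = f_5\<close>,
  \<open>s_3 = f_7\<close>. Under products of series \<open>s_3 + s_1 * s_2\<close> is additive.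
  Substitution spoils this by \<open>b_3 * (a_2 + a_3)\<close>, where \<open>a\<close> and
  \<open>b\<close> are the inner and the outer series, and \<open>f_5\<close> fails to be additive
  by the same amount; hence the sum of both is additive.\<close>

lemma ab_map_hom: "ab_map \<in> hom Riordan (Zmod 2 \<times>\<times> Zmod 2 \<times>\<times> Zmod 2 \<times>\<times> Zmod 4)"
proof (rule homI)
  fix x assume "x \<in> carrier Riordan"
  show "ab_map x \<in> carrier (Zmod 2 \<times>\<times> Zmod 2 \<times>\<times> Zmod 2 \<times>\<times> Zmod 4)"
    by (cases x) (simp add: ab_map_def carrier_Zmod of_bool_def)
next
  fix x y assume xy: "x \<in> carrier Riordan" "y \<in> carrier Riordan"
  obtain g1 f1 g2 f2 where eq: "x = (g1, f1)" "y = (g2, f2)" by fastforce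
  let ?c = "f2 oo f1"
  have f: "fps_nth f1 0 = 0" "fps_nth f1 1 = 1" "fps_nth f2 0 = 0" "fps_nth f2 1 = 1"
    using xy by (auto simp: eq)
  have g: "fps_nth g1 0 = 1" "fps_nth g2 0 = 1"
    using xy by (auto simp: eq)
  have o: "fps_nth (odd_part h) 0 = fps_nth h 1" "fps_nth (odd_part h) 1 = fps_nth h 3"
    "fps_nth (odd_part h) 2 = fps_nth h 5" "fps_nth (odd_part h) 3 = fps_nth h 7"
    "fps_nth (even_part h) 0 = fps_nth h 0" "fps_nth (even_part h) 1 = fps_nth h 2" "fps_nth (even_part h) 2 = fps_nth h 4"
    for h :: "bit fps"
    by (simp_all add: odd_part_nth even_part_nth)
  note o = o o(2,6)[unfolded One_nat_def] f(2,4)[unfolded One_nat_def]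
  have sets: "{0..1::nat} = {0,1}" "{0..2::nat} = {0,1,2}" "{0..3::nat} = {0,1,2,3}"
    by auto
  note m = fps_mult_nth[where n=1, unfolded sets] fps_mult_nth[where n=2, unfolded sets]
    fps_mult_nth[where n=3, unfolded sets]
  note cc = compose_nth_1[where h=f1] compose_nth_1[where h=f1, unfolded One_nat_def] compose_nth_2_3[where h=f1, OF f(1,2)]
  have c2: "fps_nth ?c 2 = fps_nth f2 2 + fps_nth f1 2"
    using o(6)[of ?c] unfolding parts_compose[OF f(1)] fps_add_nth m using f
    by (simp add: cc o del: One_nat_def)
  have c4: "fps_nth ?c 4 = fps_nth f2 4 + fps_nth f2 2 * fps_nth f1 2 + fps_nth f1 4 + fps_nth f1 2 * fps_nth f2 3"
    using o(7)[of ?c] unfolding parts_compose[OF f(1)] fps_add_nth m using f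
    by (simp add: cc o algebra_simps del: One_nat_def)
  have c3: "fps_nth ?c 3 = fps_nth f2 3 + fps_nth f1 3"
    using o(2)[of ?c] unfolding parts_compose[OF f(1)] m using f
    by (simp add: cc o del: One_nat_def)
  have c5: "fps_nth ?c 5 = fps_nth f2 5 + fps_nth f2 3 * fps_nth f1 2 + fps_nth f1 5 + fps_nth f2 3 * fps_nth f1 3"
    using o(3)[of ?c] unfolding parts_compose[OF f(1)] m using f
    by (simp add: cc o algebra_simps del: One_nat_def)
  have c7: "fps_nth ?c 7 = fps_nth f2 7 + fps_nth f2 3 * fps_nth f1 3
      + (fps_nth f2 3 * fps_nth f1 2 + fps_nth f2 5) * fps_nth f1 3 + fps_nth f2 3 * fps_nth f1 5 + fps_nth f1 7"
    using o(4)[of ?c] unfolding parts_compose[OF f(1)] m using f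
    by (simp add: cc o algebra_simps del: One_nat_def)
  have g1: "fps_nth (g1 * (g2 oo f1)) 1 = fps_nth g1 1 + fps_nth g2 1"
    using f g by (simp add: m cc del: One_nat_def)
  have psi: "fps_nth ?c 5 + fps_nth ?c 7 + fps_nth ?c 3 * fps_nth ?c 5 =
    (fps_nth f1 5 + fps_nth f1 7 + fps_nth f1 3 * fps_nth f1 5) + (fps_nth f2 5 + fps_nth f2 7 + fps_nth f2 3 * fps_nth f2 5)"
    unfolding c5 c7 c3 by (simp add: algebra_simps)
  have q: "fps_nth ?c 4 + fps_nth ?c 5 + fps_nth ?c 2 * fps_nth ?c 3 =
    (fps_nth f1 4 + fps_nth f1 5 + fps_nth f1 2 * fps_nth f1 3) + (fps_nth f2 4 + fps_nth f2 5 + fps_nth f2 2 * fps_nth f2 3)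
    + (fps_nth f1 2 + fps_nth f1 3) * (fps_nth f2 2 + fps_nth f2 3)"
    unfolding c2 c3 c4 c5 by (simp add: algebra_simps)
  have l: "fps_nth ?c 2 + fps_nth ?c 3 = (fps_nth f1 2 + fps_nth f1 3) + (fps_nth f2 2 + fps_nth f2 3)"
    unfolding c2 c3 by (simp add: algebra_simps)
  show "ab_map (x \<otimes>\<^bsub>Riordan\<^esub> y) = ab_map x \<otimes>\<^bsub>Zmod 2 \<times>\<times> Zmod 2 \<times>\<times> Zmod 2 \<times>\<times> Zmod 4\<^esub> ab_map y"
    unfolding eq ab_map_def Riordan_simps case_prod_conv mult_DirProd Zmod_simps g1 psi q l of_nat_numeral
    unfolding c3
    by (intro arg_cong2[where f=Pair] bit_int_add bit_int_add_carry) (simp only: bit_int_add add.commute)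
qed

lemma agree_Suc: "agree (Suc m) f g \<longleftrightarrow> agree m f g \<and> fps_nth f m = fps_nth g m"
  by (auto simp: agree_def less_Suc_eq)

lemma agree_step_2:
  assumes "n \<ge> 2"
  shows "agree (2 * Suc n - 2) f (1::bit fps) \<longleftrightarrow>
    agree (2 * n - 2) f 1 \<and> fps_nth f (2 * n - 2) = 0 \<and> fps_nth f (2 * n - 1) = 0"
proof -
  have *: "2 * Suc n - 2 = Suc (Suc (2 * n - 2))" "Suc (2 * n - 2) = 2 * n - 1"
    using assms by simp_all
  show ?thesis
    using assms unfolding *(1) agree_Suc unfolding *(2) by simp
qed

text \<open>Write \<open>P\<close> and \<open>S\<close> for the even and the odd part. For even
  \<open>n\<close> the vanishing of \<open>P_n\<close> entails that of \<open>S_(2n-2)\<close> and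
  \<open>S_(2n-1)\<close>, so only two conditions are new.\<close>

lemma nottingham_lcs_Suc_even:
  assumes "n \<ge> 2" "even n"
  shows "f \<in> nottingham_lcs (Suc n) \<longleftrightarrow> f \<in> nottingham_lcs n \<and> fps_nth (even_part f) n = 0 \<and>
    fps_nth (odd_part f) (2 * n + 1) + fps_nth (even_part f) (n + 1) = 0"
proof -
  have "2 * Suc n - 1 = 2 * n + 1" "Suc n \<noteq> 2" using assms by auto
  then show ?thesis
    using assms unfolding nottingham_lcs_def mem_Collect_eq agree_step_2[OF assms(1)] agree_Suc bit_add_eq_0_iff
    by auto
qed

text \<open>For odd \<open>n\<close> only \<open>S_(2n-1)\<close> is tied to \<open>P_n\<close>,
  while \<open>S_(2n-2)\<close> is free, and the even number \<open>n + 1\<close> brings two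
  relations: four new conditions. Adding the two new coefficients of the first component gives the
  ranks 6 here and 4 for even \<open>n\<close>.\<close>

lemma nottingham_lcs_Suc_odd:
  assumes "n \<ge> 2" "odd n"
  shows "f \<in> nottingham_lcs (Suc n) \<longleftrightarrow> f \<in> nottingham_lcs n \<and> fps_nth (even_part f) n = 0 \<and> fps_nth (odd_part f) (2 * n - 2) = 0 \<and>
    fps_nth (odd_part f) (2 * n) + fps_nth (even_part f) (n + 1) = 0 \<and> fps_nth (odd_part f) (2 * n + 1) = 0"
proof -
  have "2 * Suc n - 1 = 2 * n + 1" "2 * Suc n - 2 = 2 * n" "Suc n \<noteq> 2" using assms by auto
  then show ?thesis
    using assms unfolding nottingham_lcs_def mem_Collect_eq agree_step_2[OF assms(1)] agree_Suc bit_add_eq_0_iff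
    by auto
qed

lemma riordan_lcs_mult_fst_nth:
  assumes "n \<ge> 2" "(g1, f1) \<in> riordan_lcs n" "(g2, f2) \<in> riordan_lcs n" "0 < k" "k < 2 * n"
  shows "fps_nth (g1 * (g2 oo f1)) k = fps_nth g1 k + fps_nth g2 k"
proof -
  have l: "2 * n - 2 = 2 * (n - 1)" "2 * n = 2 * (n - 1) + 2" using assms(1) by simp_all
  have "agree (2 * (n - 1) + 2) (g2 oo f1) g2"
    using assms nottingham_lcs_nth_0_1[of f1 n] by (intro compose_agree_near) (auto simp: riordan_lcs_iff l)
  then have "agree (2 * n) (g1 * (g2 oo f1)) (g1 * g2)"
    using l by (intro agree_mult) auto
  moreover have "agree (2 * (2 * n - 2)) (g1 * g2) (g1 + g2 + 1)"
    using assms by (intro agree_mult_near_1) (auto simp: riordan_lcs_iff)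
  ultimately have "fps_nth (g1 * (g2 oo f1)) k = fps_nth (g1 + g2 + 1) k"
    using assms by (auto simp: agree_def)
  then show ?thesis
    using assms by simp
qed

lemma bit_int_add_comm: "bit_int (a + b) = (bit_int b + bit_int a) mod 2"
  by (cases a; cases b) simp_all

lemma bit_int_add_4: "bit_int (a + b + (c + d)) = (bit_int (b + d) + bit_int (a + c)) mod 2"
  by (cases a; cases b; cases c; cases d) simp_all

lemma Riordan_restrict_mult:
  "(g1, f1) \<otimes>\<^bsub>Riordan\<lparr>carrier := A\<rparr>\<^esub> (g2, f2) = (g1 * (g2 oo f1), f2 oo f1)"
  by simp

text \<open>Additivity is shown on the bare set, before it is known to be a subgroup, because
  \<open>subgroup_riordan_lcs\<close> obtains the subgroups as kernels of these maps.\<close>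

lemma lcs_map_even_hom:
  assumes "n \<ge> 2"
  shows "lcs_map_even n \<in> hom (Riordan\<lparr>carrier := riordan_lcs n\<rparr>) (Zmod 2 \<times>\<times> Zmod 2 \<times>\<times> Zmod 2 \<times>\<times> Zmod 2)"
proof (rule homI)
  fix x show "lcs_map_even n x \<in> carrier (Zmod 2 \<times>\<times> Zmod 2 \<times>\<times> Zmod 2 \<times>\<times> Zmod 2)"
    by (cases x) (simp add: lcs_map_even_def carrier_Zmod of_bool_def)
next
  fix x y
  assume xy: "x \<in> carrier (Riordan\<lparr>carrier := riordan_lcs n\<rparr>)" "y \<in> carrier (Riordan\<lparr>carrier := riordan_lcs n\<rparr>)"
  obtain g1 f1 g2 f2 where eq: "x = (g1, f1)" "y = (g2, f2)" by fastforce
  have *: "(g1, f1) \<in> riordan_lcs n" "(g2, f2) \<in> riordan_lcs n" "f2 \<in> nottingham_lcs n" "f1 \<in> nottingham_lcs n"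
    using xy by (auto simp: eq riordan_lcs_iff)
  have g: "fps_nth (g1 * (g2 oo f1)) (2 * n - 2) = fps_nth g1 (2 * n - 2) + fps_nth g2 (2 * n - 2)"
    "fps_nth (g1 * (g2 oo f1)) (2 * n - 1) = fps_nth g1 (2 * n - 1) + fps_nth g2 (2 * n - 1)"
    using assms by (auto intro!: riordan_lcs_mult_fst_nth *)
  show "lcs_map_even n (x \<otimes>\<^bsub>Riordan\<lparr>carrier := riordan_lcs n\<rparr>\<^esub> y) =
    lcs_map_even n x \<otimes>\<^bsub>Zmod 2 \<times>\<times> Zmod 2 \<times>\<times> Zmod 2 \<times>\<times> Zmod 2\<^esub> lcs_map_even n y"
    unfolding eq lcs_map_even_def Riordan_restrict_mult case_prod_conv
      mult_DirProd Zmod_simps of_nat_numeral g nottingham_lcs_compose_nth[OF assms *(3,4)]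
    by (intro arg_cong2[where f=Pair] bit_int_add bit_int_add_comm bit_int_add_4)
qed

lemma lcs_map_odd_hom:
  assumes "n \<ge> 2" "odd n"
  shows "lcs_map_odd n \<in> hom (Riordan\<lparr>carrier := riordan_lcs n\<rparr>)
    (Zmod 2 \<times>\<times> Zmod 2 \<times>\<times> Zmod 2 \<times>\<times> Zmod 2 \<times>\<times> Zmod 2 \<times>\<times> Zmod 2)"
proof (rule homI)
  fix x show "lcs_map_odd n x \<in> carrier (Zmod 2 \<times>\<times> Zmod 2 \<times>\<times> Zmod 2 \<times>\<times> Zmod 2 \<times>\<times> Zmod 2 \<times>\<times> Zmod 2)"
    by (cases x) (simp add: lcs_map_odd_def carrier_Zmod of_bool_def)
next
  fix x y
  assume xy: "x \<in> carrier (Riordan\<lparr>carrier := riordan_lcs n\<rparr>)" "y \<in> carrier (Riordan\<lparr>carrier := riordan_lcs n\<rparr>)"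
  obtain g1 f1 g2 f2 where eq: "x = (g1, f1)" "y = (g2, f2)" by fastforce
  have *: "(g1, f1) \<in> riordan_lcs n" "(g2, f2) \<in> riordan_lcs n" "f2 \<in> nottingham_lcs n" "f1 \<in> nottingham_lcs n"
    using xy by (auto simp: eq riordan_lcs_iff)
  have g: "fps_nth (g1 * (g2 oo f1)) (2 * n - 2) = fps_nth g1 (2 * n - 2) + fps_nth g2 (2 * n - 2)"
    "fps_nth (g1 * (g2 oo f1)) (2 * n - 1) = fps_nth g1 (2 * n - 1) + fps_nth g2 (2 * n - 1)"
    using assms by (auto intro!: riordan_lcs_mult_fst_nth *)
  have "n \<noteq> 2" using assms by auto
  show "lcs_map_odd n (x \<otimes>\<^bsub>Riordan\<lparr>carrier := riordan_lcs n\<rparr>\<^esub> y) =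
    lcs_map_odd n x \<otimes>\<^bsub>Zmod 2 \<times>\<times> Zmod 2 \<times>\<times> Zmod 2 \<times>\<times> Zmod 2 \<times>\<times> Zmod 2 \<times>\<times> Zmod 2\<^esub> lcs_map_odd n y"
    unfolding eq lcs_map_odd_def Riordan_restrict_mult case_prod_conv
      mult_DirProd Zmod_simps of_nat_numeral g nottingham_lcs_compose_nth(1-3)[OF assms(1) *(3,4)]
      nottingham_lcs_compose_nth(4,5)[OF assms(1) *(3,4) \<open>n \<noteq> 2\<close>]
    by (intro arg_cong2[where f=Pair] bit_int_add bit_int_add_comm bit_int_add_4)
qed

lemma group_Z2_4: "group (Zmod 2 \<times>\<times> Zmod 2 \<times>\<times> Zmod 2 \<times>\<times> Zmod 2)"
  and group_Z2_6: "group (Zmod 2 \<times>\<times> Zmod 2 \<times>\<times> Zmod 2 \<times>\<times> Zmod 2 \<times>\<times> Zmod 2 \<times>\<times> Zmod 2)"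
  and group_Z2_3_Z4: "group (Zmod 2 \<times>\<times> Zmod 2 \<times>\<times> Zmod 2 \<times>\<times> Zmod 4)"
  by (intro DirProd_group Zmod_simps)+

text \<open>Once \<open>f_2\<close> and \<open>f_3\<close> vanish, the two quadratic entries reduce
  to \<open>f_5 + f_7\<close> and \<open>f_4 + f_5\<close>; these are the exceptional relations of
  \<open>nottingham_lcs 2\<close>.\<close>

lemma kernel_ab_map: "kernel Riordan (Zmod 2 \<times>\<times> Zmod 2 \<times>\<times> Zmod 2 \<times>\<times> Zmod 4) ab_map = riordan_lcs 2"
proof -
  have "ab_map (g, f) = (0, 0, 0, 0) \<longleftrightarrow> (g, f) \<in> riordan_lcs 2" if "(g, f) \<in> riordan_carrier" for g f
  proof -
    have "(bit_int a + 2 * bit_int b = 0) \<longleftrightarrow> a = 0 \<and> b = 0" for a b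
      by (cases a; cases b) simp_all
    moreover have "(g, f) \<in> riordan_lcs 2 \<longleftrightarrow> fps_nth g 1 = 0 \<and> fps_nth f 2 = 0 \<and> fps_nth f 3 = 0 \<and>
       fps_nth f 5 = fps_nth f 4 \<and> fps_nth f 7 = fps_nth f 4"
      using that by (auto simp: riordan_lcs_iff nottingham_lcs_def agree_def even_part_nth odd_part_nth less_2_cases_iff)
    ultimately show ?thesis
      by (auto simp: ab_map_def bit_add_eq_0_iff)
  qed
  then show ?thesis
    using riordan_lcs_subset[of 2] by (auto simp: kernel_def)
qed

lemma kernel_lcs_map_even:
  assumes "n \<ge> 2" "even n"
  shows "kernel (Riordan\<lparr>carrier := riordan_lcs n\<rparr>) (Zmod 2 \<times>\<times> Zmod 2 \<times>\<times> Zmod 2 \<times>\<times> Zmod 2) (lcs_map_even n) = riordan_lcs (Suc n)"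
  by (auto simp: kernel_def riordan_lcs_iff lcs_map_even_def nottingham_lcs_Suc_even[OF assms] agree_step_2[OF assms(1), simplified])

lemma kernel_lcs_map_odd:
  assumes "n \<ge> 2" "odd n"
  shows "kernel (Riordan\<lparr>carrier := riordan_lcs n\<rparr>)
    (Zmod 2 \<times>\<times> Zmod 2 \<times>\<times> Zmod 2 \<times>\<times> Zmod 2 \<times>\<times> Zmod 2 \<times>\<times> Zmod 2) (lcs_map_odd n) = riordan_lcs (Suc n)"
  by (auto simp: kernel_def riordan_lcs_iff lcs_map_odd_def nottingham_lcs_Suc_odd[OF assms] agree_step_2[OF assms(1), simplified])

lemma group_hom_ab_map: "group_hom Riordan (Zmod 2 \<times>\<times> Zmod 2 \<times>\<times> Zmod 2 \<times>\<times> Zmod 4) ab_map"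
  by (intro group_hom.intro group_hom_axioms.intro group_Riordan group_Z2_3_Z4 ab_map_hom)

text \<open>Each term is the kernel of an additive map on the preceding one, so closure under
  products and inverses never has to be checked on the defining conditions.\<close>

lemma subgroup_riordan_lcs: "n \<ge> 1 \<Longrightarrow> subgroup (riordan_lcs n) Riordan"
proof (induction n rule: nat_induct_at_least)
  case base
  show ?case
    using R.subgroup_self unfolding riordan_lcs_1 by simp
next
  case (Suc n)
  interpret G: group "Riordan\<lparr>carrier := riordan_lcs n\<rparr>"
    by (rule R.subgroup_imp_group[OF Suc.IH])
  consider "n = 1" | "n \<ge> 2" "even n" | "n \<ge> 2" "odd n" using Suc.hyps by linarith
  then show ?case
  proof cases
    case 1
    then show ?thesis
      using group_hom.subgroup_kernel[OF group_hom_ab_map] unfolding kernel_ab_map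
      by (simp add: numeral_2_eq_2)
  next
    case 2
    have "group_hom (Riordan\<lparr>carrier := riordan_lcs n\<rparr>) (Zmod 2 \<times>\<times> Zmod 2 \<times>\<times> Zmod 2 \<times>\<times> Zmod 2) (lcs_map_even n)"
      by (intro group_hom.intro group_hom_axioms.intro G.is_group group_Z2_4 lcs_map_even_hom 2)
    from group_hom.subgroup_kernel[OF this] show ?thesis
      unfolding kernel_lcs_map_even[OF 2] by (rule R.incl_subgroup[OF Suc.IH])
  next
    case 3
    have "group_hom (Riordan\<lparr>carrier := riordan_lcs n\<rparr>)
      (Zmod 2 \<times>\<times> Zmod 2 \<times>\<times> Zmod 2 \<times>\<times> Zmod 2 \<times>\<times> Zmod 2 \<times>\<times> Zmod 2) (lcs_map_odd n)"
      by (intro group_hom.intro group_hom_axioms.intro G.is_group group_Z2_6 lcs_map_odd_hom 3)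
    from group_hom.subgroup_kernel[OF this] show ?thesis
      unfolding kernel_lcs_map_odd[OF 3] by (rule R.incl_subgroup[OF Suc.IH])
  qed
qed

section \<open>Surjectivity and the successive quotients\<close>

lemma obtain_bit_int:
  assumes "x \<in> {0..<2::int}"
  obtains b where "x = bit_int b"
proof -
  have "x = 0 \<or> x = 1" using assms by auto
  then show ?thesis using that[of 0] that[of 1] by auto
qed

lemma ab_map_surj: "ab_map ` carrier Riordan = carrier (Zmod 2 \<times>\<times> Zmod 2 \<times>\<times> Zmod 2 \<times>\<times> Zmod 4)"
proof
  show "ab_map ` carrier Riordan \<subseteq> carrier (Zmod 2 \<times>\<times> Zmod 2 \<times>\<times> Zmod 2 \<times>\<times> Zmod 4)"
    using hom_carrier[OF ab_map_hom] by simp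
  show "carrier (Zmod 2 \<times>\<times> Zmod 2 \<times>\<times> Zmod 2 \<times>\<times> Zmod 4) \<subseteq> ab_map ` carrier Riordan"
  proof
    fix v assume v: "v \<in> carrier (Zmod 2 \<times>\<times> Zmod 2 \<times>\<times> Zmod 2 \<times>\<times> Zmod 4)"
    obtain x y z w where eq: "v = (x, y, z, w)" by (metis surj_pair)
    from v have m: "x \<in> {0..<2}" "y \<in> {0..<2}" "z \<in> {0..<2}" "w mod 2 \<in> {0..<2}" "w div 2 \<in> {0..<2}"
      by (auto simp: eq carrier_Zmod)
    obtain p where p: "x = bit_int p" by (rule obtain_bit_int[OF m(1)])
    obtain q where q: "y = bit_int q" by (rule obtain_bit_int[OF m(2)])
    obtain r where r: "z = bit_int r" by (rule obtain_bit_int[OF m(3)])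
    obtain s where s: "w mod 2 = bit_int s" by (rule obtain_bit_int[OF m(4)])
    obtain t where t: "w div 2 = bit_int t" by (rule obtain_bit_int[OF m(5)])
    have w: "w = bit_int s + 2 * bit_int t"
      using s t by (metis add.commute mult_div_mod_eq)
    \<comment> \<open>The coefficients solve the equations one after another: \<open>f_3 = q\<close>
      gives \<open>f_2 = s + q\<close>, the choice \<open>f_7 = q * r\<close> cancels the product in
      the third entry and leaves \<open>f_5 = r\<close>, and \<open>f_4\<close> is whatever the high
      bit \<open>t\<close> still lacks.\<close>
    define f where "f = interleave (fps_const (s + q) * fps_X + fps_const (t + r + (s + q) * q) * fps_X ^ 2)
      (1 + fps_const q * fps_X + fps_const r * fps_X ^ 2 + fps_const (q * r) * fps_X ^ 3)"
    have f: "fps_nth f 0 = 0" "fps_nth f 1 = 1" "fps_nth f 2 = s + q" "fps_nth f 3 = q"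
      "fps_nth f 4 = t + r + (s + q) * q" "fps_nth f 5 = r" "fps_nth f 7 = q * r"
      by (simp_all add: f_def interleave_def)
    have g: "fps_nth (1 + fps_const p * fps_X) 1 = p" "fps_nth (1 + fps_const p * fps_X) 0 = 1"
      by simp_all
    have "ab_map (1 + fps_const p * fps_X, f) = v"
      unfolding ab_map_def case_prod_conv f g by (simp add: eq p q r w algebra_simps)
    moreover have "(1 + fps_const p * fps_X, f) \<in> carrier Riordan"
      using f g by simp
    ultimately show "v \<in> ab_map ` carrier Riordan" by force
  qed
qed

lemma lcs_map_even_surj:
  assumes "n \<ge> 2" "even n"
  shows "lcs_map_even n ` riordan_lcs n = carrier (Zmod 2 \<times>\<times> Zmod 2 \<times>\<times> Zmod 2 \<times>\<times> Zmod 2)"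
proof
  show "lcs_map_even n ` riordan_lcs n \<subseteq> carrier (Zmod 2 \<times>\<times> Zmod 2 \<times>\<times> Zmod 2 \<times>\<times> Zmod 2)"
    using hom_carrier[OF lcs_map_even_hom[OF assms(1)]] by simp
  show "carrier (Zmod 2 \<times>\<times> Zmod 2 \<times>\<times> Zmod 2 \<times>\<times> Zmod 2) \<subseteq> lcs_map_even n ` riordan_lcs n"
  proof
    fix v assume v: "v \<in> carrier (Zmod 2 \<times>\<times> Zmod 2 \<times>\<times> Zmod 2 \<times>\<times> Zmod 2)"
    obtain x y z w where eq: "v = (x, y, z, w)" by (metis surj_pair)
    from v have m: "x \<in> {0..<2}" "y \<in> {0..<2}" "z \<in> {0..<2}" "w \<in> {0..<2}"
      by (auto simp: eq carrier_Zmod)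
    obtain p where p: "x = bit_int p" by (rule obtain_bit_int[OF m(1)])
    obtain q where q: "y = bit_int q" by (rule obtain_bit_int[OF m(2)])
    obtain r where r: "z = bit_int r" by (rule obtain_bit_int[OF m(3)])
    obtain s where s: "w = bit_int s" by (rule obtain_bit_int[OF m(4)])
    define g where "g = 1 + fps_const p * fps_X ^ (2 * n - 2) + fps_const q * fps_X ^ (2 * n - 1)"
    \<comment> \<open>The copies of \<open>r\<close> in the odd part are forced by membership in
      \<open>nottingham_lcs n\<close>. The last entry is \<open>s\<close> because the even part has
      no coefficient of index \<open>n + 1\<close>.\<close>
    define f where "f = interleave (fps_const r * fps_X ^ n)
      (1 + fps_const r * fps_X ^ (2 * n - 2) + fps_const (if n = 2 then r else 0) * fps_X ^ (2 * n - 1)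
        + fps_const s * fps_X ^ (2 * n + 1))"
    have "f \<in> nottingham_lcs n"
      using assms by (auto simp: nottingham_lcs_def f_def agree_def)
    then have "(g, f) \<in> riordan_lcs n"
      using assms by (auto simp: riordan_lcs_iff g_def agree_def)
    moreover have "lcs_map_even n (g, f) = v"
      using assms by (auto simp: lcs_map_even_def f_def g_def eq p q r s)
    ultimately show "v \<in> lcs_map_even n ` riordan_lcs n" by force
  qed
qed

lemma lcs_map_odd_surj:
  assumes "n \<ge> 2" "odd n"
  shows "lcs_map_odd n ` riordan_lcs n = carrier (Zmod 2 \<times>\<times> Zmod 2 \<times>\<times> Zmod 2 \<times>\<times> Zmod 2 \<times>\<times> Zmod 2 \<times>\<times> Zmod 2)"
proof
  show "lcs_map_odd n ` riordan_lcs n \<subseteq> carrier (Zmod 2 \<times>\<times> Zmod 2 \<times>\<times> Zmod 2 \<times>\<times> Zmod 2 \<times>\<times> Zmod 2 \<times>\<times> Zmod 2)"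
    using hom_carrier[OF lcs_map_odd_hom[OF assms]] by simp
  show "carrier (Zmod 2 \<times>\<times> Zmod 2 \<times>\<times> Zmod 2 \<times>\<times> Zmod 2 \<times>\<times> Zmod 2 \<times>\<times> Zmod 2) \<subseteq> lcs_map_odd n ` riordan_lcs n"
  proof
    fix v assume v: "v \<in> carrier (Zmod 2 \<times>\<times> Zmod 2 \<times>\<times> Zmod 2 \<times>\<times> Zmod 2 \<times>\<times> Zmod 2 \<times>\<times> Zmod 2)"
    obtain x y z w w' w'' where eq: "v = (x, y, z, w, w', w'')" by (metis surj_pair)
    from v have m: "x \<in> {0..<2}" "y \<in> {0..<2}" "z \<in> {0..<2}" "w \<in> {0..<2}" "w' \<in> {0..<2}" "w'' \<in> {0..<2}"
      by (auto simp: eq carrier_Zmod)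
    obtain p where p: "x = bit_int p" by (rule obtain_bit_int[OF m(1)])
    obtain q where q: "y = bit_int q" by (rule obtain_bit_int[OF m(2)])
    obtain r where r: "z = bit_int r" by (rule obtain_bit_int[OF m(3)])
    obtain s where s: "w = bit_int s" by (rule obtain_bit_int[OF m(4)])
    obtain s' where s': "w' = bit_int s'" by (rule obtain_bit_int[OF m(5)])
    obtain s'' where s'': "w'' = bit_int s''" by (rule obtain_bit_int[OF m(6)])
    define g where "g = 1 + fps_const p * fps_X ^ (2 * n - 2) + fps_const q * fps_X ^ (2 * n - 1)"
    \<comment> \<open>For odd \<open>n\<close> the forced copy of \<open>r\<close> has index
      \<open>2 * n - 1\<close>, and the coefficient \<open>s\<close> of index
      \<open>2 * n - 2\<close> is free.\<close>
    define f where "f = interleave (fps_const r * fps_X ^ n)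
      (1 + fps_const s * fps_X ^ (2 * n - 2) + fps_const r * fps_X ^ (2 * n - 1)
        + fps_const s' * fps_X ^ (2 * n) + fps_const s'' * fps_X ^ (2 * n + 1))"
    have "f \<in> nottingham_lcs n"
      using assms by (auto simp: nottingham_lcs_def f_def agree_def)
    then have "(g, f) \<in> riordan_lcs n"
      using assms by (auto simp: riordan_lcs_iff g_def agree_def)
    moreover have "lcs_map_odd n (g, f) = v"
      using assms by (auto simp: lcs_map_odd_def f_def g_def eq p q r s s' s'')
    ultimately show "v \<in> lcs_map_odd n ` riordan_lcs n" by force
  qed
qed

lemma riordan_lcs_quotients:
  shows "Riordan Mod riordan_lcs 2 \<cong> Zmod 2 \<times>\<times> Zmod 2 \<times>\<times> Zmod 2 \<times>\<times> Zmod 4"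
    and "n \<ge> 2 \<Longrightarrow> even n \<Longrightarrow> (Riordan\<lparr>carrier := riordan_lcs n\<rparr>) Mod riordan_lcs (Suc n)
      \<cong> Zmod 2 \<times>\<times> Zmod 2 \<times>\<times> Zmod 2 \<times>\<times> Zmod 2"
    and "n \<ge> 2 \<Longrightarrow> odd n \<Longrightarrow> (Riordan\<lparr>carrier := riordan_lcs n\<rparr>) Mod riordan_lcs (Suc n)
      \<cong> Zmod 2 \<times>\<times> Zmod 2 \<times>\<times> Zmod 2 \<times>\<times> Zmod 2 \<times>\<times> Zmod 2 \<times>\<times> Zmod 2"
proof -
  show "Riordan Mod riordan_lcs 2 \<cong> Zmod 2 \<times>\<times> Zmod 2 \<times>\<times> Zmod 2 \<times>\<times> Zmod 4"
    using group_hom.FactGroup_iso[OF group_hom_ab_map ab_map_surj] by (simp add: kernel_ab_map)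
next
  assume n: "n \<ge> 2" "even n"
  then have "group_hom (Riordan\<lparr>carrier := riordan_lcs n\<rparr>) (Zmod 2 \<times>\<times> Zmod 2 \<times>\<times> Zmod 2 \<times>\<times> Zmod 2) (lcs_map_even n)"
    by (intro group_hom.intro group_hom_axioms.intro R.subgroup_imp_group subgroup_riordan_lcs group_Z2_4 lcs_map_even_hom)
      auto
  from group_hom.FactGroup_iso[OF this]
  show "(Riordan\<lparr>carrier := riordan_lcs n\<rparr>) Mod riordan_lcs (Suc n) \<cong> Zmod 2 \<times>\<times> Zmod 2 \<times>\<times> Zmod 2 \<times>\<times> Zmod 2"
    using lcs_map_even_surj[OF n] by (simp add: kernel_lcs_map_even[OF n])
next
  assume n: "n \<ge> 2" "odd n"
  then have "group_hom (Riordan\<lparr>carrier := riordan_lcs n\<rparr>)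
    (Zmod 2 \<times>\<times> Zmod 2 \<times>\<times> Zmod 2 \<times>\<times> Zmod 2 \<times>\<times> Zmod 2 \<times>\<times> Zmod 2) (lcs_map_odd n)"
    by (intro group_hom.intro group_hom_axioms.intro R.subgroup_imp_group subgroup_riordan_lcs group_Z2_6 lcs_map_odd_hom)
      auto
  from group_hom.FactGroup_iso[OF this]
  show "(Riordan\<lparr>carrier := riordan_lcs n\<rparr>) Mod riordan_lcs (Suc n)
      \<cong> Zmod 2 \<times>\<times> Zmod 2 \<times>\<times> Zmod 2 \<times>\<times> Zmod 2 \<times>\<times> Zmod 2 \<times>\<times> Zmod 2"
    using lcs_map_odd_surj[OF n] by (simp add: kernel_lcs_map_odd[OF n])
qed

section \<open>Commutators\<close>

text \<open>Multiplying by \<open>y x\<close> removes the inverses, so the components of a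
  commutator can be found as the solution of an equation.\<close>

lemma rcomm_closed_eq:
  assumes "x \<in> riordan_carrier" "y \<in> riordan_carrier"
  shows "rcomm x y \<in> riordan_carrier"
    "(y \<otimes>\<^bsub>Riordan\<^esub> x) \<otimes>\<^bsub>Riordan\<^esub> rcomm x y = x \<otimes>\<^bsub>Riordan\<^esub> y"
proof -
  have xy: "x \<in> carrier Riordan" "y \<in> carrier Riordan"
    using assms by simp_all
  then show "rcomm x y \<in> riordan_carrier"
    using R.m_closed R.inv_closed unfolding rcomm_def by (metis Riordan_simps(1))
  have "rcomm x y = inv\<^bsub>Riordan\<^esub> (y \<otimes>\<^bsub>Riordan\<^esub> x) \<otimes>\<^bsub>Riordan\<^esub> (x \<otimes>\<^bsub>Riordan\<^esub> y)"
    unfolding rcomm_def using xy by (simp only: R.inv_mult_group R.m_assoc R.inv_closed R.m_closed)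
  then show "(y \<otimes>\<^bsub>Riordan\<^esub> x) \<otimes>\<^bsub>Riordan\<^esub> rcomm x y = x \<otimes>\<^bsub>Riordan\<^esub> y"
    using xy by (simp only: R.inv_solve_left' R.m_closed R.inv_closed flip: R.m_assoc)
      (simp only: R.r_inv R.m_closed R.l_one)
qed

text \<open>Products compose the second components in reverse order, so the last hypothesis is the
  second component of \<open>(y x) c = x y\<close>. The conclusions compare the odd and the even
  parts of its two sides.\<close>

lemma comm_equations:
  fixes x y c :: "bit fps"
  assumes "fps_nth x 0 = 0" "fps_nth y 0 = 0" "c oo (x oo y) = y oo x"
  shows "odd_part y * (odd_part x oo y) * (odd_part c oo (x oo y)) = odd_part x * (odd_part y oo x)"
    "(even_part c oo (x oo y)) + ((even_part x oo y) + even_part y * (odd_part x oo y)) * (odd_part c oo (x oo y))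
      = (even_part y oo x) + even_part x * (odd_part y oo x)"
proof -
  have g: "fps_nth (x oo y) 0 = 0" using assms by simp
  show "odd_part y * (odd_part x oo y) * (odd_part c oo (x oo y)) = odd_part x * (odd_part y oo x)"
    using parts_compose(1)[OF g, of c] unfolding assms(3)
    by (simp add: parts_compose[OF assms(1)] parts_compose[OF assms(2)])
  show "(even_part c oo (x oo y)) + ((even_part x oo y) + even_part y * (odd_part x oo y)) * (odd_part c oo (x oo y))
      = (even_part y oo x) + even_part x * (odd_part y oo x)"
    using parts_compose(2)[OF g, of c] unfolding assms(3)
    by (simp add: parts_compose[OF assms(1)] parts_compose[OF assms(2)])
qed

text \<open>Composition with \<open>g = t + ...\<close> can be cancelled and preserves the leading
  coefficient. Hence it suffices to study a commutator composed with \<open>x oo y\<close>, which is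
  what \<open>comm_equations\<close> provides.\<close>

lemma compose_lead_iff:
  fixes C g :: "bit fps"
  assumes "agree m (C oo g) 1" "fps_nth g 0 = 0" "fps_nth g 1 = 1" "m > 0"
  shows "agree m C 1" "fps_nth C m = fps_nth (C oo g) m"
proof -
  show C: "agree m C 1"
    using agree_compose_cancel[of m C g 1] assms by simp
  then have "agree m (C + 1) 0" by (simp add: agree_1_iff)
  from compose_nth_lead(1)[OF this assms(2,3)]
  show "fps_nth C m = fps_nth (C oo g) m"
    using assms(4) by (simp add: fps_compose_add_distrib)
qed

lemma compose_lead_iff_0:
  fixes C g :: "bit fps"
  assumes "agree m (C oo g) 0" "fps_nth g 0 = 0" "fps_nth g 1 = 1"
  shows "agree m C 0" "fps_nth C m = fps_nth (C oo g) m"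
proof -
  show C: "agree m C 0"
    using agree_compose_cancel[of m C g 0] assms by simp
  from compose_nth_lead(1)[OF this assms(2,3)]
  show "fps_nth C m = fps_nth (C oo g) m" by simp
qed

text \<open>This is a division: \<open>C\<close> composed with \<open>g\<close> is, modulo
  \<open>t^(m+1)\<close>, the quotient of two series that differ in degree \<open>m\<close> at the
  earliest.\<close>

lemma quotient_lead:
  fixes S S' C g :: "bit fps"
  assumes "agree (Suc m) (S' * (C oo g)) S" "agree m S' S" "fps_nth S 0 = 1" "m > 0"
    "fps_nth g 0 = 0" "fps_nth g 1 = 1"
  shows "agree m C 1" "fps_nth C m = fps_nth S' m + fps_nth S m"
proof -
  let ?C = "C oo g"
  have S0: "fps_nth S' 0 = 1"
    using agreeD[OF assms(2), of 0] assms by simp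
  have "agree m (S' * ?C) (S' * 1)"
    using agree_trans[OF agree_mono[OF assms(1), of m] agree_sym[OF assms(2)]] by simp
  then have C: "agree m ?C 1"
    by (rule agree_mult_cancel) (simp add: S0)
  then show "agree m C 1"
    by (rule compose_lead_iff) (use assms in auto)
  have "agree m (?C + 1) 0" using C by (simp add: agree_1_iff)
  then have "fps_nth (S' * (?C + 1)) m = fps_nth ?C m"
    using mult_nth_lead(1)[of m "?C + 1" S'] S0 assms(4) by simp
  moreover have "S' * (?C + 1) = S' * ?C + S'" by (simp add: algebra_simps)
  ultimately have "fps_nth ?C m = fps_nth (S' * ?C) m + fps_nth S' m" by simp
  also have "fps_nth (S' * ?C) m = fps_nth S m"
    using agreeD[OF assms(1), of m] by simp
  finally show "fps_nth C m = fps_nth S' m + fps_nth S m"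
    using compose_lead_iff(2)[OF C assms(5,6,4)] by (simp add: add_ac)
qed

text \<open>As \<open>x\<close> is \<open>t\<close> modulo \<open>t^(2n)\<close> and its odd part is
  1 modulo \<open>t^(2n-2)\<close>, the substitutions occurring in the equation of odd parts have an
  effect only from degree \<open>2n\<close> on. The effect on the odd part of \<open>y\<close> comes
  from \<open>compose_near_X\<close>, the effect on the odd part of \<open>x\<close> from
  \<open>compose_nth_even\<close> with \<open>l = n - 1\<close>.\<close>

lemma nottingham_comm_nth:
  fixes x y c :: "bit fps"
  assumes n: "n \<ge> 2" and x: "x \<in> nottingham_lcs n" and y: "fps_nth y 0 = 0" "fps_nth y 1 = 1"
    and c: "c oo (x oo y) = y oo x"
  shows "agree (2 * n) (odd_part c) 1" "agree (n + 1) (even_part c) 0"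
    "fps_nth (even_part c) (n + 1) = fps_nth y 3 * fps_nth (even_part x) n + of_nat n * fps_nth y 2 * fps_nth (even_part x) n
      + (if n = 2 then fps_nth y 2 * fps_nth (odd_part x) 2 else 0)"
    "fps_nth (odd_part c) (2 * n) = fps_nth (odd_part x) (2 * n - 1) * fps_nth y 2
      + of_nat (n - 1) * fps_nth y 2 * fps_nth (odd_part x) (2 * n - 2) + fps_nth y 3 * fps_nth (even_part x) n"
    "fps_nth (odd_part c) (2 * n + 1) = fps_nth y 3 * fps_nth (odd_part c) (2 * n) + fps_nth y 3 * fps_nth (odd_part x) n
      + fps_nth (odd_part x) (2 * n - 1) * (fps_nth y 3 + of_nat (n - 1) * fps_nth y 2)
      + fps_nth y 3 * (fps_nth (odd_part x) (2 * n - 1) * fps_nth y 2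
        + of_nat (n - 1) * fps_nth y 2 * fps_nth (odd_part x) (2 * n - 2))"
proof -
  define g where "g = x oo y"
  define r q S P where "r = odd_part y" and "q = even_part y" and "S = odd_part x" and "P = even_part x"
  define S' r' C where "S' = S oo y" and "r' = r oo x" and "C = odd_part c oo g"
  have xX: "agree (2 * n) x fps_X"
    using nottingham_lcs_agree_X[OF x] n by simp
  have x0: "fps_nth x 0 = 0" "fps_nth x 1 = 1"
    using nottingham_lcs_nth_0_1[OF x] n by auto
  have g0: "fps_nth g 0 = 0" "fps_nth g 1 = 1"
    using x0 y by (simp_all add: g_def compose_nth_1[unfolded One_nat_def])
  note E = comm_equations[OF x0(1) y(1) c, folded g_def r_def q_def S_def P_def, folded S'_def r'_def C_def]
  have l: "2 * n - 2 = 2 * (n - 1)" "2 * n = 2 * (n - 1) + 2" "2 * n - 1 = 2 * (n - 1) + 1"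
    "2 * n + 1 = 2 * (n - 1) + 3"
    using n by simp_all
  have S: "agree (2 * (n - 1)) S 1" and P: "agree n P 0" and S0: "fps_nth S 0 = 1"
    using x by (auto simp: nottingham_lcs_def S_def P_def l)
  have S1: "fps_nth S 1 = 0"
    using agreeD[OF S, of 1] n by simp
  have r: "fps_nth r 0 = 1" "fps_nth r 1 = fps_nth y 3" and q: "fps_nth q 0 = 0" "fps_nth q 1 = fps_nth y 2"
    using y by (simp_all add: r_def q_def odd_part_nth even_part_nth)
  have S'S: "agree (2 * n) S' S"
    using compose_agree_near[OF S y] l by (simp add: S'_def)
  have r'r: "agree (2 * n) r' r"
    using agree_compose[OF agree_refl xX, of r] by (simp add: r'_def)
  have S'0: "fps_nth S' 0 = 1" "fps_nth S' 1 = 0"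
    using agreeD[OF S'S, of 0] agreeD[OF S'S, of 1] S0 S1 n by simp_all
  have "agree (2 * n) (r * S * C) (r * S' * C)"
    by (intro agree_mult agree_refl agree_sym[OF S'S])
  also have "r * S' * C = S * r'" by (rule E(1))
  also have "agree (2 * n) (S * r') (S * r)"
    by (intro agree_mult agree_refl r'r)
  also have "S * r = r * S * 1" by (simp add: mult_ac)
  finally have C: "agree (2 * n) C 1"
    by (rule agree_mult_cancel) (simp add: r S0)
  then show odc: "agree (2 * n) (odd_part c) 1"
    using compose_lead_iff(1)[of "2 * n" "odd_part c" g] g0 n by (simp add: C_def)

  define k where "k = odd_part c + 1"
  have k: "agree (2 * n) k 0"
    using odc by (simp add: k_def agree_1_iff)
  have kC: "k oo g = C + 1"
    by (simp add: k_def C_def fps_compose_add_distrib)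
  have k': "fps_nth (C + 1) (2 * n) = fps_nth k (2 * n)" "fps_nth (C + 1) (2 * n + 1) = fps_nth k (2 * n + 1)"
    using compose_nth_even(1,2)[OF k g0] by (simp_all only: kC)
  have kk: "fps_nth k (2 * n) = fps_nth (odd_part c) (2 * n)" "fps_nth k (2 * n + 1) = fps_nth (odd_part c) (2 * n + 1)"
    using n by (simp_all add: k_def)
  have e: "agree (2 * n) (S' + S) 0"
    using agree_add[OF S'S agree_refl[of _ S]] by simp
  have d: "agree (2 * n) (r' + r) 0"
    using agree_add[OF r'r agree_refl[of _ r]] by simp
  have K: "agree (2 * n) (C + 1) 0"
    using C by (simp add: agree_1_iff)
  have SK: "agree (2 * n) (S' * (C + 1)) 0"
    using agree_mult[OF agree_refl K, of S'] by simp
  \<comment> \<open>Adding \<open>r * S'\<close> to both sides of the odd equation expresses the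
    deviation of \<open>C\<close> from 1 by the two differences \<open>r' + r\<close> and
    \<open>S' + S\<close>, all of order at least \<open>2 * n\<close>. Comparing two coefficients is
    then linear.\<close>
  have "r * (S' * (C + 1)) = r * S' * C + r * S'" by (simp add: algebra_simps)
  also have "\<dots> = S * (r' + r) + r * (S' + S)"
    unfolding E(1) by (simp add: algebra_simps)
  finally have main: "r * (S' * (C + 1)) = S * (r' + r) + r * (S' + S)" .
  have d1: "fps_nth (r' + r) (2 * n) = fps_nth y 3 * fps_nth P n"
    "fps_nth (r' + r) (Suc (2 * n)) = fps_nth y 3 * fps_nth S n"
    using compose_near_X[OF xX, of r] n r by (simp_all add: r'_def P_def S_def even_part_nth odd_part_nth add_ac)
  have e1: "fps_nth (S' + S) (2 * n) = fps_nth S (2 * n - 1) * fps_nth y 2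
      + of_nat (n - 1) * fps_nth y 2 * fps_nth S (2 * n - 2)"
    "fps_nth (S' + S) (Suc (2 * n)) = fps_nth S (2 * n - 1) * (fps_nth y 3 + of_nat (n - 1) * fps_nth y 2)"
  proof -
    have S1: "agree (2 * (n - 1)) (S + 1) 0"
      using S by (simp add: agree_1_iff)
    have z: "(S + 1) oo y = S' + 1"
      by (simp add: S'_def fps_compose_add_distrib)
    have nz: "fps_nth (f + 1) (2 * (n - 1) + i) = fps_nth f (2 * (n - 1) + i)"
      "fps_nth (f + 1) (2 * (n - 1)) = fps_nth f (2 * (n - 1))" if "i > 0" for f :: "bit fps" and i
      using n that by simp_all
    show "fps_nth (S' + S) (2 * n) = fps_nth S (2 * n - 1) * fps_nth y 2
      + of_nat (n - 1) * fps_nth y 2 * fps_nth S (2 * n - 2)"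
      using compose_nth_even(3)[OF S1 y] unfolding z l by (simp add: nz add_ac)
    have "fps_nth (S' + S) (2 * (n - 1) + 3)
      = fps_nth S (2 * (n - 1) + 1) * (fps_nth y 3 + of_nat (n - 1) * fps_nth y 2)"
      using compose_nth_even(4)[OF S1 y] unfolding z by (simp add: nz add_ac)
    moreover have "Suc (2 * n) = 2 * (n - 1) + 3" using l by simp
    ultimately show "fps_nth (S' + S) (Suc (2 * n)) = fps_nth S (2 * n - 1) * (fps_nth y 3 + of_nat (n - 1) * fps_nth y 2)"
      by (simp only: l(3))
  qed
  have "fps_nth k (2 * n) = fps_nth (r' + r) (2 * n) + fps_nth (S' + S) (2 * n)"
    using arg_cong[OF main, of "\<lambda>f. fps_nth f (2 * n)"] k'(1) r S0 S'0
    unfolding fps_add_nth[of "S * (r' + r)"] mult_nth_lead(1)[OF SK] mult_nth_lead(1)[OF K]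
      mult_nth_lead(1)[OF d] mult_nth_lead(1)[OF e] by (simp only: mult_1_left)
  then show 1: "fps_nth (odd_part c) (2 * n) = fps_nth (odd_part x) (2 * n - 1) * fps_nth y 2
      + of_nat (n - 1) * fps_nth y 2 * fps_nth (odd_part x) (2 * n - 2) + fps_nth y 3 * fps_nth (even_part x) n"
    unfolding d1 e1 kk by (simp add: S_def P_def add_ac)
  have "fps_nth k (2 * n + 1) + fps_nth y 3 * fps_nth k (2 * n) = fps_nth (r' + r) (Suc (2 * n))
     + (fps_nth (S' + S) (Suc (2 * n)) + fps_nth y 3 * fps_nth (S' + S) (2 * n))"
    using arg_cong[OF main, of "\<lambda>f. fps_nth f (Suc (2 * n))"] k' r S0 S1 S'0
    unfolding fps_add_nth[of "S * (r' + r)"] mult_nth_lead[OF SK] mult_nth_lead[OF K]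
      mult_nth_lead[OF d] mult_nth_lead[OF e]
    by (simp only: mult_1_left mult_zero_left add_0_right Suc_eq_plus1)
  then have "fps_nth (odd_part c) (2 * n + 1) = fps_nth y 3 * fps_nth k (2 * n) + (fps_nth (r' + r) (Suc (2 * n))
     + (fps_nth (S' + S) (Suc (2 * n)) + fps_nth y 3 * fps_nth (S' + S) (2 * n)))"
    unfolding kk by (metis add.commute bit_add_self_left)
  then show "fps_nth (odd_part c) (2 * n + 1) = fps_nth y 3 * fps_nth (odd_part c) (2 * n) + fps_nth y 3 * fps_nth (odd_part x) n
      + fps_nth (odd_part x) (2 * n - 1) * (fps_nth y 3 + of_nat (n - 1) * fps_nth y 2)
      + fps_nth y 3 * (fps_nth (odd_part x) (2 * n - 1) * fps_nth y 2
        + of_nat (n - 1) * fps_nth y 2 * fps_nth (odd_part x) (2 * n - 2))"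
    unfolding d1 e1 kk by (simp only: S_def P_def add.assoc)

  define F where "F = even_part c oo g"
  \<comment> \<open>Modulo \<open>t^(2n)\<close> the series \<open>C\<close>, \<open>S'\<close>,
    \<open>r'\<close> and \<open>q oo x\<close> may be replaced by \<open>1\<close>,
    \<open>S\<close>, \<open>r\<close> and \<open>q\<close>. Nothing needed is lost, since
    \<open>n + 1 < 2 * n\<close>.\<close>
  have "agree (2 * n) (((P oo y) + q * S') * C) (((P oo y) + q * S) * 1)"
    by (intro agree_mult agree_add agree_refl C S'S)
  moreover have "agree (2 * n) ((q oo x) + P * r') (q + P * r)"
    using agree_compose[OF agree_refl xX, of q] by (intro agree_mult agree_add agree_refl r'r) simp
  moreover have "F = ((P oo y) + q * S') * C + ((q oo x) + P * r')"
    unfolding E(2)[folded F_def, symmetric] by (simp add: add_ac)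
  ultimately have "agree (2 * n) F (((P oo y) + q * S) * 1 + (q + P * r))"
    using agree_add by metis
  also have "((P oo y) + q * S) * 1 + (q + P * r) = (P oo y) + r * P + q * (S + 1)"
    by (simp add: algebra_simps)
  finally have F: "agree (2 * n) F ((P oo y) + r * P + q * (S + 1))" .
  have q1: "agree 1 q 0" using q by (simp add: agree_def)
  have Sm: "agree (2 * n - 2) (S + 1) 0"
    using S by (simp add: agree_1_iff l)
  have "agree (1 + (2 * n - 2)) (q * (S + 1)) 0"
    by (rule agree_0_mult[OF q1 Sm])
  then have qS: "agree (2 * n - 1) (q * (S + 1)) 0"
    using n by (simp add: agree_def)
  have Py: "agree n (P oo y) 0" by (rule agree_0_compose[OF P y(1)])
  have rP: "agree n (r * P) 0" using agree_mult[OF agree_refl P, of r] by simp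
  have Fn: "fps_nth F k = fps_nth (P oo y) k + fps_nth (r * P) k + fps_nth (q * (S + 1)) k" if "k < 2 * n" for k
    using agreeD[OF F that] by (simp only: fps_add_nth)
  have "fps_nth F k = 0" if "k < n + 1" for k
  proof (cases "k = n")
    case True
    have "fps_nth F n = fps_nth P n + fps_nth P n + 0"
      using Fn[of n] compose_nth_lead(1)[OF P y] mult_nth_lead(1)[OF P, of r] agreeD[OF qS, of n] n r
      by simp
    then show ?thesis using True by simp
  next
    case False
    then have "k < n" "k < 2 * n - 1" "k < 2 * n" using that by auto
    then show ?thesis
      using Fn[of k] agreeD[OF Py, of k] agreeD[OF rP, of k] agreeD[OF qS, of k] by simp
  qed
  then have F0: "agree (n + 1) F 0" by (simp add: agree_def)
  then show "agree (n + 1) (even_part c) 0"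
    unfolding F_def by (rule compose_lead_iff_0) (use g0 in auto)
  have "fps_nth (even_part c) (n + 1) = fps_nth F (n + 1)"
    using compose_lead_iff_0(2)[OF F0[unfolded F_def] g0] by (simp add: F_def)
  also have "\<dots> = fps_nth (P oo y) (n + 1) + fps_nth (r * P) (n + 1) + fps_nth (q * (S + 1)) (n + 1)"
    using n by (intro Fn) auto
  also have "fps_nth (P oo y) (n + 1) = fps_nth P (n + 1) + of_nat n * fps_nth y 2 * fps_nth P n"
    using compose_nth_lead(2)[OF P y] by simp
  also have "fps_nth (r * P) (n + 1) = fps_nth P (n + 1) + fps_nth y 3 * fps_nth P n"
    using mult_nth_lead(2)[OF P, of r] r by simp
  \<comment> \<open>The product has order at least \<open>2 * n - 1\<close>, and this equals
    \<open>n + 1\<close> only for \<open>n = 2\<close>.\<close>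
  also have "fps_nth (q * (S + 1)) (n + 1) = (if n = 2 then fps_nth y 2 * fps_nth S 2 else 0)"
  proof (cases "n = 2")
    case True
    then show ?thesis
      using mult_nth_lead(2)[OF Sm, of q] q by (simp add: numeral_3_eq_3 numeral_2_eq_2)
  next
    case False
    then show ?thesis using agreeD[OF qS, of "n + 1"] n by simp
  qed
  finally show "fps_nth (even_part c) (n + 1) = fps_nth y 3 * fps_nth (even_part x) n + of_nat n * fps_nth y 2 * fps_nth (even_part x) n
      + (if n = 2 then fps_nth y 2 * fps_nth (odd_part x) 2 else 0)"
    by (simp add: S_def P_def add_ac)
qed

text \<open>Inserting the relations of stage \<open>n\<close> into the commutator coefficients
  produces those of stage \<open>n + 1\<close>. For even \<open>n > 2\<close> the coefficients
  \<open>P_(n+1)\<close> and \<open>S_(2n+1)\<close> of \<open>c\<close> both become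
  \<open>y_3 * P_n\<close>, with \<open>P_n\<close> taken from \<open>x\<close>; for
  \<open>n = 2\<close> both become \<open>(y_2 + y_3) * P_n\<close>. For odd \<open>n\<close> this
  last value is shared by \<open>P_(n+1)\<close> and \<open>S_(2n)\<close>, while the terms of
  \<open>S_(2n+1)\<close> cancel.\<close>

lemma nottingham_comm:
  assumes n: "n \<ge> 2" and x: "x \<in> nottingham_lcs n" and y: "fps_nth y 0 = 0" "fps_nth y 1 = 1"
    and c: "c oo (x oo y) = y oo x"
  shows "c \<in> nottingham_lcs (Suc n)"
proof -
  note C = nottingham_comm_nth[OF assms]
  have c0: "fps_nth (odd_part c) 0 = 1"
    using agreeD[OF C(1), of 0] n by simp
  have a: "2 * Suc n - 2 = 2 * n" "2 * Suc n - 1 = 2 * n + 1" by simp_all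
  have Sn: "fps_nth (odd_part x) n = 0" if "n \<noteq> 2"
    using x n that by (auto simp: nottingham_lcs_def agree_def)
  consider "n = 2" | "n > 2" "even n" | "n > 2" "odd n" using n by linarith
  then show ?thesis
  proof cases
    case 1
    then have "fps_nth (odd_part x) 2 = fps_nth (even_part x) 2" "fps_nth (odd_part x) 3 = fps_nth (even_part x) 2"
      using x by (auto simp: nottingham_lcs_def)
    then show ?thesis
      using C(1,2) C(3-5)[unfolded 1] c0 unfolding nottingham_lcs_def mem_Collect_eq a
      by (simp add: 1 numeral_3_eq_3 algebra_simps)
  next
    case 2
    then have "fps_nth (odd_part x) (2 * n - 2) = fps_nth (even_part x) n" "fps_nth (odd_part x) (2 * n - 1) = 0"
      using x by (auto simp: nottingham_lcs_def)
    moreover have "(of_nat n :: bit) = 0" "(of_nat (n - 1) :: bit) = 1"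
      using 2 by (auto simp: of_nat_diff elim!: evenE)
    ultimately show ?thesis
      using C(1,2) C(3-5) c0 2 Sn unfolding nottingham_lcs_def mem_Collect_eq a
      by (simp add: algebra_simps)
  next
    case 3
    then have "fps_nth (odd_part x) (2 * n - 1) = fps_nth (even_part x) n"
      using x by (auto simp: nottingham_lcs_def)
    moreover have "(of_nat n :: bit) = 1" "(of_nat (n - 1) :: bit) = 0"
      using 3 by (auto elim!: oddE)
    ultimately show ?thesis
      using C(1,2) C(3-5) c0 3 Sn unfolding nottingham_lcs_def mem_Collect_eq a
      by (simp add: algebra_simps)
  qed
qed

text \<open>The target of \<open>ab_map\<close> is abelian, and \<open>riordan_lcs 2\<close> is the
  kernel.\<close>

lemma comm_riordan_lcs_1:
  assumes "x \<in> riordan_carrier" "y \<in> riordan_carrier"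
  shows "rcomm x y \<in> riordan_lcs 2"
proof -
  let ?H = "Zmod 2 \<times>\<times> Zmod 2 \<times>\<times> Zmod 2 \<times>\<times> Zmod 4"
  interpret h: group_hom Riordan ?H ab_map by (rule group_hom_ab_map)
  have xy: "x \<in> carrier Riordan" "y \<in> carrier Riordan" "rcomm x y \<in> carrier Riordan"
    using assms rcomm_closed_eq(1) by simp_all
  have comm: "ab_map x \<otimes>\<^bsub>?H\<^esub> ab_map y = ab_map y \<otimes>\<^bsub>?H\<^esub> ab_map x"
    by (simp add: mult_DirProd' add.commute)
  have "ab_map ((y \<otimes>\<^bsub>Riordan\<^esub> x) \<otimes>\<^bsub>Riordan\<^esub> rcomm x y) = ab_map (x \<otimes>\<^bsub>Riordan\<^esub> y)"
    using rcomm_closed_eq(2)[OF assms] by simp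
  then have "(ab_map y \<otimes>\<^bsub>?H\<^esub> ab_map x) \<otimes>\<^bsub>?H\<^esub> ab_map (rcomm x y) = ab_map y \<otimes>\<^bsub>?H\<^esub> ab_map x"
    using xy comm by (simp only: h.hom_mult R.m_closed)
  then have "ab_map (rcomm x y) = \<one>\<^bsub>?H\<^esub>"
    using xy by (metis h.H.l_cancel_one h.H.m_closed h.hom_closed)
  then have "rcomm x y \<in> kernel Riordan ?H ab_map"
    using xy(3) by (simp only: kernel_def mem_Collect_eq)
  then show ?thesis by (simp only: kernel_ab_map)
qed

lemma comm_components:
  assumes "(g1, f1) \<in> riordan_carrier" "(g2, f2) \<in> riordan_carrier"
  obtains cg cf where "rcomm (g1, f1) (g2, f2) = (cg, cf)" "(cg, cf) \<in> riordan_carrier"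
    "cf oo (f1 oo f2) = f2 oo f1" "g2 * (g1 oo f2) * (cg oo (f1 oo f2)) = g1 * (g2 oo f1)"
proof -
  obtain cg cf where c: "rcomm (g1, f1) (g2, f2) = (cg, cf)" by fastforce
  show ?thesis
    using rcomm_closed_eq[OF assms] unfolding c Riordan_simps
    by (intro that[OF c]) auto
qed

lemma compose_carrier_nth:
  fixes f h :: "bit fps"
  assumes "fps_nth f 0 = 0" "fps_nth f 1 = 1" "fps_nth h 0 = 0" "fps_nth h 1 = 1"
  shows "fps_nth (f oo h) 0 = 0" "fps_nth (f oo h) 1 = 1"
  using assms by (simp_all add: compose_nth_1[unfolded One_nat_def])

text \<open>Modulo \<open>t^(2n)\<close>, substituting \<open>f2\<close> does not change
  \<open>g1\<close>, because \<open>g1 - 1\<close> is divisible by the even power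
  \<open>t^(2n-2)\<close>, and substituting \<open>f1\<close> does not change \<open>g2\<close>,
  because \<open>f1\<close> is \<open>t\<close> modulo \<open>t^(2n)\<close>. Cancelling
  \<open>g1 * g2\<close> leaves the first component of the commutator congruent to 1.\<close>

lemma comm_riordan_lcs:
  assumes n: "n \<ge> 1" and x: "x \<in> riordan_lcs n" and y: "y \<in> riordan_carrier"
  shows "rcomm x y \<in> riordan_lcs (Suc n)"
proof (cases "n = 1")
  case True
  then show ?thesis
    using comm_riordan_lcs_1[of x y] x y by (simp add: numeral_2_eq_2 riordan_lcs_1[unfolded One_nat_def])
next
  case False
  then have n2: "n \<ge> 2" using n by simp
  obtain g1 f1 g2 f2 where eq: "x = (g1, f1)" "y = (g2, f2)" by fastforce
  have xR: "(g1, f1) \<in> riordan_carrier"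
    using x riordan_lcs_subset[OF n] unfolding eq by blast
  obtain cg cf where c: "rcomm (g1, f1) (g2, f2) = (cg, cf)" "(cg, cf) \<in> riordan_carrier"
    "cf oo (f1 oo f2) = f2 oo f1" "g2 * (g1 oo f2) * (cg oo (f1 oo f2)) = g1 * (g2 oo f1)"
    using comm_components[OF xR y[unfolded eq]] by blast
  have y0: "fps_nth f2 0 = 0" "fps_nth f2 1 = 1" "fps_nth g2 0 = 1"
    using y by (auto simp: eq)
  have x0: "fps_nth f1 0 = 0" "fps_nth f1 1 = 1" "fps_nth g1 0 = 1"
    using xR by auto
  have f1: "f1 \<in> nottingham_lcs n" and g1: "agree (2 * n - 2) g1 1"
    using x by (auto simp: eq riordan_lcs_iff)
  have l: "2 * n - 2 = 2 * (n - 1)" "2 * n = 2 * (n - 1) + 2" using n2 by simp_all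
  have "agree (2 * n) (g1 oo f2) g1"
    using compose_agree_near[OF g1[unfolded l(1)] y0(1,2)] l by simp
  then have 1: "agree (2 * n) (g2 * (g1 oo f2) * (cg oo (f1 oo f2))) (g2 * g1 * (cg oo (f1 oo f2)))"
    by (intro agree_mult agree_refl)
  have "agree (2 * n) (g2 oo f1) g2"
    using agree_compose[OF agree_refl nottingham_lcs_agree_X[OF f1 n], of g2] by simp
  then have "agree (2 * n) (g1 * (g2 oo f1)) (g1 * g2)"
    by (intro agree_mult agree_refl)
  with 1 have "agree (2 * n) (g2 * g1 * (cg oo (f1 oo f2))) (g2 * g1 * 1)"
    unfolding c(4) by (metis agree_sym agree_trans mult.commute mult.right_neutral)
  then have "agree (2 * n) (cg oo (f1 oo f2)) 1"
    by (rule agree_mult_cancel) (simp add: x0 y0)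
  then have "agree (2 * n) cg 1"
    by (rule compose_lead_iff) (use compose_carrier_nth[OF x0(1,2) y0(1,2)] n in auto)
  moreover have "cf \<in> nottingham_lcs (Suc n)"
    by (rule nottingham_comm[OF n2 f1 y0(1,2) c(3)])
  ultimately show ?thesis
    using c(1,2) by (simp add: eq riordan_lcs_iff)
qed

section \<open>The Nottingham and Appell subgroups\<close>

lemma Nottingham_iff: "(g, f) \<in> Nottingham \<longleftrightarrow> g = 1 \<and> fps_nth f 0 = 0 \<and> fps_nth f 1 = 1"
  by (auto simp: Nottingham_def)

lemma subgroup_Nottingham: "subgroup Nottingham Riordan"
proof (rule R.subgroupI)
  show "Nottingham \<subseteq> carrier Riordan" by (auto simp: Nottingham_def)
  show "Nottingham \<noteq> {}" using Nottingham_iff[of 1 fps_X] by auto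
next
  fix x assume x: "x \<in> Nottingham"
  then obtain f where f: "x = (1, f)" "fps_nth f 0 = 0" "fps_nth f 1 = 1"
    by (cases x) (auto simp: Nottingham_iff)
  have h: "fps_nth (fps_inv f) 0 = 0" "fps_nth (fps_inv f) 1 = 1"
    using f by (simp_all add: fps_inv_def)
  have "(1, fps_inv f) \<otimes>\<^bsub>Riordan\<^esub> x = \<one>\<^bsub>Riordan\<^esub>"
    using f by (simp add: fps_inv_right)
  then have "inv\<^bsub>Riordan\<^esub> x = (1, fps_inv f)"
    using f h by (intro R.inv_equality) auto
  then show "inv\<^bsub>Riordan\<^esub> x \<in> Nottingham"
    using h by (simp add: Nottingham_iff)
next
  fix x y assume "x \<in> Nottingham" "y \<in> Nottingham"
  then show "x \<otimes>\<^bsub>Riordan\<^esub> y \<in> Nottingham"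
    by (cases x; cases y) (auto simp: Nottingham_iff compose_nth_1[unfolded One_nat_def])
qed

lemma Appell_m_iff: "(g, f) \<in> Appell_m m \<longleftrightarrow> f = fps_X \<and> fps_nth g 0 = 1 \<and> agree (Suc m) g 1"
proof -
  have "(\<forall>k. 1 \<le> k \<and> k \<le> m \<longrightarrow> fps_nth g k = 0) \<longleftrightarrow> agree (Suc m) g 1" if "fps_nth g 0 = 1"
    using that by (auto simp: agree_def less_Suc_eq_le Suc_le_eq)
  then show ?thesis by (auto simp: Appell_m_def Appell_def)
qed

text \<open>First components commute, so conjugating \<open>(g, t)\<close> by \<open>(a, b)\<close>
  gives \<open>(g oo b, t)\<close>, and substitution respects congruence to 1.\<close>

lemma Appell_m_normal: "Appell_m m \<lhd> Riordan"
proof -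
  have inv: "inv\<^bsub>Riordan\<^esub> (g, fps_X) = (inverse g, fps_X)" if "fps_nth g 0 = 1" for g
    using that by (intro R.inv_equality) (auto simp: inverse_mult_eq_1)
  have "subgroup (Appell_m m) Riordan"
  proof (rule R.subgroupI)
    show "Appell_m m \<subseteq> carrier Riordan" by (auto simp: Appell_m_iff)
    show "Appell_m m \<noteq> {}" using Appell_m_iff[of 1 fps_X m] by auto
  next
    fix x assume "x \<in> Appell_m m"
    then obtain g where g: "x = (g, fps_X)" "fps_nth g 0 = 1" "agree (Suc m) g 1"
      by (cases x) (auto simp: Appell_m_iff)
    have "agree (Suc m) (g * inverse g) (g * 1)"
      using g by (simp add: inverse_mult_eq_1' agree_sym)
    then have "agree (Suc m) (inverse g) 1"
      by (rule agree_mult_cancel) (simp add: g)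
    then show "inv\<^bsub>Riordan\<^esub> x \<in> Appell_m m"
      using g by (simp add: inv Appell_m_iff)
  next
    fix x y assume "x \<in> Appell_m m" "y \<in> Appell_m m"
    then show "x \<otimes>\<^bsub>Riordan\<^esub> y \<in> Appell_m m"
      using agree_mult[of "Suc m" "fst x" 1 "fst y" 1] by (cases x; cases y) (auto simp: Appell_m_iff)
  qed
  moreover have "x \<otimes>\<^bsub>Riordan\<^esub> h \<otimes>\<^bsub>Riordan\<^esub> inv\<^bsub>Riordan\<^esub> x \<in> Appell_m m"
    if x: "x \<in> carrier Riordan" and hA: "h \<in> Appell_m m" for x h
  proof -
    obtain g where h: "h = (g, fps_X)" "fps_nth g 0 = 1" "agree (Suc m) g 1"
      using hA by (cases h) (auto simp: Appell_m_iff)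
    obtain a b where ab: "x = (a, b)" "fps_nth b 0 = 0" using x by (cases x) auto
    have "x \<otimes>\<^bsub>Riordan\<^esub> h = (g oo b, fps_X) \<otimes>\<^bsub>Riordan\<^esub> x"
      using ab h by (simp add: mult_ac)
    moreover have "(g oo b, fps_X) \<in> carrier Riordan" using h by simp
    ultimately have "x \<otimes>\<^bsub>Riordan\<^esub> h \<otimes>\<^bsub>Riordan\<^esub> inv\<^bsub>Riordan\<^esub> x = (g oo b, fps_X)"
      using x by (metis R.inv_solve_right R.m_closed)
    moreover have "agree (Suc m) (g oo b) 1"
      using agree_compose[OF h(3) agree_refl, of b] by simp
    ultimately show ?thesis using h by (simp add: Appell_m_iff)
  qed
  ultimately show ?thesis by (simp only: R.normal_inv_iff) blast
qed

section \<open>Closed subgroups\<close>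

lemma rclosureD:
  assumes "x \<in> rclosure S"
  shows "x \<in> riordan_carrier" "\<exists>h\<in>S. agree N (fst h) (fst x) \<and> agree N (snd h) (snd x)"
proof -
  show "x \<in> riordan_carrier" using assms unfolding rclosure_def by blast
  obtain h where "h \<in> S" "\<forall>k\<le>N. fps_nth (fst h) k = fps_nth (fst x) k \<and> fps_nth (snd h) k = fps_nth (snd x) k"
    using assms unfolding rclosure_def by blast
  then show "\<exists>h\<in>S. agree N (fst h) (fst x) \<and> agree N (snd h) (snd x)"
    by (intro bexI[of _ h]) (simp_all add: agree_def)
qed

text \<open>A set of group elements on which membership depends only on the coefficients below a
  fixed \<open>N\<close> is closed.\<close>

lemma rclosure_eqI:
  assumes "S \<subseteq> riordan_carrier"
    and "\<And>g f g' f'. (g', f') \<in> S \<Longrightarrow> (g, f) \<in> riordan_carrier \<Longrightarrow> agree N g' g \<Longrightarrow> agree N f' f \<Longrightarrow> (g, f) \<in> S"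
  shows "rclosure S = S"
proof
  show "S \<subseteq> rclosure S" using assms(1) by (auto simp: rclosure_def)
  show "rclosure S \<subseteq> S"
  proof
    fix x assume x: "x \<in> rclosure S"
    then obtain h where h: "h \<in> S" "agree N (fst h) (fst x)" "agree N (snd h) (snd x)"
      using rclosureD(2) by blast
    have "(fst x, snd x) \<in> S"
      using h rclosureD(1)[OF x] assms(2)[where g'="fst h" and f'="snd h" and g="fst x" and f="snd x"] by simp
    then show "x \<in> S" by simp
  qed
qed

lemma nottingham_lcs_cong:
  assumes "agree (4 * n + 4) f f'" "f \<in> nottingham_lcs n"
  shows "f' \<in> nottingham_lcs n"
proof -
  have "fps_nth (even_part f) k = fps_nth (even_part f') k" "fps_nth (odd_part f) k = fps_nth (odd_part f') k" if "k < 2 * n + 1" for k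
    using assms(1) that by (auto simp: agree_def even_part_nth odd_part_nth)
  then show ?thesis
    using assms(2) by (auto simp: nottingham_lcs_def agree_def)
qed

lemma closed_riordan_lcs:
  assumes "n \<ge> 1"
  shows "rclosure (riordan_lcs n) = riordan_lcs n"
proof (rule rclosure_eqI[OF riordan_lcs_subset[OF assms]])
  fix g f g' f'
  assume *: "(g', f') \<in> riordan_lcs n" "(g, f) \<in> riordan_carrier" "agree (4 * n + 4) g' g" "agree (4 * n + 4) f' f"
  then show "(g, f) \<in> riordan_lcs n"
    using nottingham_lcs_cong[OF *(4)] by (auto simp: riordan_lcs_iff agree_def)
qed

text \<open>The condition \<open>g = 1\<close> involves all coefficients, so
  \<open>rclosure_eqI\<close> does not apply to it; an approximating element is chosen for each
  coefficient separately.\<close>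

lemma closed_riordan_lcs_Nottingham:
  assumes "n \<ge> 1"
  shows "rclosure (riordan_lcs n \<inter> Nottingham) = riordan_lcs n \<inter> Nottingham"
proof -
  have mono: "S \<subseteq> T \<Longrightarrow> rclosure S \<subseteq> rclosure T" for S T
    unfolding rclosure_def by blast
  have sub: "S \<subseteq> rclosure S" if "S \<subseteq> riordan_carrier" for S
    using that unfolding rclosure_def by blast
  have "rclosure Nottingham \<subseteq> Nottingham"
  proof
    fix x assume x: "x \<in> rclosure Nottingham"
    obtain g f where gf: "x = (g, f)" by fastforce
    have "fps_nth g k = fps_nth 1 k" for k
    proof -
      obtain h where "h \<in> Nottingham" "agree (Suc k) (fst h) g"
        using rclosureD(2)[OF x, of "Suc k"] gf by auto
      then show ?thesis by (cases h) (auto simp: Nottingham_iff agree_def)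
    qed
    then have "g = 1" by (intro fps_ext) auto
    then show "x \<in> Nottingham" using rclosureD(1)[OF x] by (simp add: gf Nottingham_iff)
  qed
  moreover have "rclosure (riordan_lcs n \<inter> Nottingham) \<subseteq> riordan_lcs n"
    using mono[of "riordan_lcs n \<inter> Nottingham" "riordan_lcs n"] closed_riordan_lcs[OF assms] by blast
  moreover have "rclosure (riordan_lcs n \<inter> Nottingham) \<subseteq> rclosure Nottingham"
    by (rule mono) blast
  ultimately show ?thesis
    using sub[of "riordan_lcs n \<inter> Nottingham"] riordan_lcs_subset[OF assms] by blast
qed

text \<open>Dividing \<open>x\<close> again and again by elements of \<open>K\<close> with the same
  leading coefficients gives factorizations of \<open>x\<close> into an element of \<open>K\<close>
  and a remainder that tends to the identity; so \<open>x\<close> is a limit of elements of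
  \<open>K\<close>. The assumption \<open>D1\<close> is the start, as \<open>step\<close> only
  handles coefficients of index at least 2.\<close>

lemma sift:
  assumes K: "subgroup K Riordan" "rclosure K = K" and D: "subgroup D Riordan"
    and D1: "\<And>g f. (g, f) \<in> D \<Longrightarrow> fps_nth g 1 = 0"
    and step: "\<And>m g f. m \<ge> 1 \<Longrightarrow> (g, f) \<in> D \<Longrightarrow> agree (Suc m) g 1 \<Longrightarrow> agree (Suc m) f fps_X \<Longrightarrow>
      \<exists>g' f'. (g', f') \<in> K \<inter> D \<and> agree (Suc m) g' 1 \<and> agree (Suc m) f' fps_X \<and>
        fps_nth g' (Suc m) = fps_nth g (Suc m) \<and> fps_nth f' (Suc m) = fps_nth f (Suc m)"
  shows "D \<subseteq> K"
proof
  fix x assume x: "x \<in> D"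
  have KC: "\<And>k. k \<in> K \<Longrightarrow> k \<in> carrier Riordan" and DC: "\<And>k. k \<in> D \<Longrightarrow> k \<in> carrier Riordan"
    using subgroup.mem_carrier[OF K(1)] subgroup.mem_carrier[OF D] by auto
  have main: "\<exists>k g f. k \<in> K \<and> (g, f) \<in> D \<and> x = k \<otimes>\<^bsub>Riordan\<^esub> (g, f) \<and> agree (Suc N) g 1 \<and> agree (Suc N) f fps_X"
    if "N \<ge> 1" for N
    using that
  proof (induction N rule: nat_induct_at_least)
    case base
    obtain g f where gf: "x = (g, f)" by fastforce
    have "agree 2 g 1" "agree 2 f fps_X"
      using DC[OF x] D1[of g f] x by (auto simp: gf agree_def less_2_cases_iff)
    moreover have "x = \<one>\<^bsub>Riordan\<^esub> \<otimes>\<^bsub>Riordan\<^esub> (g, f)"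
      by (simp add: gf)
    ultimately show ?case
      using x subgroup.one_closed[OF K(1)] unfolding gf by (metis Suc_1 One_nat_def)
  next
    case (Suc N)
    then obtain k g f where k: "k \<in> K" "(g, f) \<in> D" "x = k \<otimes>\<^bsub>Riordan\<^esub> (g, f)"
      "agree (Suc N) g 1" "agree (Suc N) f fps_X" by blast
    from step[OF Suc.hyps k(2,4,5)] obtain g' f' where z: "(g', f') \<in> K" "(g', f') \<in> D"
      "agree (Suc N) g' 1" "agree (Suc N) f' fps_X"
      "fps_nth g' (Suc N) = fps_nth g (Suc N)" "fps_nth f' (Suc N) = fps_nth f (Suc N)" by blast
    \<comment> \<open>The new remainder. Both factors of the quotient lie in \<open>D\<close> and
      share their coefficients up to index \<open>N + 1\<close>, so it stays in \<open>D\<close> and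
      agrees with the identity one degree further.\<close>
    define y where "y = inv\<^bsub>Riordan\<^esub> (g', f') \<otimes>\<^bsub>Riordan\<^esub> (g, f)"
    obtain a b where y: "y = (a, b)" by fastforce
    have yD: "(a, b) \<in> D"
      unfolding y[symmetric] y_def using z k D by (simp only: subgroup.m_closed subgroup.m_inv_closed)
    have zy: "(g', f') \<otimes>\<^bsub>Riordan\<^esub> (a, b) = (g, f)"
      unfolding y[symmetric] y_def using DC[OF z(2)] DC[OF k(2)]
      by (metis R.inv_closed R.l_one R.m_assoc R.r_inv)
    have "x = (k \<otimes>\<^bsub>Riordan\<^esub> (g', f')) \<otimes>\<^bsub>Riordan\<^esub> (a, b)"
      unfolding k(3) zy[symmetric] using KC[OF k(1)] DC[OF z(2)] DC[OF yD] by (simp only: R.m_assoc)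
    moreover have "k \<otimes>\<^bsub>Riordan\<^esub> (g', f') \<in> K"
      using K(1) k z by (simp only: subgroup.m_closed)
    moreover have f': "fps_nth g' 0 = 1" "fps_nth f' 0 = 0" "fps_nth f' 1 = 1"
      using DC[OF z(2)] by auto
    have "agree (Suc (Suc N)) (g' * (a oo f')) (g' * 1)" "agree (Suc (Suc N)) (b oo f') (fps_X oo f')"
      using zy z k f' by (auto simp: agree_def less_Suc_eq)
    then have "agree (Suc (Suc N)) (a oo f') (1 oo f')" "agree (Suc (Suc N)) b fps_X"
      using agree_mult_cancel[of "Suc (Suc N)" g' "a oo f'" 1] agree_compose_cancel[of "Suc (Suc N)" b f' fps_X] f'
      by auto
    then have "agree (Suc (Suc N)) a 1" "agree (Suc (Suc N)) b fps_X"
      using agree_compose_cancel[of "Suc (Suc N)" a f' 1] f' by auto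
    ultimately show ?case using yD by blast
  qed
  have "x \<in> rclosure K"
    unfolding rclosure_def mem_Collect_eq
  proof (intro conjI allI)
    show "x \<in> riordan_carrier" using DC[OF x] by simp
    fix N
    obtain k g f where k: "k \<in> K" "(g, f) \<in> D" "x = k \<otimes>\<^bsub>Riordan\<^esub> (g, f)"
      "agree (Suc (Suc N)) g 1" "agree (Suc (Suc N)) f fps_X"
      using main[of "Suc N"] by auto
    obtain a b where ab: "k = (a, b)" "fps_nth b 0 = 0" using KC[OF k(1)] by (cases k) auto
    have "agree (Suc (Suc N)) (a * (g oo b)) (a * 1)" "agree (Suc (Suc N)) (f oo b) b"
      using agree_mult[OF agree_refl agree_compose[OF k(4) agree_refl, of b], of a]
        agree_compose[OF k(5) agree_refl, of b] ab by simp_all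
    then have "\<forall>i\<le>N. fps_nth (fst k) i = fps_nth (fst x) i \<and> fps_nth (snd k) i = fps_nth (snd x) i"
      by (auto simp: k(3) ab agree_def)
    then show "\<exists>h\<in>K. \<forall>i\<le>N. fps_nth (fst h) i = fps_nth (fst x) i \<and> fps_nth (snd h) i = fps_nth (snd x) i"
      using k(1) by blast
  qed
  then show "x \<in> K" by (simp add: K(2))
qed

section \<open>Explicit commutators with prescribed leading coefficients\<close>

text \<open>For odd \<open>j\<close> the derivative of \<open>t^j\<close> is \<open>t^(j-1)\<close>,
  so \<open>y_2\<close> shows up already in degree \<open>j + 1\<close>. When
  \<open>y_2 = 0\<close>, the first change is \<open>y_3\<close> in degree \<open>j + 2\<close>;
  thus \<open>t + t^2\<close> and \<open>t + t^3\<close> reach both parities.\<close>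

lemma one_plus_odd_power_compose:
  fixes y :: "bit fps"
  assumes "odd j" "fps_nth y 0 = 0" "fps_nth y 1 = 1"
  shows "agree (Suc j) ((1 + fps_X ^ j) oo y) (1 + fps_X ^ j)"
    "fps_nth ((1 + fps_X ^ j) oo y) (Suc j) = fps_nth y 2"
    "fps_nth ((1 + fps_X ^ j) oo y) (Suc (Suc j)) = fps_nth y 3 + of_nat (j div 2) * fps_nth y 2"
proof -
  obtain l where j: "j = 2 * l + 1" using assms(1) by (elim oddE)
  have u: "agree (2 * l) (fps_X ^ j) (0::bit fps)"
    by (auto simp: agree_def j)
  have uj: "agree j (fps_X ^ j) (0::bit fps)" by (simp add: agree_def)
  have eq: "(1 + fps_X ^ j) oo y = 1 + (fps_X ^ j oo y)"
    by (simp add: fps_compose_add_distrib)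
  have "agree j (fps_X ^ j oo y) 0" by (rule agree_0_compose[OF uj assms(2)])
  then show "agree (Suc j) ((1 + fps_X ^ j) oo y) (1 + fps_X ^ j)"
    using compose_nth_lead(1)[OF uj assms(2,3)] unfolding eq agree_Suc by (auto simp: agree_def)
  show "fps_nth ((1 + fps_X ^ j) oo y) (Suc j) = fps_nth y 2"
    using compose_nth_even(3)[OF u assms(2,3)] assms(1) unfolding eq by (auto simp: j)
  show "fps_nth ((1 + fps_X ^ j) oo y) (Suc (Suc j)) = fps_nth y 3 + of_nat (j div 2) * fps_nth y 2"
    using compose_nth_even(4)[OF u assms(2,3)] unfolding eq by (simp add: j numeral_3_eq_3)
qed

lemma interleave_agree_X:
  fixes P S :: "bit fps"
  assumes "agree p P 0" "agree p S 1"
  shows "agree (2 * p) (interleave P S) fps_X"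
  unfolding agree_def
proof safe
  fix k assume k: "k < 2 * p"
  then have "k div 2 < p" by simp
  then have "fps_nth P (k div 2) = 0" "fps_nth S (k div 2) = (if k div 2 = 0 then 1 else 0)"
    using assms by (simp_all add: agree_def)
  then show "fps_nth (interleave P S) k = fps_nth fps_X k"
    by (auto simp: interleave_def elim!: oddE)
qed

lemma agree_X_parts:
  fixes z :: "bit fps"
  assumes "agree p (even_part z) 0" "agree p (odd_part z) 1"
  shows "agree (2 * p) z fps_X"
proof -
  have "z = interleave (even_part z) (odd_part z)"
    by (rule fps_ext) (simp add: interleave_def nth_even_odd[of z])
  then show ?thesis using interleave_agree_X[OF assms] by simp
qed

lemma interleave_nth: "fps_nth (interleave P S) 0 = fps_nth P 0" "fps_nth (interleave P S) 1 = fps_nth S 0"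
  "fps_nth (interleave P S) (Suc 0) = fps_nth S 0"
  "fps_nth (interleave P S) 2 = fps_nth P 1" "fps_nth (interleave P S) 3 = fps_nth S 1"
  by (simp_all add: interleave_def)

text \<open>Here \<open>x = t + t^(2p-2)\<close> and \<open>y = t + t^3\<close>, and the commutator
  begins \<open>t + t^(2p)\<close>. Its odd part stays trivial up to degree \<open>2p - 2\<close>,
  so such elements can change even parts with little damage to odd parts.\<close>

lemma comm_even_exponent:
  assumes p: "p \<ge> 2" and x: "x = interleave (fps_X ^ (p - 1)) 1" and y: "y = interleave 0 (1 + fps_X)"
    and c: "c oo (x oo y) = y oo (x :: bit fps)"
  shows "agree (2 * p - 2) (odd_part c) 1" "agree p (even_part c) 0" "fps_nth (even_part c) p = 1"
proof -
  have x0: "fps_nth x 0 = 0" "fps_nth x 1 = 1" and y0: "fps_nth y 0 = 0" "fps_nth y 1 = 1"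
    and y2: "fps_nth y 2 = 0"
    using p by (simp_all add: x y interleave_nth)
  define g where "g = x oo y"
  have g0: "fps_nth g 0 = 0" "fps_nth g 1 = 1"
    using compose_carrier_nth[OF x0 y0] by (simp_all add: g_def)
  define P where "P = (fps_X ^ (p - 1) :: bit fps)"
  have ex: "even_part x = P" "odd_part x = 1" "even_part y = 0" "odd_part y = 1 + fps_X"
    by (simp_all add: x y P_def)
  have yx: "(1 + fps_X) oo x = 1 + x"
    using x0 by (simp add: fps_compose_add_distrib)
  note E = comm_equations[OF x0(1) y0(1) c, folded g_def, unfolded ex yx fps_compose_1 fps_compose_0
    mult_zero_left add_0_left add_0_right mult_1_left mult_1_right]
  have P: "agree (p - 1) P 0" by (simp add: P_def agree_def)
  have "agree (2 * (p - 1)) x fps_X"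
    unfolding x by (rule interleave_agree_X) (auto simp: agree_def)
  then have "agree (2 * p - 2) (1 + x) (1 + fps_X)"
    by (simp add: agree_def diff_mult_distrib2)
  then have "agree (2 * p - 2) ((1 + fps_X) * (odd_part c oo g)) ((1 + fps_X) * 1)"
    unfolding E(1) by simp
  then have C: "agree (2 * p - 2) (odd_part c oo g) 1"
    by (rule agree_mult_cancel) simp
  then show "agree (2 * p - 2) (odd_part c) 1"
    by (rule compose_lead_iff) (use g0 p in auto)
  have PC: "agree (p + 1) ((P oo y) * ((odd_part c oo g) + 1)) 0"
    using agree_0_mult[OF agree_0_compose[OF P y0(1)], of "2 * p - 2" "(odd_part c oo g) + 1"] C p
    by (simp add: agree_1_iff) (erule agree_mono, simp)
  have F: "even_part c oo g = (P oo y) * ((odd_part c oo g) + 1) + ((P oo y) + P + x * P)"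
  proof -
    have "even_part c oo g = (P oo y) * (odd_part c oo g) + P * (1 + x)"
      unfolding E(2)[symmetric] by (simp add: add_ac)
    then show ?thesis by (simp add: algebra_simps)
  qed
  have Fk: "fps_nth (even_part c oo g) k = fps_nth (P oo y) k + fps_nth P k + fps_nth (x * P) k" if "k < p + 1" for k
    using agreeD[OF PC that] by (simp add: F)
  have Sp: "Suc (p - 1) = p" using p by simp
  have lead: "fps_nth (P oo y) (p - 1) = 1" "fps_nth (P oo y) p = 0" "fps_nth (x * P) (p - 1) = 0"
    "fps_nth (x * P) p = 1" "fps_nth P (p - 1) = 1" "fps_nth P p = 0"
    using compose_nth_lead[OF P y0] mult_nth_lead[OF P, of x] x0 p unfolding Sp
    by (simp_all add: P_def y2)
  have xP: "agree (p - 1) (x * P) 0" using agree_mult[OF agree_refl P, of x] by simp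
  have "fps_nth (even_part c oo g) k = 0" if k: "k < p" for k
  proof (cases "k = p - 1")
    case True then show ?thesis using Fk[of k] lead p by simp
  next
    case False
    then have "k < p - 1" using k by simp
    then show ?thesis
      using Fk[of k] k agreeD[OF agree_0_compose[OF P y0(1)], of k] agreeD[OF P, of k] agreeD[OF xP, of k] by simp
  qed
  then have F0: "agree p (even_part c oo g) 0" by (simp add: agree_def)
  then show "agree p (even_part c) 0" by (rule compose_lead_iff_0) (use g0 in auto)
  show "fps_nth (even_part c) p = 1"
    using compose_lead_iff_0(2)[OF F0 g0] Fk[of p] lead by simp
qed

text \<open>Here \<open>x = t + t^(2a+1)\<close> and \<open>y = t + t^3\<close> have zero even part,
  hence so does their commutator; it begins \<open>t + t^(2a+5)\<close>.\<close>

lemma comm_odd_exponent_1: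
  assumes a: "odd a" "a \<ge> 3" and x: "x = interleave 0 (1 + fps_X ^ a)" and y: "y = interleave 0 (1 + fps_X)"
    and c: "c oo (x oo y) = y oo (x :: bit fps)"
  shows "even_part c = 0" "agree (a + 2) (odd_part c) 1" "fps_nth (odd_part c) (a + 2) = 1"
proof -
  define S where "S = (1 + fps_X ^ a :: bit fps)"
  have S0: "fps_nth S 0 = 1" using a by (simp add: S_def)
  have x0: "fps_nth x 0 = 0" "fps_nth x 1 = 1" and y0: "fps_nth y 0 = 0" "fps_nth y 1 = 1"
    "fps_nth y 2 = 0" "fps_nth y 3 = 1"
    using a by (auto simp: x y interleave_nth)
  define g where "g = x oo y"
  have g0: "fps_nth g 0 = 0" "fps_nth g 1 = 1"
    using compose_carrier_nth[OF x0 y0(1,2)] by (simp_all add: g_def)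
  have ex: "even_part x = 0" "odd_part x = S" "even_part y = 0" "odd_part y = 1 + fps_X"
    by (simp_all add: x y S_def)
  have yx: "(1 + fps_X) oo x = 1 + x"
    using x0 by (simp add: fps_compose_add_distrib)
  note E = comm_equations[OF x0(1) y0(1) c, folded g_def, unfolded ex yx fps_compose_0
    mult_zero_left add_0_left add_0_right]
  have "even_part c oo g = 0 oo g" using E(2) by simp
  then show "even_part c = 0"
    using fps_compose_inj_right[of g "even_part c" 0] g0 by simp
  have "agree (2 * a) x fps_X"
    unfolding x by (rule interleave_agree_X) (auto simp: agree_def)
  then have "agree (a + 3) (1 + x) (1 + fps_X)"
    using a by (auto simp: agree_def)
  then have "agree (a + 3) (S * (1 + x)) (S * (1 + fps_X))"
    by (intro agree_mult agree_refl)
  then have "agree (a + 3) ((1 + fps_X) * ((S oo y) * (odd_part c oo g))) ((1 + fps_X) * S)"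
    unfolding E(1)[symmetric] by (simp add: mult_ac)
  then have 1: "agree (Suc (a + 2)) ((S oo y) * (odd_part c oo g)) S"
    using agree_mult_cancel[of "a + 3" "1 + fps_X" "(S oo y) * (odd_part c oo g)" S] by (simp add: numeral_3_eq_3)
  note o = one_plus_odd_power_compose[OF a(1) y0(1,2), folded S_def]
  have "fps_nth S (Suc a) = 0" "fps_nth S (Suc (Suc a)) = 0" by (simp_all add: S_def)
  then have 2: "agree (a + 2) (S oo y) S"
    using o y0 by (simp add: agree_Suc)
  show "agree (a + 2) (odd_part c) 1" "fps_nth (odd_part c) (a + 2) = 1"
    using quotient_lead[OF 1 2 S0 _ g0] o(3) y0 \<open>fps_nth S (Suc (Suc a)) = 0\<close> by simp_all
qed

text \<open>Here \<open>x = t + t^(2r+1)\<close> and \<open>y = t + t^2\<close>. Both parts of the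
  commutator deviate in degree \<open>r + 1\<close>, so the desired \<open>t^(2r+3)\<close> is
  preceded by an undesired \<open>t^(2r+2)\<close>.\<close>

lemma comm_odd_exponent_2:
  assumes r: "odd r" "r \<ge> 3" and x: "x = interleave 0 (1 + fps_X ^ r)" and y: "y = interleave fps_X 1"
    and c: "c oo (x oo y) = y oo (x :: bit fps)"
  shows "agree (r + 1) (even_part c) 0" "fps_nth (even_part c) (r + 1) = 1"
    "agree (r + 1) (odd_part c) 1" "fps_nth (odd_part c) (r + 1) = 1"
proof -
  define S where "S = (1 + fps_X ^ r :: bit fps)"
  have S0: "fps_nth S 0 = 1" using r by (simp add: S_def)
  have x0: "fps_nth x 0 = 0" "fps_nth x 1 = 1" and y0: "fps_nth y 0 = 0" "fps_nth y 1 = 1"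
    "fps_nth y 2 = 1"
    using r by (auto simp: x y interleave_nth)
  define g where "g = x oo y"
  have g0: "fps_nth g 0 = 0" "fps_nth g 1 = 1"
    using compose_carrier_nth[OF x0 y0(1,2)] by (simp_all add: g_def)
  have ex: "even_part x = 0" "odd_part x = S" "even_part y = fps_X" "odd_part y = 1"
    by (simp_all add: x y S_def)
  note E = comm_equations[OF x0(1) y0(1) c, folded g_def, unfolded ex fps_X_fps_compose_startby0[OF x0(1)]
    fps_compose_0 fps_compose_1 mult_1_left mult_1_right mult_zero_left add_0_left add_0_right]
  have 1: "agree (Suc (r + 1)) ((S oo y) * (odd_part c oo g)) S"
    using E(1) by simp
  note o = one_plus_odd_power_compose[OF r(1) y0(1,2), folded S_def]
  have "fps_nth S (Suc r) = 0" by (simp add: S_def)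
  then show "agree (r + 1) (odd_part c) 1" "fps_nth (odd_part c) (r + 1) = 1"
    using quotient_lead[OF 1 _ S0 _ g0] o y0 by simp_all
  have "even_part c oo g = fps_X * (S oo y) * (odd_part c oo g) + x"
    using E(2) by (metis add.commute bit_fps_add_self_left)
  also have "fps_X * (S oo y) * (odd_part c oo g) = fps_X * S"
    using E(1) by (simp add: mult.assoc)
  finally have F: "even_part c oo g = fps_X * S + x" .
  have xX: "agree (2 * r) x fps_X"
    unfolding x by (rule interleave_agree_X) (auto simp: agree_def)
  have Fk: "fps_nth (even_part c oo g) k = (if k = r + 1 then 1 else 0)" if "k < 2 * r" for k
    using agreeD[OF xX that] r by (cases k) (auto simp: F S_def)
  have F0: "agree (r + 1) (even_part c oo g) 0"
    using Fk r by (auto simp: agree_def)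
  then show "agree (r + 1) (even_part c) 0"
    by (rule compose_lead_iff_0) (use g0 in auto)
  show "fps_nth (even_part c) (r + 1) = 1"
    using compose_lead_iff_0(2)[OF F0 g0] Fk[of "r + 1"] r by simp
qed

text \<open>Here \<open>x = t + t^(2r)\<close> and \<open>y = t + t^2\<close> both have odd part 1,
  hence so does their commutator, which begins \<open>t + t^(2r+2)\<close>. This cancels the
  undesired term of the preceding commutator.\<close>

lemma comm_odd_exponent_3:
  assumes r: "odd r" "r \<ge> 3" and x: "x = interleave (fps_X ^ r) 1" and y: "y = interleave fps_X 1"
    and c: "c oo (x oo y) = y oo (x :: bit fps)"
  shows "agree (r + 1) (even_part c) 0" "fps_nth (even_part c) (r + 1) = 1" "odd_part c = 1"
proof -
  define P where "P = (fps_X ^ r :: bit fps)"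
  have x0: "fps_nth x 0 = 0" "fps_nth x 1 = 1" and y0: "fps_nth y 0 = 0" "fps_nth y 1 = 1"
    "fps_nth y 2 = 1"
    using r by (auto simp: x y interleave_nth)
  define g where "g = x oo y"
  have g0: "fps_nth g 0 = 0" "fps_nth g 1 = 1"
    using compose_carrier_nth[OF x0 y0(1,2)] by (simp_all add: g_def)
  have ex: "even_part x = P" "odd_part x = 1" "even_part y = fps_X" "odd_part y = 1"
    by (simp_all add: x y P_def)
  note E = comm_equations[OF x0(1) y0(1) c, folded g_def, unfolded ex fps_X_fps_compose_startby0[OF x0(1)]
    fps_compose_0 fps_compose_1 mult_1_left mult_1_right mult_zero_left add_0_left add_0_right]
  show "odd_part c = 1"
    using E(1) fps_compose_inj_right[of g "odd_part c" 1] g0 by simp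
  have "even_part c oo g = (P oo y) + fps_X + (x + P)"
    using E(2) unfolding E(1) by (metis add.commute bit_fps_add_self_left mult_1_right)
  then have F: "even_part c oo g = (P oo y) + P + (x + fps_X)" by (simp add: add_ac)
  have xX: "agree (2 * r) x fps_X"
    unfolding x by (rule interleave_agree_X) (auto simp: agree_def)
  have P: "agree r P 0" by (simp add: P_def agree_def)
  have "fps_nth (P oo y) r = 1" "fps_nth (P oo y) (Suc r) = 1"
    using compose_nth_lead[OF P y0(1,2)] y0 r by (auto simp: P_def elim!: oddE)
  moreover have "fps_nth (P oo y) k = 0" if "k < r" for k
    using agreeD[OF agree_0_compose[OF P y0(1)] that] by simp
  ultimately have Fk: "fps_nth (even_part c oo g) k = (if k = r + 1 then 1 else 0)" if "k < r + 2" for k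
    using agreeD[OF xX, of k] that r by (auto simp: F P_def less_Suc_eq)
  have F0: "agree (r + 1) (even_part c oo g) 0"
    using Fk r by (auto simp: agree_def)
  then show "agree (r + 1) (even_part c) 0"
    by (rule compose_lead_iff_0) (use g0 in auto)
  show "fps_nth (even_part c) (r + 1) = 1"
    using compose_lead_iff_0(2)[OF F0 g0] Fk[of "r + 1"] by simp
qed

lemma nottingham_lcs_lead_exists:
  assumes "n \<ge> 2"
  shows "\<exists>x\<in>nottingham_lcs n. fps_nth (even_part x) n = 1"
proof (cases "odd n")
  case True
  then have "interleave (fps_X ^ n) (1 + fps_X ^ (2 * n - 1)) \<in> nottingham_lcs n"
    using assms by (auto simp: nottingham_lcs_def agree_def)
  then show ?thesis by (rule bexI[rotated]) simp
next
  case False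
  then have "interleave (fps_X ^ n) (1 + fps_X ^ (2 * n - 2) + (if n = 2 then fps_X ^ 3 else 0)) \<in> nottingham_lcs n"
    using assms by (auto simp: nottingham_lcs_def agree_def)
  then show ?thesis by (rule bexI[rotated]) simp
qed

text \<open>By \<open>sift\<close> it suffices to realize every leading exponent that occurs in the
  next term: the even ones from \<open>2n + 2\<close> on, and \<open>2j + 1\<close> with
  \<open>j \<ge> 2n + 2\<close>, or \<open>j = 2n\<close> if \<open>n\<close> is even. Facts
  \<open>A\<close> to \<open>D\<close> supply them. Only commutators of Nottingham elements enter,
  so the result serves both lower central series.\<close>

lemma Nottingham_lower:
  assumes n: "n \<ge> 1" and K: "subgroup K Riordan" "rclosure K = K"
    and comm: "\<And>x y. x \<in> riordan_lcs n \<inter> Nottingham \<Longrightarrow> y \<in> Nottingham \<Longrightarrow> rcomm x y \<in> K"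
  shows "riordan_lcs (Suc n) \<inter> Nottingham \<subseteq> K"
proof -
  define L where "L = {f. f \<in> nottingham_lcs (Suc n) \<and> (1, f) \<in> K}"
  have L0: "fps_nth f 0 = 0" "fps_nth f 1 = 1" if "f \<in> L" for f
    using that nottingham_lcs_nth_0_1[of f "Suc n"] by (auto simp: L_def)
  have comm_L: "\<exists>c\<in>L. c oo (x oo y) = y oo x"
    if x: "x \<in> nottingham_lcs n" and y: "fps_nth y 0 = 0" "fps_nth y 1 = 1" for x y
  proof -
    have x0: "fps_nth x 0 = 0" "fps_nth x 1 = 1" using nottingham_lcs_nth_0_1[OF x n] by auto
    have xG: "(1, x) \<in> riordan_lcs n" using x by (simp add: riordan_lcs_iff)
    have xR: "(1, x) \<in> riordan_carrier" and yR: "(1, y) \<in> riordan_carrier" using x0 y by auto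
    obtain cg cf where c: "rcomm (1, x) (1, y) = (cg, cf)" "(cg, cf) \<in> riordan_carrier"
      "cf oo (x oo y) = y oo x" "1 * (1 oo y) * (cg oo (x oo y)) = 1 * (1 oo x)"
      using comm_components[OF xR yR] by blast
    have "cg oo (x oo y) = 1 oo (x oo y)" using c(4) by simp
    then have "cg = 1"
      using fps_compose_inj_right[of "x oo y" cg 1] compose_carrier_nth[OF x0 y] by simp
    moreover have "(cg, cf) \<in> riordan_lcs (Suc n)"
      using comm_riordan_lcs[OF n xG yR] c(1) by simp
    moreover have "(cg, cf) \<in> K"
      using comm[of "(1, x)" "(1, y)"] xG x0 y c(1) by (simp add: Nottingham_iff)
    ultimately have "cf \<in> L" by (simp add: L_def riordan_lcs_iff)
    then show ?thesis using c(3) by blast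
  qed
  have L_mult: "b oo a \<in> L" if "a \<in> L" "b \<in> L" for a b
  proof -
    have "(1, a) \<otimes>\<^bsub>Riordan\<^esub> (1, b) \<in> K \<inter> riordan_lcs (Suc n)"
      using that subgroup.m_closed[OF K(1), of "(1, a)" "(1, b)"]
        subgroup.m_closed[OF subgroup_riordan_lcs, of "Suc n" "(1, a)" "(1, b)"]
      by (simp add: L_def riordan_lcs_iff)
    then show ?thesis by (simp add: L_def riordan_lcs_iff)
  qed
  have A1: "\<exists>z\<in>L. agree p (even_part z) 0 \<and> fps_nth (even_part z) p = 1 \<and> agree (2 * p - 2) (odd_part z) 1"
    if p: "p \<ge> n + 2 \<or> n = 1 \<and> p \<ge> 2" for p
  proof -
    have p2: "p \<ge> 2" using p n by auto
    have "interleave (fps_X ^ (p - 1)) 1 \<in> nottingham_lcs n"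
      using p n by (auto simp: nottingham_lcs_def agree_def)
    then obtain c where c: "c \<in> L" "c oo (interleave (fps_X ^ (p - 1)) 1 oo interleave 0 (1 + fps_X)) =
        interleave 0 (1 + fps_X) oo (interleave (fps_X ^ (p - 1)) 1)"
      using comm_L[of "interleave (fps_X ^ (p - 1)) 1" "interleave 0 (1 + fps_X)"] by (auto simp: interleave_nth)
    then show ?thesis
      using comm_even_exponent[OF p2 refl refl c(2)] by blast
  qed
  have A: "\<exists>z\<in>L. agree p (even_part z) 0 \<and> fps_nth (even_part z) p = 1 \<and> agree p (odd_part z) 1" if p: "p \<ge> n + 1" for p
  proof (cases "p \<ge> n + 2 \<or> n = 1 \<and> p \<ge> 2")
    case True
    have "p \<le> 2 * p - 2" using True n by auto
    then show ?thesis using A1[OF True] agree_mono by blast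
  next
    \<comment> \<open>For \<open>n \<ge> 2\<close> and \<open>p = n + 1\<close> the series
      \<open>t + t^(2n)\<close> violates the relations of \<open>nottingham_lcs n\<close>. An
      element with leading even coefficient in degree \<open>n\<close> and the odd coefficients
      forced by it takes its place.\<close>
    case False
    then have n2: "n \<ge> 2" and pn: "p = n + 1" using p n by auto
    obtain x where x: "x \<in> nottingham_lcs n" "fps_nth (even_part x) n = 1" using nottingham_lcs_lead_exists[OF n2] by blast
    define y where "y = (interleave 0 (1 + fps_X) :: bit fps)"
    have y: "fps_nth y 0 = 0" "fps_nth y 1 = 1" "fps_nth y 2 = 0" "fps_nth y 3 = 1"
      by (simp_all add: y_def interleave_nth)
    obtain c where c: "c \<in> L" "c oo (x oo y) = y oo x" using comm_L[OF x(1) y(1,2)] by blast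
    note C = nottingham_comm_nth[OF n2 x(1) y(1,2) c(2)]
    have "fps_nth (even_part c) p = 1" using C(3) x y by (simp add: pn)
    then show ?thesis
      using c(1) C(2) agree_mono[OF C(1), of p] n2 by (auto simp: pn)
  qed
  have B: "\<exists>z\<in>L. agree (j + 1) (even_part z) 0 \<and> agree j (odd_part z) 1 \<and> fps_nth (odd_part z) j = 1"
    if j: "odd j" "j \<ge> 2 * n + 3" for j
  proof -
    define a where "a = j - 2"
    have a: "odd a" "a \<ge> 3" "a \<ge> 2 * n + 1" "a + 2 = j" using j n by (auto simp: a_def)
    have "interleave 0 (1 + fps_X ^ a) \<in> nottingham_lcs n"
      using a n by (auto simp: nottingham_lcs_def agree_def)
    then obtain c where c: "c \<in> L" "c oo (interleave 0 (1 + fps_X ^ a) oo interleave 0 (1 + fps_X)) =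
        interleave 0 (1 + fps_X) oo (interleave 0 (1 + fps_X ^ a))"
      using comm_L[of "interleave 0 (1 + fps_X ^ a)" "interleave 0 (1 + fps_X)"] by (auto simp: interleave_nth)
    show ?thesis
      using comm_odd_exponent_1[OF a(1,2) refl refl c(2)] c(1) unfolding a(4)
      by (intro bexI[of _ c]) simp_all
  qed
  have C: "\<exists>z\<in>L. agree (j + 1) (even_part z) 0 \<and> agree j (odd_part z) 1 \<and> fps_nth (odd_part z) j = 1"
    if j: "even j" "j \<ge> 2 * n + 2" for j
  proof -
    define r where "r = j - 1"
    have r: "odd r" "r \<ge> 3" "r \<ge> 2 * n + 1" "r + 1 = j" using j n by (auto simp: r_def)
    have "interleave 0 (1 + fps_X ^ r) \<in> nottingham_lcs n" "interleave (fps_X ^ r) 1 \<in> nottingham_lcs n"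
      using r n by (auto simp: nottingham_lcs_def agree_def)
    then obtain c d where c: "c \<in> L" "c oo (interleave 0 (1 + fps_X ^ r) oo interleave fps_X 1) =
        interleave fps_X 1 oo (interleave 0 (1 + fps_X ^ r))" and d: "d \<in> L" "d oo (interleave (fps_X ^ r) 1 oo interleave fps_X 1) =
        interleave fps_X 1 oo (interleave (fps_X ^ r) 1)"
      using comm_L[of "interleave 0 (1 + fps_X ^ r)" "interleave fps_X 1"] comm_L[of "interleave (fps_X ^ r) 1" "interleave fps_X 1"]
      by (auto simp: interleave_nth)
    note c' = comm_odd_exponent_2[OF r(1,2) refl refl c(2), unfolded r(4)]
    note d' = comm_odd_exponent_3[OF r(1,2) refl refl d(2), unfolded r(4)]
    \<comment> \<open>As \<open>d\<close> has odd part 1, composing it with \<open>c\<close> leaves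
      the odd part of \<open>c\<close> unchanged, while the two leading even coefficients in degree
      \<open>j\<close> cancel.\<close>
    have o: "odd_part (d oo c) = odd_part c" "even_part (d oo c) = (even_part d oo c) + even_part c"
      using parts_compose[OF L0(1)[OF c(1)], of d] d'(3) by simp_all
    have "agree j (even_part d oo c) 0" "fps_nth (even_part d oo c) j = 1"
      using agree_0_compose[OF d'(1) L0(1)[OF c(1)]] compose_nth_lead(1)[OF d'(1) L0[OF c(1)]] d'(2) by simp_all
    then have "agree (Suc j) (even_part (d oo c)) 0"
      using c'(1,2) unfolding o agree_Suc by (simp add: agree_def)
    then show ?thesis
      using c'(3,4) L_mult[OF c(1) d(1)] o(1) by (intro bexI[of _ "d oo c"]) simp_all
  qed
  txt \<open>The exponent \<open>4n + 1\<close> only arises from elements whose even part starts in degree \<open>n\<close>; the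
    even part of the resulting commutator is then removed by factors from \<open>A1\<close>, which do not
    affect the coefficient of \<open>t\<^bsup>4n+1\<^esup>\<close>.\<close>
  have D: "\<exists>z\<in>L. agree (2 * n + 1) (even_part z) 0 \<and> agree (2 * n) (odd_part z) 1 \<and> fps_nth (odd_part z) (2 * n) = 1"
    if "even n"
  proof -
    have n2: "n \<ge> 2" using that n by auto
    have *: "\<exists>z\<in>L. agree t (even_part z) 0 \<and> agree (2 * n) (odd_part z) 1 \<and> fps_nth (odd_part z) (2 * n) = 1" if "t \<ge> n + 2" for t
      using that
    proof (induction t rule: nat_induct_at_least)
      case base
      obtain x where x: "x \<in> nottingham_lcs n" "fps_nth (even_part x) n = 1" using nottingham_lcs_lead_exists[OF n2] by blast
      \<comment> \<open>For \<open>n = 2\<close> the additional \<open>t^3\<close> compensates the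
        exceptional summand \<open>y_2 * S_2\<close> in the coefficient \<open>n + 1\<close> of the
        even part, where \<open>S\<close> is the odd part of \<open>x\<close>; the coefficient
        \<open>2 * n\<close> of the odd part of the commutator is 1 in both cases.\<close>
      define y where "y = (interleave fps_X (1 + (if n = 2 then fps_X else 0)) :: bit fps)"
      have y: "fps_nth y 0 = 0" "fps_nth y 1 = 1" "fps_nth y 2 = 1" "fps_nth y 3 = (if n = 2 then 1 else 0)"
        by (simp_all add: y_def interleave_nth)
      have S: "fps_nth (odd_part x) (2 * n - 2) = 1" "fps_nth (odd_part x) (2 * n - 1) = (if n = 2 then 1 else 0)"
        using x n2 \<open>even n\<close> by (auto simp: nottingham_lcs_def)
      have par: "(of_nat n :: bit) = 0" "(of_nat (n - 1) :: bit) = 1"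
        using n2 \<open>even n\<close> by (auto simp: of_nat_diff elim!: evenE)
      obtain c where c: "c \<in> L" "c oo (x oo y) = y oo x" using comm_L[OF x(1) y(1,2)] by blast
      note C = nottingham_comm_nth[OF n2 x(1) y(1,2) c(2)]
      have "fps_nth (even_part c) (n + 1) = 0"
        using C(3) x y S par by (cases "n = 2") simp_all
      then have "agree (n + 2) (even_part c) 0" using C(2) by (simp add: agree_Suc)
      moreover have "fps_nth (odd_part c) (2 * n) = 1"
        using C(4) x y S par by (cases "n = 2") simp_all
      ultimately show ?case using C(1) c(1) by blast
    next
      case (Suc t)
      then obtain z where z: "z \<in> L" "agree t (even_part z) 0" "agree (2 * n) (odd_part z) 1" "fps_nth (odd_part z) (2 * n) = 1"
        by blast
      show ?case
      proof (cases "fps_nth (even_part z) t = 0")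
        case True
        then show ?thesis using z by (auto simp: agree_Suc)
      next
        case False
        then have zt: "fps_nth (even_part z) t = 1" by simp
        obtain a where a: "a \<in> L" "agree t (even_part a) 0" "fps_nth (even_part a) t = 1" "agree (2 * t - 2) (odd_part a) 1"
          using A1[of t] Suc.hyps by blast
        note z0 = L0[OF z(1)]
        have "agree (2 * t - 2) (odd_part a oo z) 1"
          using agree_compose[OF a(4) agree_refl, of z] by simp
        then have oa: "agree (2 * n + 1) (odd_part a oo z) 1"
          by (rule agree_mono) (use Suc.hyps in simp)
        have o: "agree (2 * n + 1) (odd_part (a oo z)) (odd_part z)"
          using agree_mult[OF agree_refl oa, of "odd_part z"] by (simp add: parts_compose[OF z0(1)])
        then have "agree (2 * n) (odd_part (a oo z)) 1" "fps_nth (odd_part (a oo z)) (2 * n) = 1"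
          using z(3,4) agreeD[OF o, of "2 * n"] by (auto simp: agree_def)
        moreover have "agree (Suc t) (even_part (a oo z)) 0"
        proof -
          have oa0: "fps_nth (odd_part a oo z) 0 = 1" using agreeD[OF oa, of 0] by simp
          have e: "even_part (a oo z) = (even_part a oo z) + (odd_part a oo z) * even_part z"
            by (simp add: parts_compose[OF z0(1)] mult.commute)
          have "agree t ((odd_part a oo z) * even_part z) 0"
            using agree_mult[OF agree_refl z(2), of "odd_part a oo z"] by simp
          then show ?thesis
            unfolding e agree_Suc
            using agree_0_compose[OF a(2) z0(1)] compose_nth_lead(1)[OF a(2) z0] a(3)
              mult_nth_lead(1)[OF z(2), of "odd_part a oo z"] oa0 zt
            by (simp add: agree_def)
        qed
        ultimately show ?thesis using L_mult[OF z(1) a(1)] by blast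
      qed
    qed
    \<comment> \<open>Vanishing of the even part below degree \<open>2n + 1\<close> removes all even
      exponents up to \<open>4n\<close>, so that \<open>4n + 1\<close> becomes the leading
      exponent.\<close>
    show ?thesis using *[of "2 * n + 1"] n2 by simp
  qed
  show ?thesis
  proof (rule sift[OF K])
    show "subgroup (riordan_lcs (Suc n) \<inter> Nottingham) Riordan"
      by (rule R.subgroups_Inter_pair) (use subgroup_riordan_lcs subgroup_Nottingham in auto)
    show "fps_nth g 1 = 0" if "(g, f) \<in> riordan_lcs (Suc n) \<inter> Nottingham" for g f
      using that by (simp add: Nottingham_iff)
  next
    fix m g f
    assume m: "m \<ge> 1" and gf: "(g, f) \<in> riordan_lcs (Suc n) \<inter> Nottingham" and f: "agree (Suc m) f fps_X"
    have g: "g = 1" and fn: "f \<in> nottingham_lcs (Suc n)" using gf by (auto simp: Nottingham_iff riordan_lcs_iff)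
    have "\<exists>z\<in>L. agree (Suc m) z fps_X \<and> fps_nth z (Suc m) = fps_nth f (Suc m)"
    proof (cases "fps_nth f (Suc m) = 0")
      case True
      have "fps_X \<in> L"
        using fps_X_mem_nottingham_lcs[of "Suc n"] subgroup.one_closed[OF K(1)] by (simp add: L_def)
      then show ?thesis using True m by (intro bexI[of _ fps_X]) auto
    next
      case False
      then have f1: "fps_nth f (Suc m) = 1" by simp
      have evn: "agree (n + 1) (even_part f) 0" and odn: "agree (2 * n) (odd_part f) 1"
        using fn by (auto simp: nottingham_lcs_def)
      show ?thesis
      proof (cases "even (Suc m)")
        case True
        then obtain p where p: "Suc m = 2 * p" by (elim evenE)
        have "fps_nth (even_part f) p = 1" using f1 p by (simp add: even_part_nth)
        then have "p \<ge> n + 1" using agreeD[OF evn, of p] by (cases "p < n + 1") auto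
        from A[OF this] obtain z where "z \<in> L" "agree p (even_part z) 0" "fps_nth (even_part z) p = 1" "agree p (odd_part z) 1"
          by blast
        then show ?thesis
          using agree_X_parts[of p z] f1 p by (auto simp: even_part_nth)
      next
        case False
        then obtain j where j: "Suc m = 2 * j + 1" by (elim oddE)
        have oj: "fps_nth (odd_part f) j = 1" using f1 j by (simp add: odd_part_nth)
        have j1: "j \<ge> 1" using m j by simp
        have ej: "fps_nth (even_part f) k = 0" if "k \<le> j" for k
          using agreeD[OF f, of "2 * k"] that j by (simp add: even_part_nth)
        have j2: "j \<ge> 2 * n" using agreeD[OF odn, of j] oj j1 by (cases "j < 2 * n") auto
        have fc: "if odd (Suc n) then fps_nth (odd_part f) (2 * n + 1) = fps_nth (even_part f) (Suc n)
          else fps_nth (odd_part f) (2 * n) = fps_nth (even_part f) (Suc n) \<and>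
            fps_nth (odd_part f) (2 * n + 1) = (if Suc n = 2 then fps_nth (even_part f) (Suc n) else 0)"
        proof -
          have "2 * Suc n - 1 = 2 * n + 1" "2 * Suc n - 2 = 2 * n" "2 \<le> Suc n" using n by auto
          then show ?thesis using fn unfolding nottingham_lcs_def mem_Collect_eq by presburger
        qed
        \<comment> \<open>The even part of \<open>f\<close> vanishes up to degree \<open>j\<close>,
          and \<open>n + 1 \<le> 2 * n\<close>. So the right-hand sides in \<open>fc\<close> become
          zero, which excludes \<open>j = 2n + 1\<close> for every \<open>n\<close> and
          \<open>j = 2n\<close> for odd \<open>n\<close>.\<close>
        have en: "fps_nth (even_part f) (Suc n) = 0" using j2 n by (intro ej) simp
        have "j \<noteq> 2 * n + 1" using fc en oj by (auto split: if_splits)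
        moreover have "j = 2 * n \<Longrightarrow> even n" using fc en oj by (auto split: if_splits)
        ultimately consider "j = 2 * n" "even n" | "odd j" "j \<ge> 2 * n + 3" | "even j" "j \<ge> 2 * n + 2"
          using j2 by (cases "j = 2 * n"; cases "j = 2 * n + 2"; cases "even j"; force)
        then obtain z where z: "z \<in> L" "agree (j + 1) (even_part z) 0" "agree j (odd_part z) 1" "fps_nth (odd_part z) j = 1"
          using B C D by cases blast+
        have "agree (2 * j) z fps_X"
          using agree_X_parts[OF agree_mono[OF z(2)] z(3)] by simp
        moreover have "fps_nth z (2 * j) = 0"
          using agreeD[OF z(2), of j] by (simp add: even_part_nth)
        moreover have "fps_nth z (2 * j + 1) = 1"
          using z(4) by (simp add: odd_part_nth)
        ultimately show ?thesis
          using z(1) f1 j by (intro bexI[of _ z]) (auto simp: agree_Suc)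
      qed
    qed
    then obtain z where "z \<in> L" "agree (Suc m) z fps_X" "fps_nth z (Suc m) = fps_nth f (Suc m)" by blast
    then show "\<exists>g' f'. (g', f') \<in> K \<inter> (riordan_lcs (Suc n) \<inter> Nottingham) \<and> agree (Suc m) g' 1 \<and> agree (Suc m) f' fps_X \<and>
        fps_nth g' (Suc m) = fps_nth g (Suc m) \<and> fps_nth f' (Suc m) = fps_nth f (Suc m)"
      using L0 g by (intro exI[of _ 1] exI[of _ z]) (auto simp: L_def riordan_lcs_iff Nottingham_iff)
  qed
qed

text \<open>The commutator of \<open>(1 + t^j, t)\<close> with \<open>(1, y)\<close> is an Appell
  element \<open>(cg, t)\<close>, where \<open>cg oo y\<close> is the quotient of
  \<open>1 + t^j\<close> by its composition with \<open>y\<close>. For odd \<open>j\<close> its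
  leading exponent is \<open>j + 1\<close> if \<open>y = t + t^2\<close> and \<open>j + 2\<close> if
  \<open>y = t + t^3\<close>, so odd \<open>j\<close> suffice for all exponents.\<close>

lemma Appell_lower:
  assumes n: "n \<ge> 1" and K: "subgroup K Riordan" "rclosure K = K"
    and comm: "\<And>x y. x \<in> riordan_lcs n \<Longrightarrow> y \<in> riordan_carrier \<Longrightarrow> rcomm x y \<in> K"
  shows "Appell_m (2 * n - 1) \<subseteq> K"
proof (rule sift[OF K])
  show "subgroup (Appell_m (2 * n - 1)) Riordan"
    using Appell_m_normal by (simp add: R.normal_inv_iff)
  show "fps_nth g 1 = 0" if "(g, f) \<in> Appell_m (2 * n - 1)" for g f
    using that n by (auto simp: Appell_m_iff agree_def)
next
  fix m g f
  assume m: "m \<ge> 1" and gf: "(g, f) \<in> Appell_m (2 * n - 1)" and g: "agree (Suc m) g 1"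
  show "\<exists>g' f'. (g', f') \<in> K \<inter> Appell_m (2 * n - 1) \<and> agree (Suc m) g' 1 \<and> agree (Suc m) f' fps_X \<and>
        fps_nth g' (Suc m) = fps_nth g (Suc m) \<and> fps_nth f' (Suc m) = fps_nth f (Suc m)"
  proof (cases "fps_nth g (Suc m) = 0")
    case True
    then show ?thesis
      using subgroup.one_closed[OF K(1)] gf by (intro exI[of _ 1] exI[of _ fps_X]) (auto simp: Appell_m_iff)
  next
    case False
    then have g1: "fps_nth g (Suc m) = 1" by simp
    have f: "f = fps_X" using gf by (simp add: Appell_m_iff)
    have mn: "Suc m \<ge> 2 * n"
      using gf g1 m by (cases "Suc m < 2 * n") (auto simp: Appell_m_iff agree_def)
    define j where "j = (if odd m then m else m - 1)"
    define y where "y = (if odd m then interleave fps_X 1 else interleave 0 (1 + fps_X) :: bit fps)"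
    define S where "S = (1 + fps_X ^ j :: bit fps)"
    \<comment> \<open>For even \<open>m\<close> the exponent \<open>m + 1\<close> is odd, hence at
      least \<open>2n + 1\<close>, and \<open>j = m - 1\<close> still satisfies
      \<open>j \<ge> 2n - 1\<close>, as membership in the n-th term requires.\<close>
    have "Suc m \<noteq> 2 * n" if "even m" using that by presburger
    then have j: "odd j" "j \<ge> 2 * n - 1" using mn m by (auto simp: j_def)
    have y: "fps_nth y 0 = 0" "fps_nth y 1 = 1" by (auto simp: y_def interleave_nth)
    have S0: "fps_nth S 0 = 1" using odd_pos[OF j(1)] by (simp add: S_def)
    have x: "(S, fps_X) \<in> riordan_lcs n"
      using j n fps_X_mem_nottingham_lcs[OF n] by (auto simp: riordan_lcs_iff S_def agree_def)
    have xR: "(S, fps_X) \<in> riordan_carrier" and yR: "(1, y) \<in> riordan_carrier" using S0 y by auto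
    obtain cg cf where c: "rcomm (S, fps_X) (1, y) = (cg, cf)" "(cg, cf) \<in> riordan_carrier"
      "cf oo (fps_X oo y) = y oo fps_X" "1 * (S oo y) * (cg oo (fps_X oo y)) = S * (1 oo fps_X)"
      using comm_components[OF xR yR] by blast
    have "cf oo y = fps_X oo y" using c(3) y by simp
    then have cf: "cf = fps_X"
      using fps_compose_inj_right[of y cf fps_X] y by simp
    have 1: "agree (Suc (Suc m)) ((S oo y) * (cg oo y)) S"
      using c(4) y by simp
    note o = one_plus_odd_power_compose[OF j(1) y, folded S_def]
    have Sm: "fps_nth S (Suc m) = 0" using m by (auto simp: S_def j_def)
    have 2: "agree (Suc m) (S oo y) S \<and> fps_nth (S oo y) (Suc m) = 1"
    proof (cases "odd m")
      case True
      then show ?thesis using o by (simp add: j_def y_def interleave_nth)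
    next
      case False
      then have "Suc (Suc j) = Suc m" "Suc j = m" using m by (auto simp: j_def)
      moreover have "fps_nth S (Suc j) = 0" by (simp add: S_def)
      moreover have "fps_nth y 2 = 0" "fps_nth y 3 = 1" using False by (simp_all add: y_def interleave_nth)
      ultimately show ?thesis using o agree_Suc[of m "S oo y" S] by simp
    qed
    have cg: "agree (Suc m) cg 1" "fps_nth cg (Suc m) = 1"
      using quotient_lead[OF 1 conjunct1[OF 2] S0 _ y] conjunct2[OF 2] Sm by simp_all
    have "(cg, cf) \<in> K" using comm[OF x yR] c(1) by simp
    moreover have "(cg, cf) \<in> Appell_m (2 * n - 1)"
      using cf c(2) agree_mono[OF cg(1), of "2 * n"] mn n by (simp add: Appell_m_iff)
    ultimately show ?thesis
      using cg cf f g1 by (intro exI[of _ cg] exI[of _ cf]) auto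
  qed
qed

section \<open>Identification of both lower central series\<close>

lemma closed_comm_Nottingham:
  assumes n: "n \<ge> 1"
  shows "closed_comm (riordan_lcs n \<inter> Nottingham) Nottingham = riordan_lcs (Suc n) \<inter> Nottingham"
proof
  have "rcomm x y \<in> Nottingham" if "x \<in> Nottingham" "y \<in> Nottingham" for x y
    using that unfolding rcomm_def
    by (intro subgroup.m_closed[OF subgroup_Nottingham] subgroup.m_inv_closed[OF subgroup_Nottingham])
  moreover have "rcomm x y \<in> riordan_lcs (Suc n)" if "x \<in> riordan_lcs n" "y \<in> Nottingham" for x y
    using that subgroup.subset[OF subgroup_Nottingham] by (intro comm_riordan_lcs[OF n]) auto
  ultimately have "{rcomm x y |x y. x \<in> riordan_lcs n \<inter> Nottingham \<and> y \<in> Nottingham} \<subseteq> riordan_lcs (Suc n) \<inter> Nottingham"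
    by blast
  then show "closed_comm (riordan_lcs n \<inter> Nottingham) Nottingham \<subseteq> riordan_lcs (Suc n) \<inter> Nottingham"
    unfolding closed_comm_def
    by (intro Inter_lower)
      (use R.subgroups_Inter_pair[OF subgroup_riordan_lcs subgroup_Nottingham, of "Suc n"]
        closed_riordan_lcs_Nottingham[of "Suc n"] in auto)
  show "riordan_lcs (Suc n) \<inter> Nottingham \<subseteq> closed_comm (riordan_lcs n \<inter> Nottingham) Nottingham"
    unfolding closed_comm_def
  proof (rule Inter_greatest)
    fix K assume "K \<in> {K. subgroup K Riordan \<and> rclosure K = K \<and>
      {rcomm x y |x y. x \<in> riordan_lcs n \<inter> Nottingham \<and> y \<in> Nottingham} \<subseteq> K}"
    then show "riordan_lcs (Suc n) \<inter> Nottingham \<subseteq> K"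
      by (intro Nottingham_lower[OF n]) blast+
  qed
qed

text \<open>An element \<open>(g, f)\<close> is the product of \<open>(g, t)\<close> and
  \<open>(1, f)\<close>, so the lower bounds for the Appell and the Nottingham part can be applied
  to the two factors separately.\<close>

lemma closed_comm_riordan_lcs:
  assumes n: "n \<ge> 1"
  shows "closed_comm (riordan_lcs n) riordan_carrier = riordan_lcs (Suc n)"
proof
  show "closed_comm (riordan_lcs n) riordan_carrier \<subseteq> riordan_lcs (Suc n)"
    unfolding closed_comm_def
    by (intro Inter_lower) (use subgroup_riordan_lcs[of "Suc n"] closed_riordan_lcs[of "Suc n"] comm_riordan_lcs[OF n] in auto)
  show "riordan_lcs (Suc n) \<subseteq> closed_comm (riordan_lcs n) riordan_carrier"
    unfolding closed_comm_def
  proof (intro Inter_greatest subsetI)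
    fix K x assume K: "K \<in> {K. subgroup K Riordan \<and> rclosure K = K \<and>
      {rcomm x y |x y. x \<in> riordan_lcs n \<and> y \<in> riordan_carrier} \<subseteq> K}" and x: "x \<in> riordan_lcs (Suc n)"
    obtain g f where gf: "x = (g, f)" by fastforce
    have f: "f \<in> nottingham_lcs (Suc n)" using x by (simp add: gf riordan_lcs_iff)
    have f0: "fps_nth f 0 = 0" "fps_nth f 1 = 1" using nottingham_lcs_nth_0_1[OF f] by auto
    have sub: "subgroup K Riordan" "rclosure K = K"
      "\<And>x y. x \<in> riordan_lcs n \<Longrightarrow> y \<in> riordan_carrier \<Longrightarrow> rcomm x y \<in> K"
      using K by blast+
    have "(g, fps_X) \<in> Appell_m (2 * n - 1)"
      using x n by (auto simp: gf riordan_lcs_iff Appell_m_iff)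
    then have 1: "(g, fps_X) \<in> K" using Appell_lower[OF n sub] by blast
    have "(1, f) \<in> riordan_lcs (Suc n) \<inter> Nottingham"
      using f f0 by (simp add: riordan_lcs_iff Nottingham_iff)
    moreover have "riordan_lcs (Suc n) \<inter> Nottingham \<subseteq> K"
      using subgroup.subset[OF subgroup_Nottingham] by (intro Nottingham_lower[OF n sub(1,2)] sub(3)) auto
    ultimately have "(1, f) \<in> K" by blast
    from subgroup.m_closed[OF sub(1) 1 this] show "x \<in> K" by (simp add: gf)
  qed
qed

lemma gamma_riordan_carrier:
  assumes "n \<ge> 1"
  shows "gamma riordan_carrier n = riordan_lcs n"
proof -
  have "lcs_aux riordan_carrier k = riordan_lcs (Suc k)" for k
    by (induction k) (simp_all add: closed_comm_riordan_lcs riordan_lcs_1[unfolded One_nat_def])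
  then show ?thesis using assms by (simp add: gamma_def)
qed

lemma gamma_Nottingham:
  assumes "n \<ge> 1"
  shows "gamma Nottingham n = riordan_lcs n \<inter> Nottingham"
proof -
  have "Nottingham \<subseteq> riordan_lcs 1" using subgroup.subset[OF subgroup_Nottingham] unfolding riordan_lcs_1 by simp
  then have "lcs_aux Nottingham k = riordan_lcs (Suc k) \<inter> Nottingham" for k
    by (induction k) (auto simp: closed_comm_Nottingham)
  then show ?thesis using assms by (simp add: gamma_def)
qed

section \<open>The abelianization\<close>

text \<open>Cosets of a kernel are fibres, so every question about \<open>Rab\<close> turns into one
  about vectors in the explicit target of \<open>ab_map\<close>.\<close>

lemma F_R_eq: 
  assumes x: "x \<in> riordan_carrier"
  shows "F_R x = {z \<in> riordan_carrier. ab_map z = ab_map x}"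
proof -
  let ?H = "Zmod 2 \<times>\<times> Zmod 2 \<times>\<times> Zmod 2 \<times>\<times> Zmod 4"
  interpret h: group_hom Riordan ?H ab_map by (rule group_hom_ab_map)
  have xc: "x \<in> carrier Riordan" using x by simp
  have ker: "h \<in> riordan_lcs 2 \<longleftrightarrow> h \<in> carrier Riordan \<and> ab_map h = \<one>\<^bsub>?H\<^esub>" for h
    unfolding kernel_ab_map[symmetric] kernel_def by blast
  have F: "F_R x = riordan_lcs 2 #>\<^bsub>Riordan\<^esub> x"
    by (simp add: F_R_def gamma_riordan_carrier)
  show ?thesis
  proof (intro equalityI subsetI)
    fix z assume "z \<in> F_R x"
    then obtain h where h: "h \<in> riordan_lcs 2" "z = h \<otimes>\<^bsub>Riordan\<^esub> x" by (auto simp: F r_coset_def)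
    then have "z \<in> carrier Riordan" "ab_map z = ab_map x"
      using ker[of h] xc by (simp_all only: h.hom_mult R.m_closed h.H.l_one h.hom_closed)
    then show "z \<in> {z \<in> riordan_carrier. ab_map z = ab_map x}" by simp
  next
    fix z assume "z \<in> {z \<in> riordan_carrier. ab_map z = ab_map x}"
    then have z: "z \<in> carrier Riordan" "ab_map z = ab_map x" by auto
    have "z \<otimes>\<^bsub>Riordan\<^esub> inv\<^bsub>Riordan\<^esub> x \<in> riordan_lcs 2"
      unfolding ker using z xc by (simp only: h.hom_mult h.hom_inv R.inv_closed R.m_closed h.H.r_inv h.hom_closed)
    moreover have "z = z \<otimes>\<^bsub>Riordan\<^esub> inv\<^bsub>Riordan\<^esub> x \<otimes>\<^bsub>Riordan\<^esub> x"
      using z xc by (simp only: R.m_assoc R.inv_closed R.l_inv R.r_one)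
    ultimately show "z \<in> F_R x" unfolding F r_coset_def by blast
  qed
qed

lemma F_R_eq_iff:
  assumes "x \<in> riordan_carrier" "y \<in> riordan_carrier"
  shows "F_R x = F_R y \<longleftrightarrow> ab_map x = ab_map y"
  using assms by (auto simp only: F_R_eq)

lemma Rab_eq: "Rab = Riordan Mod riordan_lcs 2"
  by (simp add: Rab_def gamma_riordan_carrier)

lemma riordan_lcs_2_normal: "riordan_lcs 2 \<lhd> Riordan"
  using group_hom.normal_kernel[OF group_hom_ab_map] by (simp only: kernel_ab_map)

lemma group_hom_F_R: "group_hom Riordan Rab F_R"
proof -
  have "F_R \<in> hom Riordan (Riordan Mod riordan_lcs 2)"
    using normal.r_coset_hom_Mod[OF riordan_lcs_2_normal]
    by (simp add: F_R_def[abs_def] gamma_riordan_carrier)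
  then show ?thesis
    unfolding Rab_eq
    by (intro group_hom.intro group_hom_axioms.intro group_Riordan normal.factorgroup_is_group riordan_lcs_2_normal)
qed

lemma carrier_Rab: "carrier Rab = F_R ` riordan_carrier"
  by (auto simp: Rab_eq FactGroup_def RCOSETS_def F_R_def gamma_riordan_carrier)

lemma Z2_3_Z4_pow:
  "(p, q, r, s) [^]\<^bsub>Zmod 2 \<times>\<times> Zmod 2 \<times>\<times> Zmod 2 \<times>\<times> Zmod 4\<^esub> (n::nat) =
    (int n * p mod 2, int n * q mod 2, int n * r mod 2, int n * s mod 4)"
  by (induction n) (simp_all add: nat_pow_def distrib_right mod_add_right_eq mod_add_left_eq add.commute)

text \<open>Commutativity, the four orders, and unique representation with exponents below these
  orders together say that \<open>Rab\<close> is the direct product of the four cyclic subgroups.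
  All of this is verified on images under \<open>ab_map\<close>.\<close>

lemma Rab_presentation:
  defines "a \<equiv> F_R (1 + fps_X, fps_X)"
    and "b \<equiv> (\<lambda>i::nat. F_R (1, fps_X + fps_X ^ (i + 1)))"
  defines "c \<equiv> b 1 \<otimes>\<^bsub>Rab\<^esub> b 2"
  shows "comm_group Rab" "group.ord Rab a = 2" "group.ord Rab (b 1) = 4"
    "group.ord Rab c = 2" "group.ord Rab (b 4) = 2"
    "bij_betw (\<lambda>(i, j, k, l). a [^]\<^bsub>Rab\<^esub> i \<otimes>\<^bsub>Rab\<^esub> b 1 [^]\<^bsub>Rab\<^esub> j
                             \<otimes>\<^bsub>Rab\<^esub> c [^]\<^bsub>Rab\<^esub> k \<otimes>\<^bsub>Rab\<^esub> b 4 [^]\<^bsub>Rab\<^esub> l)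
               ({..<2::nat} \<times> {..<4::nat} \<times> {..<2::nat} \<times> {..<2::nat}) (carrier Rab)"
proof -
  let ?H = "Zmod 2 \<times>\<times> Zmod 2 \<times>\<times> Zmod 2 \<times>\<times> Zmod 4"
  interpret h: group_hom Riordan ?H ab_map by (rule group_hom_ab_map)
  interpret F: group_hom Riordan Rab F_R by (rule group_hom_F_R)
  have FR: "F_R x = F_R y \<longleftrightarrow> ab_map x = ab_map y" if "x \<in> carrier Riordan" "y \<in> carrier Riordan" for x y
    using that F_R_eq_iff by simp
  have F1: "\<one>\<^bsub>Rab\<^esub> = F_R \<one>\<^bsub>Riordan\<^esub>"
    by (rule F.hom_one[symmetric])
  show "comm_group Rab"
  proof (rule F.H.group_comm_groupI)
    fix u v assume "u \<in> carrier Rab" "v \<in> carrier Rab"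
    then obtain x y where xy: "u = F_R x" "v = F_R y" "x \<in> carrier Riordan" "y \<in> carrier Riordan"
      by (auto simp: carrier_Rab)
    have "ab_map (x \<otimes>\<^bsub>Riordan\<^esub> y) = ab_map (y \<otimes>\<^bsub>Riordan\<^esub> x)"
      using xy(3,4) by (simp only: h.hom_mult) (simp add: mult_DirProd' add.commute)
    then have "F_R (x \<otimes>\<^bsub>Riordan\<^esub> y) = F_R (y \<otimes>\<^bsub>Riordan\<^esub> x)"
      using xy(3,4) by (simp only: FR R.m_closed)
    then show "u \<otimes>\<^bsub>Rab\<^esub> v = v \<otimes>\<^bsub>Rab\<^esub> u"
      using xy(3,4) by (simp only: xy(1,2) F.hom_mult)
  qed
  have ordI: "group.ord Rab (F_R x) = d"
    if x: "x \<in> carrier Riordan" and "ab_map x = (p, q, r, s)"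
      and "\<And>n::nat. int n * p mod 2 = 0 \<and> int n * q mod 2 = 0 \<and> int n * r mod 2 = 0 \<and> int n * s mod 4 = 0 \<longleftrightarrow> d dvd n"
    for x d p q r s
  proof -
    have "F_R x [^]\<^bsub>Rab\<^esub> n = \<one>\<^bsub>Rab\<^esub> \<longleftrightarrow> d dvd n" for n :: nat
    proof -
      have "F_R x [^]\<^bsub>Rab\<^esub> n = F_R (x [^]\<^bsub>Riordan\<^esub> n)"
        using x by (simp only: F.hom_nat_pow)
      then have "F_R x [^]\<^bsub>Rab\<^esub> n = \<one>\<^bsub>Rab\<^esub> \<longleftrightarrow> ab_map (x [^]\<^bsub>Riordan\<^esub> n) = ab_map \<one>\<^bsub>Riordan\<^esub>"
        using x by (simp only: F1 FR R.nat_pow_closed R.one_closed)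
      also have "\<dots> \<longleftrightarrow> ab_map x [^]\<^bsub>?H\<^esub> n = \<one>\<^bsub>?H\<^esub>"
        using x by (simp only: h.hom_nat_pow h.hom_one)
      also have "\<dots> \<longleftrightarrow> d dvd n"
        unfolding that(2) Z2_3_Z4_pow using that(3)[of n] by simp
      finally show ?thesis .
    qed
    then show ?thesis
      using F.H.ord_unique[of "F_R x" d] x F.hom_closed by blast
  qed
  define xa xb xb2 xd where "xa = (1 + fps_X :: bit fps, fps_X :: bit fps)"
    and "xb = (1 :: bit fps, fps_X + fps_X ^ (1 + 1) :: bit fps)"
    and "xb2 = (1 :: bit fps, fps_X + fps_X ^ (2 + 1) :: bit fps)"
    and "xd = (1 :: bit fps, fps_X + fps_X ^ (4 + 1) :: bit fps)"
  have xR: "xa \<in> carrier Riordan" "xb \<in> carrier Riordan" "xb2 \<in> carrier Riordan" "xd \<in> carrier Riordan"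
    by (simp_all add: xa_def xb_def xb2_def xd_def)
  define xc where "xc = xb \<otimes>\<^bsub>Riordan\<^esub> xb2"
  have xcR: "xc \<in> carrier Riordan" unfolding xc_def using xR by (simp only: R.m_closed)
  have eq: "a = F_R xa" "b 1 = F_R xb" "b 4 = F_R xd" "c = F_R xc"
    using xR by (simp_all only: a_def b_def c_def xa_def xb_def xb2_def xd_def xc_def F.hom_mult)
  have phi: "ab_map xa = (1, 0, 0, 0)" "ab_map xb = (0, 0, 0, 1)" "ab_map xb2 = (0, 1, 0, 1)" "ab_map xd = (0, 0, 1, 2)"
    by (simp_all add: xa_def xb_def xb2_def xd_def ab_map_def)
  \<comment> \<open>The element \<open>b 2\<close> has order 4, since the last entry of its vector
    is 1. Multiplication by \<open>b 1\<close> raises that entry to 2, which makes \<open>c\<close>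
    a generator of order 2.\<close>
  have phic: "ab_map xc = (0, 1, 0, 2)"
    unfolding xc_def using xR by (simp only: h.hom_mult phi) simp
  show "group.ord Rab a = 2" "group.ord Rab (b 1) = 4" "group.ord Rab c = 2" "group.ord Rab (b 4) = 2"
    unfolding eq by (rule ordI[OF xR(1) phi(1)] ordI[OF xR(2) phi(2)] ordI[OF xcR phic] ordI[OF xR(4) phi(4)]; presburger)+
  define w where "w = (\<lambda>(i::nat, j::nat, k::nat, l::nat). xa [^]\<^bsub>Riordan\<^esub> i \<otimes>\<^bsub>Riordan\<^esub> xb [^]\<^bsub>Riordan\<^esub> j
       \<otimes>\<^bsub>Riordan\<^esub> xc [^]\<^bsub>Riordan\<^esub> k \<otimes>\<^bsub>Riordan\<^esub> xd [^]\<^bsub>Riordan\<^esub> l)"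
  have wR: "w t \<in> carrier Riordan" for t
    by (cases t) (simp only: w_def case_prod_conv R.m_closed R.nat_pow_closed xR xcR)
  have wF: "(\<lambda>(i, j, k, l). a [^]\<^bsub>Rab\<^esub> i \<otimes>\<^bsub>Rab\<^esub> b 1 [^]\<^bsub>Rab\<^esub> j
      \<otimes>\<^bsub>Rab\<^esub> c [^]\<^bsub>Rab\<^esub> k \<otimes>\<^bsub>Rab\<^esub> b 4 [^]\<^bsub>Rab\<^esub> l) = (\<lambda>t. F_R (w t))"
    by (auto simp only: fun_eq_iff w_def case_prod_conv eq F.hom_mult F.hom_nat_pow R.m_closed R.nat_pow_closed xR xcR
      split: prod.split)
  have wphi: "ab_map (w (i, j, k, l)) = (int i mod 2, int k mod 2, int l mod 2, (int j + 2 * int k + 2 * int l) mod 4)"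
    for i j k l
    unfolding w_def case_prod_conv
    by (simp only: h.hom_mult h.hom_nat_pow R.m_closed R.nat_pow_closed xR xcR phi phic Z2_3_Z4_pow mult_DirProd Zmod_simps)
      (simp add: mod_simps mult.commute)
  show "bij_betw (\<lambda>(i, j, k, l). a [^]\<^bsub>Rab\<^esub> i \<otimes>\<^bsub>Rab\<^esub> b 1 [^]\<^bsub>Rab\<^esub> j
                             \<otimes>\<^bsub>Rab\<^esub> c [^]\<^bsub>Rab\<^esub> k \<otimes>\<^bsub>Rab\<^esub> b 4 [^]\<^bsub>Rab\<^esub> l)
               ({..<2::nat} \<times> {..<4::nat} \<times> {..<2::nat} \<times> {..<2::nat}) (carrier Rab)"
    unfolding wF bij_betw_def
  proof
    show "inj_on (\<lambda>t. F_R (w t)) ({..<2} \<times> {..<4} \<times> {..<2} \<times> {..<2})"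
    proof (rule inj_onI)
      fix t u :: "nat \<times> nat \<times> nat \<times> nat"
      assume tu: "t \<in> {..<2} \<times> {..<4} \<times> {..<2} \<times> {..<2}" "u \<in> {..<2} \<times> {..<4} \<times> {..<2} \<times> {..<2}"
        and "F_R (w t) = F_R (w u)"
      then have e: "ab_map (w t) = ab_map (w u)" by (simp only: FR wR)
      obtain i j k l where t: "t = (i, j, k, l)" by (metis surj_pair)
      obtain i' j' k' l' where u: "u = (i', j', k', l')" by (metis surj_pair)
      from tu have b: "i < 2" "j < 4" "k < 2" "l < 2" "i' < 2" "j' < 4" "k' < 2" "l' < 2" by (auto simp: t u)
      from e have ikl: "i = i'" "k = k'" "l = l'" using b by (simp_all add: t u wphi)
      have "(int j + 2 * int k + 2 * int l) mod 4 = (int j' + 2 * int k + 2 * int l) mod 4"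
        using e ikl by (simp add: t u wphi)
      then have "j = j'" using b(2,6) by presburger
      then show "t = u" using ikl by (simp add: t u)
    qed
    show "(\<lambda>t. F_R (w t)) ` ({..<2} \<times> {..<4} \<times> {..<2} \<times> {..<2}) = carrier Rab"
    proof
      show "(\<lambda>t. F_R (w t)) ` ({..<2} \<times> {..<4} \<times> {..<2} \<times> {..<2}) \<subseteq> carrier Rab"
        using wR F.hom_closed by blast
      show "carrier Rab \<subseteq> (\<lambda>t. F_R (w t)) ` ({..<2} \<times> {..<4} \<times> {..<2} \<times> {..<2})"
      proof
        fix u assume "u \<in> carrier Rab"
        then obtain x where x: "u = F_R x" "x \<in> carrier Riordan" by (auto simp: carrier_Rab)
        obtain p q r s where f: "ab_map x = (p, q, r, s)" by (metis surj_pair)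
        have "ab_map x \<in> carrier ?H" using x(2) by (rule h.hom_closed)
        then have m: "0 \<le> p" "p < 2" "0 \<le> q" "q < 2" "0 \<le> r" "r < 2" "0 \<le> s" "s < 4"
          by (auto simp: f carrier_Zmod)
        \<comment> \<open>Each factor \<open>c\<close> and each factor \<open>b 4\<close> adds 2 to
          the last entry; the exponent of \<open>b 1\<close> has to compensate for this.\<close>
        define j where "j = nat ((s - 2 * q - 2 * r) mod 4)"
        let ?t = "(nat p, j, nat q, nat r)"
        have "ab_map (w ?t) = ab_map x"
        proof -
          have "((s - 2 * q - 2 * r) mod 4 + 2 * q + 2 * r) mod 4 = s"
            using m(7,8) by presburger
          then show ?thesis using m by (simp add: wphi f j_def)
        qed
        then have "F_R (w ?t) = u" using x wR by (simp only: FR)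
        moreover have "?t \<in> {..<2} \<times> {..<4} \<times> {..<2} \<times> {..<2}"
          using m by (auto simp: j_def nat_less_iff)
        ultimately show "u \<in> (\<lambda>t. F_R (w t)) ` ({..<2} \<times> {..<4} \<times> {..<2} \<times> {..<2})" by blast
      qed
    qed
  qed
qed

section \<open>Semidirect decomposition and conclusion\<close>

lemma gamma_semidirect:
  assumes n: "n \<ge> 2"
  shows "gamma riordan_carrier n = Appell_m (2 * n - 3) <#>\<^bsub>Riordan\<^esub> gamma Nottingham n"
    "Appell_m (2 * n - 3) \<lhd> (Riordan\<lparr>carrier := gamma riordan_carrier n\<rparr>)"
    "Appell_m (2 * n - 3) \<inter> gamma Nottingham n = {\<one>\<^bsub>Riordan\<^esub>}"
proof -
  have n1: "n \<ge> 1" using n by simp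
  \<comment> \<open>Membership in \<open>Appell_m m\<close> is congruence to 1 modulo
    \<open>t^(m+1)\<close>, so the index \<open>2n - 3\<close> belongs to the exponent
    \<open>2n - 2\<close>.\<close>
  have l: "Suc (2 * n - 3) = 2 * n - 2" using n by simp
  note g = gamma_riordan_carrier[OF n1] gamma_Nottingham[OF n1]
  show "gamma riordan_carrier n = Appell_m (2 * n - 3) <#>\<^bsub>Riordan\<^esub> gamma Nottingham n"
    unfolding g
  proof (intro equalityI subsetI)
    fix x assume x: "x \<in> riordan_lcs n"
    obtain u f where eq: "x = (u, f)" by fastforce
    have "(u, fps_X) \<in> Appell_m (2 * n - 3)" "(1, f) \<in> riordan_lcs n \<inter> Nottingham"
      using x nottingham_lcs_nth_0_1[of f n] n1 by (auto simp: eq riordan_lcs_iff Appell_m_iff Nottingham_iff l)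
    moreover have "x = (u, fps_X) \<otimes>\<^bsub>Riordan\<^esub> (1, f)" by (simp add: eq)
    ultimately show "x \<in> Appell_m (2 * n - 3) <#>\<^bsub>Riordan\<^esub> (riordan_lcs n \<inter> Nottingham)"
      unfolding set_mult_def by blast
  next
    fix x assume "x \<in> Appell_m (2 * n - 3) <#>\<^bsub>Riordan\<^esub> (riordan_lcs n \<inter> Nottingham)"
    then obtain p q where "p \<in> Appell_m (2 * n - 3)" "q \<in> riordan_lcs n" "q \<in> Nottingham" "x = p \<otimes>\<^bsub>Riordan\<^esub> q"
      unfolding set_mult_def by blast
    then show "x \<in> riordan_lcs n"
      by (cases p; cases q) (auto simp: riordan_lcs_iff Appell_m_iff Nottingham_iff l)
  qed
  have "Appell_m (2 * n - 3) \<subseteq> riordan_lcs n"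
    using fps_X_mem_nottingham_lcs[OF n1] by (auto simp: riordan_lcs_iff Appell_m_iff l)
  then show "Appell_m (2 * n - 3) \<lhd> (Riordan\<lparr>carrier := gamma riordan_carrier n\<rparr>)"
    unfolding g by (intro R.normal_restrict_supergroup subgroup_riordan_lcs n1 Appell_m_normal)
  show "Appell_m (2 * n - 3) \<inter> gamma Nottingham n = {\<one>\<^bsub>Riordan\<^esub>}"
    unfolding g using fps_X_mem_nottingham_lcs[OF n1] by (auto simp: riordan_lcs_iff Appell_m_iff Nottingham_iff)
qed

theorem theorem7:
  shows "(\<forall>n::nat. n \<ge> 2 \<longrightarrow>
            gamma riordan_carrier n = Appell_m (2*n - 3) <#>\<^bsub>Riordan\<^esub> gamma Nottingham n
          \<and> Appell_m (2*n - 3) \<lhd> (Riordan\<lparr>carrier := gamma riordan_carrier n\<rparr>)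
          \<and> Appell_m (2*n - 3) \<inter> gamma Nottingham n = {\<one>\<^bsub>Riordan\<^esub>})
    \<and> (Riordan\<lparr>carrier := gamma riordan_carrier 1\<rparr>) Mod gamma riordan_carrier 2
         \<cong> Zmod 2 \<times>\<times> Zmod 2 \<times>\<times> Zmod 2 \<times>\<times> Zmod 4
    \<and> (\<forall>i::nat. i \<ge> 2 \<and> even i \<longrightarrow>
         (Riordan\<lparr>carrier := gamma riordan_carrier i\<rparr>) Mod gamma riordan_carrier (i + 1)
           \<cong> Zmod 2 \<times>\<times> Zmod 2 \<times>\<times> Zmod 2 \<times>\<times> Zmod 2)
    \<and> (\<forall>i::nat. i > 1 \<and> odd i \<longrightarrow>
         (Riordan\<lparr>carrier := gamma riordan_carrier i\<rparr>) Mod gamma riordan_carrier (i + 1)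
           \<cong> Zmod 2 \<times>\<times> Zmod 2 \<times>\<times> Zmod 2 \<times>\<times> Zmod 2 \<times>\<times> Zmod 2 \<times>\<times> Zmod 2)
    \<and> (let a = F_R (1 + fps_X, fps_X);
           b = (\<lambda>i::nat. F_R (1, fps_X + fps_X ^ (i + 1)));
           c = b 1 \<otimes>\<^bsub>Rab\<^esub> b 2
       in comm_group Rab
          \<and> group.ord Rab a = 2 \<and> group.ord Rab (b 1) = 4
          \<and> group.ord Rab c = 2 \<and> group.ord Rab (b 4) = 2
          \<and> bij_betw (\<lambda>(i, j, k, l). a [^]\<^bsub>Rab\<^esub> i \<otimes>\<^bsub>Rab\<^esub> b 1 [^]\<^bsub>Rab\<^esub> j
                                   \<otimes>\<^bsub>Rab\<^esub> c [^]\<^bsub>Rab\<^esub> k \<otimes>\<^bsub>Rab\<^esub> b 4 [^]\<^bsub>Rab\<^esub> l)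
               ({..<2::nat} \<times> {..<4::nat} \<times> {..<2::nat} \<times> {..<2::nat}) (carrier Rab))"
proof (intro conjI allI impI)
  fix n :: nat assume "n \<ge> 2"
  note * = gamma_semidirect[OF this]
  show "gamma riordan_carrier n = Appell_m (2*n - 3) <#>\<^bsub>Riordan\<^esub> gamma Nottingham n"
    "Appell_m (2*n - 3) \<lhd> (Riordan\<lparr>carrier := gamma riordan_carrier n\<rparr>)"
    "Appell_m (2*n - 3) \<inter> gamma Nottingham n = {\<one>\<^bsub>Riordan\<^esub>}"
    by (rule *)+
next
  have "Riordan\<lparr>carrier := gamma riordan_carrier 1\<rparr> = Riordan"
    using gamma_riordan_carrier[of 1] unfolding riordan_lcs_1 by (simp add: Riordan_def)
  then show "(Riordan\<lparr>carrier := gamma riordan_carrier 1\<rparr>) Mod gamma riordan_carrier 2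
         \<cong> Zmod 2 \<times>\<times> Zmod 2 \<times>\<times> Zmod 2 \<times>\<times> Zmod 4"
    using riordan_lcs_quotients(1) gamma_riordan_carrier[of 2] by simp
next
  fix i :: nat assume i: "i \<ge> 2 \<and> even i"
  then show "(Riordan\<lparr>carrier := gamma riordan_carrier i\<rparr>) Mod gamma riordan_carrier (i + 1)
           \<cong> Zmod 2 \<times>\<times> Zmod 2 \<times>\<times> Zmod 2 \<times>\<times> Zmod 2"
    using riordan_lcs_quotients(2)[of i] gamma_riordan_carrier[of i] gamma_riordan_carrier[of "i + 1"] by simp
next
  fix i :: nat assume i: "i > 1 \<and> odd i"
  then show "(Riordan\<lparr>carrier := gamma riordan_carrier i\<rparr>) Mod gamma riordan_carrier (i + 1)
           \<cong> Zmod 2 \<times>\<times> Zmod 2 \<times>\<times> Zmod 2 \<times>\<times> Zmod 2 \<times>\<times> Zmod 2 \<times>\<times> Zmod 2"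
    using riordan_lcs_quotients(3)[of i] gamma_riordan_carrier[of i] gamma_riordan_carrier[of "i + 1"] by simp
next
  show "let a = F_R (1 + fps_X, fps_X);
           b = (\<lambda>i::nat. F_R (1, fps_X + fps_X ^ (i + 1)));
           c = b 1 \<otimes>\<^bsub>Rab\<^esub> b 2
       in comm_group Rab
          \<and> group.ord Rab a = 2 \<and> group.ord Rab (b 1) = 4
          \<and> group.ord Rab c = 2 \<and> group.ord Rab (b 4) = 2
          \<and> bij_betw (\<lambda>(i, j, k, l). a [^]\<^bsub>Rab\<^esub> i \<otimes>\<^bsub>Rab\<^esub> b 1 [^]\<^bsub>Rab\<^esub> j
                                   \<otimes>\<^bsub>Rab\<^esub> c [^]\<^bsub>Rab\<^esub> k \<otimes>\<^bsub>Rab\<^esub> b 4 [^]\<^bsub>Rab\<^esub> l)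
               ({..<2::nat} \<times> {..<4::nat} \<times> {..<2::nat} \<times> {..<2::nat}) (carrier Rab)"
    unfolding Let_def by (intro conjI Rab_presentation)
qed

end
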